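(* Let $\varphi\in\mathcal{S}_r$. Then the following are equivalent: (i) $\varphi\in\mathcal{C}$; (ii) $\mathcal{D}\varphi$ has a nonzero constant term and no zeros in $\mathbb{C}_0$; (iii) $\mathcal{F}\varphi$ has no zeros in $\mathbb{D}_0^\infty$; (iv) $\mathcal{F}\varphi$ has no zeros in $\mathbb{D}_2^\infty$.
   Context: $L^2=L^2(0,1)$. Every $\varphi\in L^2$ is identified with its odd $2$-periodic extension to $\mathbb{R}$. The periodic dilation system of $\varphi$ is $\{\varphi(kx):k=1,2,\dots\}$; it is complete if its linear span is dense in $L^2$. $\mathcal{C}$ is the set of $\varphi\in L^2$ whose periodic dilation system is complete. $\mathcal{S}_r$ is the class of step functions on $(0,1)$ (complex-valued, piecewise constant with finitely many jumps) all of whose jump discontinuities in $(0,1)$ are rational. Write $\varphi(x)=\sum_{n\ge1}a_n\sqrt2\sin(n\pi x)$ (Fourier–sine expansion). The Beurling–Wintner transform is the Dirichlet series $\mathcal{D}\varphi(s)=\sum_{n\ge1}a_nn^{-s}$ (for $\varphi\in\mathcal{S}_r$ it converges absolutely on $\mathbb{C}_0$, where $\mathbb{C}_\sigma=\{\mathrm{Re}\,s>\sigma\}$); its constant term is $a_1$. Let $p_j$ be the $j$-th prime; for $n=p_1^{\alpha_1}\cdots p_N^{\alpha_N}$ write $\mathbf z^{\alpha(n)}=z_1^{\alpha_1}\cdots z_N^{\alpha_N}$. Then $\mathcal{F}\varphi(\mathbf z)=\sum_{n\ge1}a_n\mathbf z^{\alpha(n)}$, which converges pointwise on $\mathbb{D}_2^\infty=\{\mathbf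 z=(z_1,z_2,\dots)\in\ell^2:|z_j|<1\ \forall j\}$. $\mathbb{D}_0^\infty$ is the set of points of $\mathbb{D}_2^\infty$ with only finitely many nonzero entries. *)

theory Defs
  imports "HOL-Analysis.Analysis" "HOL-Computational_Algebra.Primes" "HOL-Library.Infinite_Set"
begin

definition M01 :: "real measure" where
  "M01 = restrict_space lborel {0<..<1}"

definition L2 :: "(real \<Rightarrow> complex) \<Rightarrow> bool" where
  "L2 f \<longleftrightarrow> f \<in> borel_measurable M01 \<and> integrable M01 (\<lambda>x. (norm (f x))\<^sup>2)"

text \<open>Odd 2-periodic extension of a function given on (0,1) (value 0 on the null set of integers).\<close>
definition odd_ext :: "(real \<Rightarrow> complex) \<Rightarrow> real \<Rightarrow> complex" where
  "odd_ext \<phi> x = (let y = x - 2 * of_int \<lfloor>x / 2\<rfloor> in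
      if 0 < y \<and> y < 1 then \<phi> y else if 1 < y then - \<phi> (2 - y) else 0)"

definition dilation_complete :: "(real \<Rightarrow> complex) \<Rightarrow> bool" where
  "dilation_complete \<phi> \<longleftrightarrow> L2 \<phi> \<and>
     (\<forall>f. L2 f \<longrightarrow> (\<forall>e>0. \<exists>N c.
        (\<integral>x. (norm (f x - (\<Sum>k=1..N. c k * odd_ext \<phi> (real k * x))))\<^sup>2 \<partial>M01) < e))"

definition step_rat :: "(real \<Rightarrow> complex) \<Rightarrow> bool" where
  "step_rat \<phi> \<longleftrightarrow> (\<exists>P. finite P \<and> P \<subseteq> \<rat> \<and>
     (\<forall>x y. 0 < x \<longrightarrow> x < y \<longrightarrow> y < 1 \<longrightarrow> {x..y} \<inter> P = {} \<longrightarrow> \<phi> x = \<phi> y))"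

definition sine_coeff :: "(real \<Rightarrow> complex) \<Rightarrow> nat \<Rightarrow> complex" where
  "sine_coeff \<phi> n = (\<integral>x. \<phi> x * complex_of_real (sqrt 2 * sin (real n * pi * x)) \<partial>M01)"

definition BW :: "(real \<Rightarrow> complex) \<Rightarrow> complex \<Rightarrow> complex" where
  "BW \<phi> s = (\<Sum>n. sine_coeff \<phi> (Suc n) * (of_nat (Suc n)) powr (- s))"

text \<open>The j-th prime, 0-indexed: nth_prime 0 = 2.\<close>
definition nth_prime :: "nat \<Rightarrow> nat" where
  "nth_prime j = enumerate {p. prime p} j"

text \<open>Monomial z^alpha(n); coordinate z j corresponds to the prime nth_prime j
  (i.e. z 0 = z_1 of the paper).\<close>
definition monom_at :: "(nat \<Rightarrow> complex) \<Rightarrow> nat \<Rightarrow> complex" where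
  "monom_at z n = (\<Prod>j\<in>{j. nth_prime j dvd n}. z j ^ multiplicity (nth_prime j) n)"

definition Bohr_lift :: "(real \<Rightarrow> complex) \<Rightarrow> (nat \<Rightarrow> complex) \<Rightarrow> complex" where
  "Bohr_lift \<phi> z = (\<Sum>n. sine_coeff \<phi> (Suc n) * monom_at z (Suc n))"

definition D2inf :: "(nat \<Rightarrow> complex) set" where
  "D2inf = {z. summable (\<lambda>j. (norm (z j))\<^sup>2) \<and> (\<forall>j. norm (z j) < 1)}"

definition D0inf :: "(nat \<Rightarrow> complex) set" where
  "D0inf = {z \<in> D2inf. finite {j. z j \<noteq> 0}}"

end

theory Submission
  imports
    Defs
    "HOL-Complex_Analysis.Complex_Analysis"
    "HOL-Number_Theory.Number_Theory"
    "HOL-Computational_Algebra.Fundamental_Theorem_Algebra"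
    "HOL-Real_Asymp.Real_Asymp"
begin

text \<open>
  The sine coefficients of \<open>\<phi>\<close> are \<open>f n / n\<close> with \<open>f\<close> periodic modulo some \<open>N\<close>; everything is an
  assertion about \<open>f\<close>.

  If the Bohr lift has no zeros in finitely many variables, then \<open>f (n a) = \<chi>(a) f n\<close> for a single
  character \<open>\<chi>\<close> and all \<open>a\<close> coprime to \<open>N\<close>. Indeed, let \<open>a\<close> be a residue class whose primes have
  divergent sum of reciprocals. Put all variables belonging to a finite set of such primes, with sum of
  reciprocals \<open>M\<close>, equal to \<open>w\<close>; the logarithm of the resulting zero-free function on the unit disc has real part
  at most \<open>O(M)\<close>, so by Borel-Caratheodory its second Taylor coefficient is \<open>O(M)\<close>, whereas the \<open>M\<^sup>2\<close> term is a
  multiple of \<open>e\<^sub>0 e\<^sub>2 - e\<^sub>1\<^sup>2\<close>, where \<open>e\<^sub>i\<close> is the lift of \<open>n \<mapsto> f (n a\<^sup>i)\<close>. The remaining classes are reached by a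
  sieve, without \<open>L(1, \<chi>) \<noteq> 0\<close>.

  Consequently the Bohr lift is a product of the zero-free Euler product of \<open>\<chi>\<close> and a rational function in the
  variables \<open>z\<^sub>p\<close>, \<open>p dvd N\<close>. The Euler product is inverted by finite products, and the denominators are cleared,
  so cyclicity reduces to that of a polynomial \<open>Q\<close> without zeros in the polydisc. On each slice
  \<open>Q(w) / Q(r w) = \<Prod> (1 - b w) / (1 - r b w)\<close> with \<open>|b| \<le> 1\<close>, which tends to 1 in \<open>l\<^sup>2\<close> uniformly as \<open>r\<close> tends to 1.

  Finally, if the Dirichlet series has no zeros and nonzero constant term, then it is bounded below on smaller half planes,
  its Dirichlet inverse has coefficients \<open>O(n\<^sup>\<epsilon>)\<close>, and therefore the Bohr lift is invertible at points with
  finitely many nonzero coordinates.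
\<close>

subsection \<open>Completely multiplicative functions\<close>

text \<open>Dilating \<phi> by k multiplies its Bohr lift by the monomial of k, so completeness says
  that the lift is cyclic. The obstacle is that absence of zeros gives no lower bound, and
  \<open>Q(w) / Q(r w)\<close> is not uniformly close to 1 on the circle when \<open>Q\<close>
  vanishes somewhere on it. What survives is a pair of coefficient bounds: the absolute sum is at
  most \<open>2 ^ D\<close>, and the difference from 1 has all coefficients at most
  \<open>(2 ^ D - 1) * (1 - r)\<close>; together they control the square sum. They depend on the
  degree only, hence hold alike on all slices \<open>z_p = w * p powr (i t)\<close>, and
  orthogonality of the functions \<open>n powr (i t)\<close> in the mean over t turns a bound on
  every slice into one in several variables. The shift argument \<open>k\<close> of
  \<open>dsum\<close> carries the arithmetic: primes of one residue class act on it identically, so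
  arbitrarily many of them may share one variable, and the quadratic relation thus forced at every
  point spreads to all powers of the class by moving one further coordinate. Completeness excludes
  zeros on all of \<open>D2inf\<close> because evaluation there is a bounded functional.\<close>

definition cmf :: "(nat \<Rightarrow> 'a::comm_monoid_mult) \<Rightarrow> nat \<Rightarrow> 'a" where
  "cmf g n = (\<Prod>p\<in>#prime_factorization n. g p)"

lemma cmf_1 [simp]: "cmf g (Suc 0) = 1"
  by (simp add: cmf_def)

text \<open>Positivity matters: \<open>prime_factorization 0\<close> is empty, so
  \<open>cmf g 0 = 1\<close> whatever \<open>g\<close> is. Only the values of \<open>g\<close> at
  primes are seen, so later functions may be arbitrary off the primes.\<close>

lemma cmf_mult: "m > 0 \<Longrightarrow> n > 0 \<Longrightarrow> cmf g (m * n) = cmf g m * cmf g n"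
  by (simp add: cmf_def prime_factorization_mult)

lemma cmf_prime: "prime p \<Longrightarrow> cmf g p = g p"
  by (simp add: cmf_def prime_factorization_prime)

lemma cmf_prime_power: "prime p \<Longrightarrow> cmf g (p ^ k) = g p ^ k"
  by (simp add: cmf_def prime_factorization_prime_power)

lemma cmf_cong: "n > 0 \<Longrightarrow> (\<And>p. prime p \<Longrightarrow> p dvd n \<Longrightarrow> g p = h p) \<Longrightarrow> cmf g n = cmf h n"
  unfolding cmf_def by (intro arg_cong[of _ _ prod_mset] image_mset_cong) (auto simp: in_prime_factors_iff)

lemma cmf_mult_fun: "cmf (\<lambda>p. g p * h p) n = cmf g n * cmf h n"
  by (simp add: cmf_def prod_mset.distrib)

lemma norm_prod_mset:
  fixes g :: "'b \<Rightarrow> 'a::real_normed_field"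
  shows "norm (\<Prod>x\<in>#M. g x) = (\<Prod>x\<in>#M. norm (g x))"
  by (induction M) (auto simp: norm_mult)

lemma norm_cmf: "norm (cmf g n) = cmf (\<lambda>p. norm (g p)) n" for g :: "nat \<Rightarrow> 'a::real_normed_field"
  by (simp add: cmf_def norm_prod_mset)

definition bigomega :: "nat \<Rightarrow> nat" where "bigomega n = size (prime_factorization n)"

lemma bigomega_mult: "m > 0 \<Longrightarrow> n > 0 \<Longrightarrow> bigomega (m * n) = bigomega m + bigomega n"
  by (simp add: bigomega_def prime_factorization_mult)

lemma cmf_scale: "cmf (\<lambda>p. c * g p) n = c ^ bigomega n * cmf g n"
  by (simp add: cmf_mult_fun) (simp add: cmf_def bigomega_def)

lemma cmf_unique:
  assumes "t 1 = 1" "\<And>m n. m > 0 \<Longrightarrow> n > 0 \<Longrightarrow> t (m * n) = t m * t n" "n > 0"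
  shows "t n = cmf t n"
  using assms(3)
proof (induction n rule: less_induct)
  case (less n)
  show ?case
  proof (cases "n = 1")
    case False
    then obtain p where p: "prime p" "p dvd n" using prime_factor_nat by blast
    then obtain m where m: "n = p * m" by auto
    with less.prems have "m > 0" "m < n" using p(1) prime_gt_1_nat[of p] by auto
    then show ?thesis
      using less.IH[of m] p(1) by (simp add: m assms(2) cmf_mult cmf_prime prime_gt_0_nat)
  qed (use assms(1) in auto)
qed

lemma cmf_of_nat: "n > 0 \<Longrightarrow> cmf of_nat n = (of_nat n :: 'a::comm_semiring_1)"
  by (rule cmf_unique[symmetric]) auto

lemma cmf_inverse_of_nat: "n > 0 \<Longrightarrow> cmf (\<lambda>p. 1 / of_nat p) n = (1 / of_nat n :: 'a::field_char_0)"
  by (rule cmf_unique[symmetric]) auto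

lemma cmf_div_of_nat:
  "n > 0 \<Longrightarrow> cmf (\<lambda>p. g p / of_nat p) n = (cmf g n / of_nat n :: 'a::field_char_0)"
  using cmf_mult_fun[of g "\<lambda>p. 1 / of_nat p" n] by (simp add: cmf_inverse_of_nat)

lemma cmf_powr: "n > 0 \<Longrightarrow> cmf (\<lambda>p. of_nat p powr s) n = (of_nat n powr s :: complex)"
  by (rule cmf_unique[symmetric]) (auto simp: powr_times_real)

lemma cmf_eq_0:
  fixes g :: "nat \<Rightarrow> 'a::field"
  shows "prime p \<Longrightarrow> p dvd n \<Longrightarrow> n > 0 \<Longrightarrow> g p = 0 \<Longrightarrow> cmf g n = 0"
  by (auto simp: cmf_def prod_mset_zero_iff in_prime_factors_iff)

lemma prod_mset_nonneg_real:
  "(\<And>x. x \<in># M \<Longrightarrow> 0 \<le> (f x :: real)) \<Longrightarrow> 0 \<le> (\<Prod>x\<in>#M. f x)"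
  by (induction M) auto

lemma cmf_nonneg: "(\<And>p. prime p \<Longrightarrow> (g p :: real) \<ge> 0) \<Longrightarrow> cmf g n \<ge> 0"
  unfolding cmf_def by (rule prod_mset_nonneg_real) (auto simp: in_prime_factors_iff)

lemma prod_mset_mono_real:
  "(\<And>x. x \<in># M \<Longrightarrow> 0 \<le> (f x :: real) \<and> f x \<le> g x) \<Longrightarrow> (\<Prod>x\<in>#M. f x) \<le> (\<Prod>x\<in>#M. g x)"
proof (induction M)
  case (add x M)
  have "0 \<le> (\<Prod>x\<in>#M. f x)" using add.prems by (intro prod_mset_nonneg_real) auto
  moreover have "(\<Prod>x\<in>#M. f x) \<le> (\<Prod>x\<in>#M. g x)" using add by auto
  ultimately show ?case using add.prems[of x] by (auto intro!: mult_mono)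
qed auto

lemma cmf_mono: "(\<And>p. prime p \<Longrightarrow> 0 \<le> g p \<and> g p \<le> (h p :: real)) \<Longrightarrow> cmf g n \<le> cmf h n"
  unfolding cmf_def by (rule prod_mset_mono_real) (auto simp: in_prime_factors_iff)

section \<open>Absolutely convergent sums over completely multiplicative functions\<close>

abbreviation pos :: "nat set" where "pos \<equiv> {0<..}"

definition csum :: "(nat \<Rightarrow> 'a::real_normed_field) \<Rightarrow> bool" where
  "csum g \<longleftrightarrow> (\<lambda>n. norm (cmf g n)) summable_on pos"

lemma csum_norm: "csum g \<longleftrightarrow> csum (\<lambda>p. norm (g p))"
  by (simp add: csum_def norm_cmf abs_of_nonneg cmf_nonneg)

lemma csum_mono:
  assumes "csum h" "\<And>p. prime p \<Longrightarrow> norm (g p) \<le> norm (h p)"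
  shows "csum g"
  using assms(1) unfolding csum_def norm_cmf
  by (rule summable_on_comparison_test) (auto intro!: cmf_nonneg cmf_mono assms(2))

lemma abs_summable_on_times:
  fixes f :: "'i \<Rightarrow> 'a::real_normed_field" and g :: "'j \<Rightarrow> 'a"
  assumes "(\<lambda>x. norm (f x)) summable_on A" "(\<lambda>y. norm (g y)) summable_on B"
  shows "(\<lambda>z. norm (case z of (x,y) \<Rightarrow> f x * g y)) summable_on A \<times> B"
proof -
  have "(\<lambda>z. norm (f (fst z)) * norm (g (snd z))) summable_on A \<times> B"
  proof (rule summable_on_SigmaI)
    show "((\<lambda>y. norm (f (fst (x,y))) * norm (g (snd (x,y)))) has_sum norm (f x) * (\<Sum>\<^sub>\<infinity>y\<in>B. norm (g y))) B" for x
      using has_sum_cmult_right[OF has_sum_infsum[OF assms(2)], of "norm (f x)"] by simp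
    show "(\<lambda>x. norm (f x) * (\<Sum>\<^sub>\<infinity>y\<in>B. norm (g y))) summable_on A"
      by (rule summable_on_cmult_left[OF assms(1)])
  qed auto
  then show ?thesis by (simp add: case_prod_unfold norm_mult)
qed

lemma bij_betw_prime_power_times:
  assumes p: "prime (p::nat)"
  shows "bij_betw (\<lambda>(j,n). p ^ j * n) (UNIV \<times> {n\<in>pos. \<not> p dvd n}) pos"
proof (rule bij_betw_byWitness[where f' = "\<lambda>n. (multiplicity p n, n div p ^ multiplicity p n)"])
  have mu: "multiplicity p (p ^ j * n) = j" if "n > 0" "\<not> p dvd n" for j n
    using that p by (simp add: prime_elem_multiplicity_mult_distrib prime_elem_multiplicity_power_distrib
         not_dvd_imp_multiplicity_0)
  show "\<forall>a\<in>UNIV \<times> {n\<in>pos. \<not> p dvd n}.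
       (\<lambda>n. (multiplicity p n, n div p ^ multiplicity p n)) ((\<lambda>(j, n). p ^ j * n) a) = a"
    using mu p by (auto simp: prime_gt_0_nat)
  show "\<forall>a'\<in>pos. (\<lambda>(j, n). p ^ j * n) (multiplicity p a', a' div p ^ multiplicity p a') = a'"
    by (auto simp: multiplicity_dvd)
  show "(\<lambda>(j,n). p ^ j * n) ` (UNIV \<times> {n\<in>pos. \<not> p dvd n}) \<subseteq> pos"
    using p by (auto simp: prime_gt_0_nat)
  show "(\<lambda>n. (multiplicity p n, n div p ^ multiplicity p n)) ` pos \<subseteq> UNIV \<times> {n\<in>pos. \<not> p dvd n}"
  proof safe
    fix n :: nat assume n: "n > 0"
    show "n div p ^ multiplicity p n > 0"
      using n multiplicity_dvd[of p n] by (metis dvd_div_eq_0_iff not_gr_zero)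
    assume "p dvd n div p ^ multiplicity p n"
    then show False using n prime_gt_1_nat[OF p] multiplicity_decompose[of n p] by auto
  qed auto
qed

text \<open>Writing n as a power of \<open>p\<close> times a number prime to \<open>p\<close> splits
  the sum into a geometric series in \<open>norm x\<close> and a sum on which \<open>g\<close> and
  its update agree.\<close>

lemma csum_upd:
  fixes g :: "nat \<Rightarrow> 'a::real_normed_field"
  assumes p: "prime p" and g: "csum g" and x: "norm x < 1"
  shows "csum (g(p := x))"
proof -
  have geo: "(\<lambda>j. norm x ^ j) summable_on UNIV"
    using x by (intro summable_nonneg_imp_summable_on_strong) auto
  have "(\<lambda>n. norm (cmf g n)) summable_on {n\<in>pos. \<not> p dvd n}"
    using g unfolding csum_def by (rule summable_on_subset_banach) auto
  with geo have "(\<lambda>(j,n). norm (norm x ^ j * norm (cmf g n))) summable_on UNIV \<times> {n\<in>pos. \<not> p dvd n}"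
    using abs_summable_on_times[of "\<lambda>j. norm x ^ j" UNIV "\<lambda>n. norm (cmf g n)" "{n\<in>pos. \<not> p dvd n}"]
    by (simp add: case_prod_unfold)
  also have "?this \<longleftrightarrow> (\<lambda>a. norm (cmf (g(p := x)) ((\<lambda>(j,n). p ^ j * n) a))) summable_on UNIV \<times> {n\<in>pos. \<not> p dvd n}"
  proof (rule summable_on_cong, clarify)
    fix j n assume n: "n > (0::nat)" "\<not> p dvd n"
    have "cmf (g(p := x)) n = cmf g n" using n by (intro cmf_cong) auto
    then show "norm (norm x ^ j * norm (cmf g n)) = norm (cmf (g(p := x)) (p ^ j * n))"
      using n p by (simp add: cmf_mult prime_gt_0_nat cmf_prime_power norm_mult norm_power)
  qed
  also have "\<dots> \<longleftrightarrow> csum (g(p := x))"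
    unfolding csum_def by (rule summable_on_reindex_bij_betw[OF bij_betw_prime_power_times[OF p]])
  finally show ?thesis .
qed

lemma csum_finite:
  fixes g :: "nat \<Rightarrow> 'a::real_normed_field"
  assumes "finite {p. prime p \<and> g p \<noteq> 0}" "\<And>p. prime p \<Longrightarrow> norm (g p) < 1"
  shows "csum g"
proof -
  have "csum (\<lambda>p. if p \<in> A then g p else 0)" if "finite A" "\<forall>p\<in>A. prime p" for A
    using that
  proof (induction A rule: finite_induct)
    case empty
    have "(\<lambda>n. norm (cmf (\<lambda>p. 0::'a) n)) summable_on {1}" by simp
    also have "?this \<longleftrightarrow> (\<lambda>n. norm (cmf (\<lambda>p. 0::'a) n)) summable_on pos"
    proof (rule summable_on_cong_neutral)
      fix n :: nat assume "n \<in> pos - {1}"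
      then obtain p where "prime p" "p dvd n" using prime_factor_nat by blast
      then show "norm (cmf (\<lambda>p. 0::'a) n) = 0" using cmf_eq_0[of p n "\<lambda>_. 0::'a"] \<open>n \<in> pos - {1}\<close> by simp
    qed auto
    finally show ?case by (simp add: csum_def)
  next
    case (insert p A)
    have "csum ((\<lambda>p. if p \<in> A then g p else 0)(p := g p))"
      using insert assms(2) by (intro csum_upd) auto
    also have "(\<lambda>p. if p \<in> A then g p else 0)(p := g p) = (\<lambda>q. if q \<in> insert p A then g q else 0)"
      by auto
    finally show ?case .
  qed
  from this[OF assms(1)] have "csum (\<lambda>p. if prime p \<and> g p \<noteq> 0 then g p else 0)" by simp
  then show ?thesis by (rule csum_mono) auto
qed

text \<open>The Bohr lift, at the point with coordinates \<open>g p\<close>, of the shifted sequence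
  sending n to \<open>F (n * k)\<close>. The shift is a parameter because taking out one prime
  \<open>p\<close> replaces \<open>k\<close> by \<open>p * k\<close>.\<close>

definition dsum :: "(nat \<Rightarrow> 'a) \<Rightarrow> (nat \<Rightarrow> 'a) \<Rightarrow> nat \<Rightarrow> 'a::{banach,real_normed_field}" where
  "dsum F g k = (\<Sum>\<^sub>\<infinity>n\<in>pos. F (n * k) * cmf g n)"

lemma dsum_abs_summable:
  assumes "csum g" "\<And>n. norm (F n) \<le> B"
  shows "(\<lambda>n. norm (F (n * k) * cmf g n)) summable_on pos"
  using summable_on_cmult_right[OF assms(1)[unfolded csum_def], of B]
  by (rule summable_on_comparison_test) (auto simp: norm_mult intro!: mult_right_mono assms)

lemma dsum_summable:
  fixes F :: "nat \<Rightarrow> 'a::{banach,real_normed_field}"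
  assumes "csum g" "\<And>n. norm (F n) \<le> B"
  shows "(\<lambda>n. F (n * k) * cmf g n) summable_on pos"
  using dsum_abs_summable[where F=F and k=k, OF assms] by (rule abs_summable_summable)

lemma norm_dsum_le:
  assumes "csum g" "\<And>n. norm (F n) \<le> B"
  shows "norm (dsum F g k) \<le> B * (\<Sum>\<^sub>\<infinity>n\<in>pos. norm (cmf g n))"
proof -
  have "norm (dsum F g k) \<le> (\<Sum>\<^sub>\<infinity>n\<in>pos. norm (F (n * k) * cmf g n))"
    unfolding dsum_def by (rule norm_infsum_bound[OF dsum_abs_summable[where F=F, OF assms]])
  also have "\<dots> \<le> (\<Sum>\<^sub>\<infinity>n\<in>pos. B * norm (cmf g n))"
    by (rule infsum_mono[OF dsum_abs_summable[where F=F, OF assms]])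
      (auto simp: norm_mult intro!: mult_right_mono assms summable_on_cmult_right assms(1)[unfolded csum_def])
  finally show ?thesis by (simp add: infsum_cmult_right')
qed

text \<open>The terms with \<open>p\<close> dividing n, rewritten with n = p m, form the same sum
  with shift \<open>p * k\<close>, weighted by \<open>g p\<close>; the remaining terms are the sum
  at the point whose coordinate at \<open>p\<close> is 0.\<close>

lemma dsum_step:
  fixes F :: "nat \<Rightarrow> 'a::{banach,real_normed_field}"
  assumes p: "prime p" and g: "csum g" and B: "\<And>n. norm (F n) \<le> B"
  shows "dsum F (g(p := 0)) k = dsum F g k - g p * dsum F g (p * k)"
proof -
  let ?A = "{n\<in>pos. \<not> p dvd n}" and ?M = "(*) p ` pos"
  have un: "pos = ?A \<union> ?M" "?A \<inter> ?M = {}"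
    using p by (auto simp: prime_gt_0_nat dvd_def)
  have sm: "(\<lambda>n. F (n * k) * cmf g n) summable_on C" if "C \<subseteq> pos" for C
    using dsum_summable[where F=F, OF g B] that by (rule summable_on_subset_banach)
  have "dsum F g k = infsum (\<lambda>n. F (n * k) * cmf g n) (?A \<union> ?M)"
    unfolding dsum_def using un(1) by simp
  also have "\<dots> = infsum (\<lambda>n. F (n * k) * cmf g n) ?A + infsum (\<lambda>n. F (n * k) * cmf g n) ?M"
    by (rule infsum_Un_disjoint[OF sm sm un(2)]) (use un(1) in auto)
  also have "infsum (\<lambda>n. F (n * k) * cmf g n) ?M = (\<Sum>\<^sub>\<infinity>n\<in>pos. F (p * n * k) * cmf g (p * n))"
    using p by (subst infsum_reindex) (auto simp: inj_on_def o_def prime_gt_0_nat)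
  also have "\<dots> = (\<Sum>\<^sub>\<infinity>n\<in>pos. g p * (F (n * (p * k)) * cmf g n))"
    using p by (intro infsum_cong) (auto simp: cmf_mult prime_gt_0_nat cmf_prime mult_ac)
  also have "\<dots> = g p * dsum F g (p * k)"
    unfolding dsum_def by (rule infsum_cmult_right')
  also have "infsum (\<lambda>n. F (n * k) * cmf g n) ?A = dsum F (g(p := 0)) k"
    unfolding dsum_def
  proof (rule infsum_cong_neutral)
    fix n assume "n \<in> pos - ?A"
    then show "F (n * k) * cmf (g(p := 0)) n = 0" using p cmf_eq_0[of p n "g(p := 0)"] by auto
  next
    fix n assume n: "n \<in> ?A \<inter> pos"
    have "cmf (g(p := 0)) n = cmf g n" using n by (intro cmf_cong) auto
    then show "F (n * k) * cmf g n = F (n * k) * cmf (g(p := 0)) n" by simp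
  qed auto
  finally show ?thesis by simp
qed

text \<open>\<open>dsum_step\<close> read as a linear equation in the coordinate \<open>x\<close> of
  \<open>p\<close>. The updated point occurs on both sides, so iteration would produce the power
  series in \<open>x\<close>; the later recursions are instances of it.\<close>

lemma dsum_upd:
  fixes F :: "nat \<Rightarrow> 'a::{banach,real_normed_field}"
  assumes p: "prime p" and g: "csum g" and x: "norm x < 1" "g p = 0" and B: "\<And>n. norm (F n) \<le> B"
  shows "dsum F (g(p := x)) k = dsum F g k + x * dsum F (g(p := x)) (p * k)"
proof -
  have "csum (g(p := x))" by (rule csum_upd[OF p g x(1)])
  moreover have "(g(p := x))(p := 0) = g" using x(2) by auto
  ultimately have "dsum F g k = dsum F (g(p := x)) k - x * dsum F (g(p := x)) (p * k)"
    using dsum_step[where F=F and k=k, OF p _ B, of "g(p := x)"] by simp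
  then show ?thesis by simp
qed

lemma dsum_zero:
  fixes F :: "nat \<Rightarrow> 'a::{banach,real_normed_field}"
  shows "dsum F (\<lambda>_. 0) k = F k"
proof -
  have "dsum F (\<lambda>_. 0) k = (\<Sum>\<^sub>\<infinity>n\<in>{1}. F (n * k) * cmf (\<lambda>_. 0) n)"
    unfolding dsum_def
  proof (rule infsum_cong_neutral)
    fix n :: nat assume n: "n \<in> pos - {1}"
    then obtain p where "prime p" "p dvd n" using prime_factor_nat by blast
    then show "F (n * k) * cmf (\<lambda>_. 0) n = 0" using cmf_eq_0[of p n "\<lambda>_. 0::'a"] n by simp
  qed auto
  then show ?thesis by simp
qed

section \<open>Complex analysis: the second logarithmic coefficient of a zero-free function\<close>

lemma holomorphic_infsum:
  fixes h :: "'i \<Rightarrow> complex \<Rightarrow> complex"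
  assumes "open S" "\<And>i. i \<in> I \<Longrightarrow> h i holomorphic_on S"
    "\<And>i s. i \<in> I \<Longrightarrow> s \<in> S \<Longrightarrow> norm (h i s) \<le> M i" "M summable_on I"
  shows "(\<lambda>s. \<Sum>\<^sub>\<infinity>i\<in>I. h i s) holomorphic_on S"
proof (rule analytic_imp_holomorphic)
  show "(\<lambda>s. \<Sum>\<^sub>\<infinity>i\<in>I. h i s) analytic_on S"
    unfolding analytic_on_def
  proof
    fix z assume "z \<in> S"
    then obtain r where r: "r > 0" "cball z r \<subseteq> S" using assms(1) open_contains_cball by blast
    have ul: "uniform_limit (cball z r) (\<lambda>X s. \<Sum>i\<in>X. h i s) (\<lambda>s. \<Sum>\<^sub>\<infinity>i\<in>I. h i s) (finite_subsets_at_top I)"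
      using r by (intro Weierstrass_m_test_general[OF _ assms(4)] assms(3)) auto
    have "eventually (\<lambda>X. finite X \<and> X \<subseteq> I) (finite_subsets_at_top I)"
      by (rule eventually_finite_subsets_at_top_weakI) auto
    then have ev: "\<forall>\<^sub>F X in finite_subsets_at_top I. continuous_on (cball z r) (\<lambda>s. \<Sum>i\<in>X. h i s) \<and>
          (\<lambda>s. \<Sum>i\<in>X. h i s) holomorphic_on ball z r"
    proof (rule eventually_mono, intro conjI)
      fix X assume X: "finite X \<and> X \<subseteq> I"
      have "(\<lambda>s. \<Sum>i\<in>X. h i s) holomorphic_on S"
        using X assms(2) by (intro holomorphic_on_sum) auto
      then show "continuous_on (cball z r) (\<lambda>s. \<Sum>i\<in>X. h i s)" "(\<lambda>s. \<Sum>i\<in>X. h i s) holomorphic_on ball z r"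
        using r ball_subset_cball by (meson holomorphic_on_imp_continuous_on holomorphic_on_subset order_trans)+
    qed
    show "\<exists>\<epsilon>>0. (\<lambda>s. \<Sum>\<^sub>\<infinity>i\<in>I. h i s) holomorphic_on ball z \<epsilon>"
      using holomorphic_uniform_limit[OF ev ul] r(1) by auto
  qed
qed

text \<open>The left side is the second derivative at 0 of the logarithm \<open>L\<close> of
  \<open>\<Phi> / \<Phi> 0\<close>. The growth hypothesis says Re L < K, and a holomorphic function
  with \<open>L 0 = 0\<close> and real part below K is O(K) on smaller discs (Borel-Caratheodory);
  Cauchy's inequality does the rest.\<close>

lemma log_second_coeff_bound:
  assumes hol: "\<Phi> holomorphic_on ball 0 1" and nz: "\<And>z. norm z < 1 \<Longrightarrow> \<Phi> z \<noteq> 0"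
    and bd: "\<And>z. norm z < 1 \<Longrightarrow> norm (\<Phi> z) < norm (\<Phi> 0) * exp K"
  shows "norm (deriv (deriv \<Phi>) 0 / \<Phi> 0 - (deriv \<Phi> 0 / \<Phi> 0)\<^sup>2) \<le> 16 * K"
proof -
  have 0: "\<Phi> 0 \<noteq> 0" using nz[of 0] by simp
  have "(\<lambda>z. \<Phi> z / \<Phi> 0) holomorphic_on ball 0 1" using 0 by (intro holomorphic_intros hol) auto
  then obtain L0 where L0: "L0 holomorphic_on ball 0 1" "\<And>z. z \<in> ball 0 1 \<Longrightarrow> exp (L0 z) = \<Phi> z / \<Phi> 0"
    by (rule holomorphic_logarithm_exists[of "ball 0 1" _ 0, rotated 2]) (use nz 0 in auto)
  define L where "L = (\<lambda>z. L0 z - L0 0)"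
  have e0: "exp (L0 0) = 1" using L0(2)[of 0] 0 by simp
  have L: "L holomorphic_on ball 0 1" "L 0 = 0" "\<And>z. norm z < 1 \<Longrightarrow> \<Phi> z = \<Phi> 0 * exp (L z)"
    using L0 0 e0 by (auto simp: L_def exp_diff intro!: holomorphic_intros)
  have Re: "Re (L z) < K" if "norm z < 1" for z
  proof -
    have "norm (\<Phi> 0) * exp (Re (L z)) < norm (\<Phi> 0) * exp K"
      using bd[OF that] L(3)[OF that] by (simp add: norm_mult)
    then show ?thesis using 0 by simp
  qed
  have K: "K > 0" using Re[of 0] L(2) by simp
  have Kz: "2 * of_real K - L z \<noteq> 0" if "norm z < 1" for z
    using Re[OF that] K by (auto simp: complex_eq_iff)
  \<comment> \<open>The Moebius map taking the half plane Re < K to the unit disc and 0 to 0, so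
    that the Schwarz lemma applies to it.\<close>
  define w where "w = (\<lambda>z. L z / (2 * of_real K - L z))"
  have w1: "norm (w z) < 1" if "norm z < 1" for z
  proof -
    have "(norm (L z))\<^sup>2 < (norm (2 * of_real K - L z))\<^sup>2"
      using mult_strict_left_mono[OF Re[OF that] K]
      unfolding cmod_power2 by (simp add: power2_eq_square algebra_simps)
    then have "norm (L z) < norm (2 * of_real K - L z)" by (rule power2_less_imp_less) auto
    then show ?thesis using Kz[OF that] by (simp add: w_def norm_divide)
  qed
  have "w holomorphic_on ball 0 1" unfolding w_def using Kz by (intro holomorphic_intros L) auto
  then have wle: "norm (w z) \<le> norm z" if "norm z < 1" for z
    using Schwarz_Lemma(1)[of w z] w1 that L(2) by (simp add: w_def)
  \<comment> \<open>On the circle of radius 1/2, solving for \<open>L\<close> gives |L| = 2 K |w| /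
    |1 + w| with |w| \<le> 1/2, hence 2 K. Cauchy's inequality on this circle then yields 2! times 2
    K divided by 1/4, that is 16 K.\<close>
  have Lb: "norm (L z) \<le> 2 * K" if z: "norm z = 1/2" for z
  proof -
    have z1: "norm z < 1" using z by simp
    have w2: "norm (w z) \<le> 1/2" using wle[OF z1] z by simp
    have ne: "1 + w z \<noteq> 0"
    proof
      assume "1 + w z = 0"
      then have "w z = -1" by (simp add: add_eq_0_iff)
      then show False using w2 by simp
    qed
    have "L z = w z * (2 * of_real K - L z)" using Kz[OF z1] by (simp add: w_def)
    then have "L z * (1 + w z) = 2 * of_real K * w z" by (simp add: algebra_simps)
    then have "norm (L z) * norm (1 + w z) = 2 * K * norm (w z)"
      using K by (metis abs_of_pos norm_mult norm_of_real norm_numeral)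
    moreover have "norm (1 + w z) \<ge> 1/2" using norm_triangle_ineq2[of 1 "- w z"] w2 by simp
    ultimately have "norm (L z) * (1/2) \<le> 2 * K * (1/2)"
      using w2 K by (smt (verit) mult_left_mono mult_mono norm_ge_zero)
    then show ?thesis by simp
  qed
  have "norm ((deriv ^^ 2) L 0) \<le> fact 2 * (2 * K) / (1/2) ^ 2"
  proof (rule Cauchy_inequality)
    show "L holomorphic_on ball 0 (1/2)" by (rule holomorphic_on_subset[OF L(1)]) auto
    show "continuous_on (cball 0 (1/2)) L"
      by (rule holomorphic_on_imp_continuous_on, rule holomorphic_on_subset[OF L(1)]) auto
  qed (use Lb in auto)
  then have b: "norm (deriv (deriv L) 0) \<le> 16 * K" by (simp add: power2_eq_square numeral_2_eq_2)
  have dL: "(L has_field_derivative deriv L z) (at z)" if "norm z < 1" for z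
    using L(1) that by (intro holomorphic_derivI[of _ "ball 0 1"]) auto
  have d1: "deriv \<Phi> z = \<Phi> z * deriv L z" if "norm z < 1" for z
  proof (rule DERIV_imp_deriv)
    have "((\<lambda>z. \<Phi> 0 * exp (L z)) has_field_derivative \<Phi> z * deriv L z) (at z)"
      unfolding L(3)[OF that] by (rule derivative_eq_intros dL that refl)+ simp
    then show "(\<Phi> has_field_derivative \<Phi> z * deriv L z) (at z)"
      by (rule has_field_derivative_transform_within_open[where S = "ball 0 1"]) (use that in \<open>auto simp: L(3)[symmetric]\<close>)
  qed
  have d\<Phi>: "(\<Phi> has_field_derivative deriv \<Phi> z) (at z)" if "norm z < 1" for z
    using hol that by (intro holomorphic_derivI[of _ "ball 0 1"]) auto
  have ddL: "(deriv L has_field_derivative deriv (deriv L) 0) (at 0)"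
    using holomorphic_deriv[OF L(1)] by (intro holomorphic_derivI[of _ "ball 0 1"]) auto
  have "deriv (deriv \<Phi>) 0 = deriv \<Phi> 0 * deriv L 0 + deriv (deriv L) 0 * \<Phi> 0"
  proof (rule DERIV_imp_deriv)
    have "((\<lambda>z. \<Phi> z * deriv L z) has_field_derivative deriv \<Phi> 0 * deriv L 0 + deriv (deriv L) 0 * \<Phi> 0) (at 0)"
      by (rule DERIV_mult[OF d\<Phi> ddL]) auto
    then show "(deriv \<Phi> has_field_derivative deriv \<Phi> 0 * deriv L 0 + deriv (deriv L) 0 * \<Phi> 0) (at 0)"
      by (rule has_field_derivative_transform_within_open[where S = "ball 0 1"]) (use d1 in auto)
  qed
  then have "deriv (deriv \<Phi>) 0 / \<Phi> 0 - (deriv \<Phi> 0 / \<Phi> 0)\<^sup>2 = deriv (deriv L) 0"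
    using d1[of 0] 0 by (simp add: field_simps power2_eq_square)
  with b show ?thesis by simp
qed

text \<open>For differentiating the recursion of \<open>dsum_upd\<close> at the origin: the factor
  \<open>z\<close> lowers by one the order of the derivative of \<open>H\<close> that is
  needed.\<close>

lemma deriv_add_mult_self:
  assumes "F holomorphic_on ball 0 1" "G holomorphic_on ball 0 1" "H holomorphic_on ball 0 1"
    and eq: "\<And>z. norm z < 1 \<Longrightarrow> F z = G z + c * z * H z"
  shows "deriv F 0 = deriv G 0 + c * H 0" "deriv (deriv F) 0 = deriv (deriv G) 0 + 2 * c * deriv H 0"
proof -
  have d: "(u has_field_derivative deriv u z) (at z)" if "norm z < 1" "u holomorphic_on ball 0 1" for z u
    using that by (intro holomorphic_derivI[of _ "ball 0 1"]) auto
  have d1: "deriv F z = deriv G z + c * H z + c * z * deriv H z" if "norm z < 1" for z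
  proof (rule DERIV_imp_deriv)
    have "((\<lambda>z. G z + c * z * H z) has_field_derivative deriv G z + c * H z + c * z * deriv H z) (at z)"
      by (auto intro!: derivative_eq_intros d that assms)
    then show "(F has_field_derivative deriv G z + c * H z + c * z * deriv H z) (at z)"
      by (rule has_field_derivative_transform_within_open[where S = "ball 0 1"]) (use that eq in auto)
  qed
  from d1[of 0] show "deriv F 0 = deriv G 0 + c * H 0" by simp
  show "deriv (deriv F) 0 = deriv (deriv G) 0 + 2 * c * deriv H 0"
  proof (rule DERIV_imp_deriv)
    have "((\<lambda>z. deriv G z + c * H z + c * z * deriv H z) has_field_derivative
            deriv (deriv G) 0 + 2 * c * deriv H 0) (at 0)"
      by (auto intro!: derivative_eq_intros d assms holomorphic_deriv)
    then show "(deriv F has_field_derivative deriv (deriv G) 0 + 2 * c * deriv H 0) (at 0)"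
      by (rule has_field_derivative_transform_within_open[where S = "ball 0 1"]) (use d1 in auto)
  qed
qed

text \<open>The small primes of \<open>B\<close> are avoided by the Chinese remainder theorem, the others by counting.\<close>

lemma ex_residue_avoiding_primes:
  fixes N r :: nat
  assumes N: "N > 0" and B: "\<And>p. p \<in> B \<Longrightarrow> prime p \<and> coprime p N"
    and sm: "(\<lambda>p. 1 / real p) summable_on B"
  shows "\<exists>n>0. [n = r] (mod N) \<and> (\<forall>p\<in>B. \<not> p dvd n)"
proof -
  have fin_tail: "\<exists>y. \<forall>F. finite F \<longrightarrow> F \<subseteq> {p\<in>B. p > y} \<longrightarrow> (\<Sum>p\<in>F. 1 / real p) < e" if "e > 0" for e
  proof -
    have "((\<lambda>p. 1 / real p) has_sum infsum (\<lambda>p. 1 / real p) B) B" using sm by (rule has_sum_infsum)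
    then have "eventually (\<lambda>X. dist (\<Sum>p\<in>X. 1 / real p) (infsum (\<lambda>p. 1 / real p) B) < e) (finite_subsets_at_top B)"
      using that unfolding has_sum_def by (rule tendstoD)
    then obtain X where X: "finite X" "X \<subseteq> B" "\<And>Y. finite Y \<Longrightarrow> X \<subseteq> Y \<Longrightarrow> Y \<subseteq> B \<Longrightarrow>
         dist (\<Sum>p\<in>Y. 1 / real p) (infsum (\<lambda>p. 1 / real p) B) < e"
      unfolding eventually_finite_subsets_at_top by metis
    show ?thesis
    proof (intro exI[of _ "Max (insert 0 X)"] allI impI)
      fix F assume F: "finite F" "F \<subseteq> {p \<in> B. Max (insert 0 X) < p}"
      have "p \<notin> X" if "p \<in> F" for p
      proof
        assume "p \<in> X"
        then have "p \<le> Max (insert 0 X)" using X(1) by (intro Max_ge) auto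
        with that F(2) show False by (auto simp del: Max_insert)
      qed
      then have disj: "F \<inter> X = {}" by blast
      have le: "(\<Sum>p\<in>Y. 1 / real p) \<le> infsum (\<lambda>p. 1 / real p) B" if "finite Y" "Y \<subseteq> B" for Y
        by (rule finite_sum_le_infsum[OF sm that]) auto
      have "(\<Sum>p\<in>F. 1 / real p) + (\<Sum>p\<in>X. 1 / real p) = (\<Sum>p\<in>F \<union> X. 1 / real p)"
        using F X disj by (simp add: sum.union_disjoint)
      also have "\<dots> \<le> infsum (\<lambda>p. 1 / real p) B" using F X by (intro le) auto
      finally show "(\<Sum>p\<in>F. 1 / real p) < e"
        using X(3)[OF X(1) order_refl X(2)] le[OF X(1,2)] by (simp add: dist_real_def)
    qed
  qed
  obtain y where y: "\<And>F. finite F \<Longrightarrow> F \<subseteq> {p\<in>B. p > y} \<Longrightarrow> (\<Sum>p\<in>F. 1 / real p) < 1/2"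
    using fin_tail[of "1/2"] by auto
  define Bs where "Bs = {p\<in>B. p \<le> y}"
  have finBs: "finite Bs" unfolding Bs_def by (rule finite_subset[of _ "{..y}"]) auto
  define Q where "Q = \<Prod>Bs"
  have Qpos: "Q > 0" unfolding Q_def using B by (auto simp: Bs_def intro!: prod_pos prime_gt_0_nat)
  have "coprime N Q" unfolding Q_def using B by (auto simp: Bs_def coprime_commute intro!: prod_coprime_right)
  then obtain b where b: "[b = r] (mod N)" "[b = 1] (mod Q)"
    using binary_chinese_remainder_nat[of N Q r 1] by auto
  define D where "D = N * Q"
  have D: "D > 0" using N Qpos by (simp add: D_def)
  \<comment> \<open>A prime p of \<open>B\<close> divides at most \<open>J / p + 1\<close> of the
    first \<open>J\<close> terms. The summands 1 count the primes up to \<open>b' + D * J\<close>;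
    with this second threshold there are at most \<open>y2\<close> plus an eighth of
    \<open>b' / D + J\<close> of them.\<close>
  obtain y2 where y2: "\<And>F. finite F \<Longrightarrow> F \<subseteq> {p\<in>B. p > y2} \<Longrightarrow> (\<Sum>p\<in>F. 1 / real p) < 1 / (8 * real D)"
    using fin_tail[of "1 / (8 * real D)"] D by auto
  \<comment> \<open>Adding \<open>D\<close> keeps every term of the progression positive even if the
    residue \<open>b\<close> is 0.\<close>
  define b' where "b' = b + D"
  define t where "t = (\<lambda>i. b' + D * i)"
  have tpos: "t i > 0" for i using D by (simp add: t_def b'_def)
  have tr: "[t i = r] (mod N)" for i
  proof -
    have "t i = b + N * (Q * (1 + i))" by (simp add: t_def b'_def D_def algebra_simps)
    then show ?thesis using b(1) by (simp add: cong_def)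
  qed
  have tQ: "\<not> p dvd t i" if p: "p \<in> Bs" for p i
  proof
    assume "p dvd t i"
    have "t i = b + Q * (N * (1 + i))" by (simp add: t_def b'_def D_def algebra_simps)
    then have "[t i = 1] (mod Q)" using b(2) by (simp add: cong_def)
    moreover have "p dvd Q" unfolding Q_def using finBs p by (rule dvd_prodI)
    ultimately have "[t i = 1] (mod p)" by (meson cong_dvd_modulus_nat)
    with \<open>p dvd t i\<close> have "p dvd 1" by (meson cong_dvd_iff)
    then show False using B[of p] p prime_gt_1_nat[of p] by (auto simp: Bs_def)
  qed
  show ?thesis
  proof (rule ccontr)
    assume neg: "\<not> ?thesis"
    have ex: "\<exists>p\<in>B. p > y \<and> p dvd t i" for i
      using neg tpos tr tQ[unfolded Bs_def] by (metis (mono_tags, lifting) linorder_not_less mem_Collect_eq)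
    \<comment> \<open>If every term had a prime divisor in \<open>B\<close>, the first
      \<open>J\<close> terms would be covered by multiples of such primes: J/2 from the density,
      about J/8 from the rounding, which is too little for large \<open>J\<close>.\<close>
    have cnt: "real J \<le> real J / 2 + (real y2 + (real b' + real D * real J) / (8 * real D))" for J
    proof -
      define P where "P = {p\<in>B. p > y \<and> p \<le> b' + D * J}"
      have finP: "finite P" unfolding P_def by (rule finite_subset[of _ "{..b' + D * J}"]) auto
      have sub: "{..<J} \<subseteq> (\<Union>p\<in>P. {i\<in>{..<J}. p dvd t i})"
      proof
        fix i assume i: "i \<in> {..<J}"
        obtain p where p: "p \<in> B" "p > y" "p dvd t i" using ex by blast
        have "p \<le> t i" using p(3) tpos by (rule dvd_imp_le)
        also have "t i \<le> b' + D * J" using i by (auto simp: t_def)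
        finally show "i \<in> (\<Union>p\<in>P. {i\<in>{..<J}. p dvd t i})" using p i by (auto simp: P_def)
      qed
      have each: "real (card {i\<in>{..<J}. p dvd t i}) \<le> real J / real p + 1" if p: "p \<in> P" for p
      proof -
        have pp: "prime p" "coprime p N" using p B by (auto simp: P_def)
        have "coprime p Q" unfolding Q_def
        proof (rule prod_coprime_right)
          fix q assume "q \<in> Bs"
          then have "prime q" "q \<noteq> p" using B p by (auto simp: Bs_def P_def)
          then show "coprime p q" using pp(1) by (simp add: primes_coprime)
        qed
        then have cop: "coprime p D" using pp by (simp add: D_def)
        \<comment> \<open>The difference \<open>D\<close> is prime to p, so the indices of multiples
          of p are all congruent modulo p and are determined by their quotients.\<close>
        have inj: "inj_on (\<lambda>i. i div p) {i\<in>{..<J}. p dvd t i}"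
        proof (rule inj_onI)
          fix i j assume i: "i \<in> {i\<in>{..<J}. p dvd t i}" and j: "j \<in> {i\<in>{..<J}. p dvd t i}" and eq: "i div p = j div p"
          have "[t i = t j] (mod p)" using i j by (simp add: cong_def)
          then have "[D * i = D * j] (mod p)" unfolding t_def by (simp add: cong_add_lcancel_nat)
          then have "[i = j] (mod p)" using cop cong_mult_lcancel_nat[of D p i j] by (simp add: coprime_commute)
          then show "i = j" using eq by (metis cong_def div_mult_mod_eq)
        qed
        have "card {i\<in>{..<J}. p dvd t i} = card ((\<lambda>i. i div p) ` {i\<in>{..<J}. p dvd t i})"
          using inj by (simp add: card_image)
        also have "\<dots> \<le> card {..J div p}" by (intro card_mono) (auto intro!: div_le_mono)
        also have "\<dots> = J div p + 1" by simp
        finally show ?thesis using of_nat_div_le_of_nat[of J p, where 'a = real] by linarith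
      qed
      have "real J = real (card {..<J})" by simp
      also have "\<dots> \<le> real (card (\<Union>p\<in>P. {i\<in>{..<J}. p dvd t i}))"
        using sub finP by (intro of_nat_mono card_mono) auto
      also have "\<dots> \<le> real (\<Sum>p\<in>P. card {i\<in>{..<J}. p dvd t i})"
        using card_UN_le[OF finP] by (intro of_nat_mono) blast
      also have "\<dots> \<le> (\<Sum>p\<in>P. real J / real p + 1)" using each by (simp add: sum_mono)
      also have "\<dots> = real J * (\<Sum>p\<in>P. 1 / real p) + real (card P)"
        by (simp add: sum.distrib sum_distrib_left)
      also have "(\<Sum>p\<in>P. 1 / real p) \<le> 1/2" using y[of P] finP by (force simp: P_def)
      also have "real (card P) \<le> real y2 + (real b' + real D * real J) / (8 * real D)"
      proof -
        define P2 where "P2 = {p\<in>P. p > y2}"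
        have P2: "finite P2" using finP by (simp add: P2_def)
        have "P = {p\<in>P. p \<le> y2} \<union> P2" by (auto simp: P2_def)
        then have "card P \<le> card {p\<in>P. p \<le> y2} + card P2" by (metis card_Un_le)
        also have "{p\<in>P. p \<le> y2} \<subseteq> {1..y2}" using B prime_ge_1_nat by (auto simp: P_def)
        then have "card {p\<in>P. p \<le> y2} \<le> y2" using card_mono[of "{1..y2}"] by fastforce
        finally have 1: "card P \<le> y2 + card P2" by simp
        have "real (card P2) = (\<Sum>p\<in>P2. 1)" by simp
        also have "\<dots> \<le> (\<Sum>p\<in>P2. real (b' + D * J) * (1 / real p))"
        proof (rule sum_mono)
          fix p assume p: "p \<in> P2"
          then have "p \<le> b' + D * J" "p > 0" using B prime_gt_0_nat by (auto simp: P2_def P_def)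
          then have "real p \<le> real (b' + D * J)" "real p > 0" by (simp_all only: of_nat_le_iff of_nat_0_less_iff)
          then show "1 \<le> real (b' + D * J) * (1 / real p)" by simp
        qed
        also have "\<dots> = real (b' + D * J) * (\<Sum>p\<in>P2. 1 / real p)" by (simp add: sum_distrib_left)
        also have "\<dots> \<le> real (b' + D * J) * (1 / (8 * real D))"
          using y2[of P2] P2 by (intro mult_left_mono) (force simp: P2_def P_def)+
        finally show ?thesis using 1 by simp
      qed
      finally show ?thesis by (simp add: mult_left_mono)
    qed
    obtain J where J: "real J > 8 * (real y2 + real b')" using reals_Archimedean2 by blast
    have "(real b' + real D * real J) / (8 * real D) = real b' / (8 * real D) + real J / 8"
      using D by (simp add: field_simps)
    also have "real b' / (8 * real D) \<le> real b'"
      using D mult_left_mono[of 1 "8 * real D" "real b'"] by (simp add: pos_divide_le_eq)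
    finally have "real J \<le> real J / 2 + (real y2 + (real b' + real J / 8))" using cnt[of J] by linarith
    moreover have False if "x \<le> x / 2 + (u + (v + x / 8))" "8 * (u + v) < x" "0 \<le> x" for x u v :: real
      using that by (simp add: field_simps)
    ultimately show False using J of_nat_0_le_iff[of J, where 'a = real] by blast
  qed
qed

section \<open>Points with finitely many coordinates; uniqueness of coefficients\<close>

lemma continuous_on_infsum:
  fixes h :: "'i \<Rightarrow> 'b::topological_space \<Rightarrow> 'a::banach"
  assumes "\<And>i. i \<in> I \<Longrightarrow> continuous_on S (h i)"
    "\<And>i s. i \<in> I \<Longrightarrow> s \<in> S \<Longrightarrow> norm (h i s) \<le> M i" "M summable_on I"
  shows "continuous_on S (\<lambda>s. \<Sum>\<^sub>\<infinity>i\<in>I. h i s)"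
proof (rule uniform_limit_theorem)
  show "uniform_limit S (\<lambda>X s. \<Sum>i\<in>X. h i s) (\<lambda>s. \<Sum>\<^sub>\<infinity>i\<in>I. h i s) (finite_subsets_at_top I)"
    using assms by (intro Weierstrass_m_test_general) auto
  show "\<forall>\<^sub>F X in finite_subsets_at_top I. continuous_on S (\<lambda>s. \<Sum>i\<in>X. h i s)"
    using assms(1) by (intro eventually_finite_subsets_at_top_weakI continuous_on_sum) auto
qed auto

lemma holomorphic_cmf:
  assumes "\<And>p. prime p \<Longrightarrow> (\<lambda>z. G z p) holomorphic_on S"
  shows "(\<lambda>z. cmf (G z) n) holomorphic_on S"
proof -
  have "(\<lambda>z. \<Prod>p\<in>#M. G z p) holomorphic_on S" if "\<forall>p\<in>#M. prime p" for M
    using that by (induction M) (auto intro!: holomorphic_intros assms)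
  then show ?thesis unfolding cmf_def by (simp add: in_prime_factors_iff)
qed

lemma continuous_on_cmf:
  fixes G :: "'b::topological_space \<Rightarrow> nat \<Rightarrow> 'a::real_normed_field"
  assumes "\<And>p. prime p \<Longrightarrow> continuous_on S (\<lambda>z. G z p)"
  shows "continuous_on S (\<lambda>z. cmf (G z) n)"
proof -
  have "continuous_on S (\<lambda>z. \<Prod>p\<in>#M. G z p)" if "\<forall>p\<in>#M. prime p" for M
    using that by (induction M) (auto intro!: continuous_intros assms)
  then show ?thesis unfolding cmf_def by (simp add: in_prime_factors_iff)
qed

text \<open>\<open>adm g\<close> says that \<open>g p = z\<^sub>p / p\<close> for a point \<open>z\<close> of the polydisc with finitely many nonzero coordinates;
  then \<open>dsum f g 1\<close> is the Bohr lift at \<open>z\<close> of the sequence \<open>f n / n\<close>.\<close>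

definition adm :: "(nat \<Rightarrow> complex) \<Rightarrow> bool" where
  "adm g \<longleftrightarrow> finite {p. prime p \<and> g p \<noteq> 0} \<and> (\<forall>p. prime p \<longrightarrow> norm (g p) * real p < 1)"

lemma adm_norm_less_1: "adm g \<Longrightarrow> prime p \<Longrightarrow> norm (g p) < 1"
proof -
  assume "adm g" "prime p"
  then have "norm (g p) * real p < 1" "real p \<ge> 1" using prime_ge_1_nat[of p] by (auto simp: adm_def)
  then show ?thesis using mult_left_mono[of 1 "real p" "norm (g p)"] by simp
qed

lemma adm_csum: "adm g \<Longrightarrow> csum g"
proof (rule csum_finite)
  assume "adm g"
  then show "finite {p. prime p \<and> g p \<noteq> 0}" by (simp add: adm_def)
qed (rule adm_norm_less_1)

lemma adm_upd: "adm g \<Longrightarrow> norm x * real p < 1 \<Longrightarrow> adm (g(p := x))"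
proof -
  assume a: "adm g" "norm x * real p < 1"
  have "{q. prime q \<and> (g(p := x)) q \<noteq> 0} \<subseteq> insert p {p. prime p \<and> g p \<noteq> 0}" by auto
  moreover have "finite (insert p {p. prime p \<and> g p \<noteq> 0})" using a(1) by (simp add: adm_def)
  ultimately have "finite {q. prime q \<and> (g(p := x)) q \<noteq> 0}" by (rule finite_subset)
  with a show ?thesis by (simp add: adm_def)
qed

lemma adm_zero [simp]: "adm (\<lambda>_. 0)"
  by (simp add: adm_def)

lemma adm_scale: "adm g \<Longrightarrow> norm c \<le> 1 \<Longrightarrow> adm (\<lambda>p. c * g p)"
proof -
  assume a: "adm g" "norm c \<le> 1"
  have "finite {p. prime p \<and> c * g p \<noteq> 0}" using a by (auto simp: adm_def intro: rev_finite_subset)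
  moreover have "norm (c * g p) * real p < 1" if "prime p" for p
  proof -
    have "norm (c * g p) * real p \<le> 1 * (norm (g p) * real p)"
      unfolding norm_mult mult.assoc using a(2) by (intro mult_right_mono) auto
    then show ?thesis using a(1) that by (auto simp: adm_def intro: le_less_trans)
  qed
  ultimately show ?thesis by (auto simp: adm_def)
qed

lemma infsum_cmf_mono:
  fixes g h :: "nat \<Rightarrow> 'a::real_normed_field"
  assumes "csum h" "\<And>p. prime p \<Longrightarrow> norm (g p) \<le> norm (h p)"
  shows "(\<Sum>\<^sub>\<infinity>n\<in>pos. norm (cmf g n)) \<le> (\<Sum>\<^sub>\<infinity>n\<in>pos. norm (cmf h n))"
  using csum_mono[of h g] assms unfolding csum_def
  by (intro infsum_mono) (auto simp: norm_cmf intro!: cmf_mono)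

text \<open>Replaces the passage to the limit x = 0 when the constant is uniform in x.\<close>

lemma eq_0_if_small:
  assumes "r > 0" "\<And>x. 0 < x \<Longrightarrow> x \<le> r \<Longrightarrow> norm \<delta> \<le> x * (C::real)"
  shows "\<delta> = 0"
proof (rule ccontr)
  assume "\<delta> \<noteq> 0"
  define x where "x = min r (norm \<delta> / (2 * (\<bar>C\<bar> + 1)))"
  have x: "x > 0" "x \<le> r" using assms(1) \<open>\<delta> \<noteq> 0\<close> by (auto simp: x_def)
  have "norm \<delta> \<le> x * C" by (rule assms(2)[OF x])
  also have "\<dots> \<le> x * (\<bar>C\<bar> + 1)" using x by (intro mult_left_mono) auto
  also have "\<dots> \<le> norm \<delta> / (2 * (\<bar>C\<bar> + 1)) * (\<bar>C\<bar> + 1)" by (intro mult_right_mono) (auto simp: x_def)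
  also have "\<dots> = norm \<delta> / 2" by (simp add: field_simps)
  finally show False using \<open>\<delta> \<noteq> 0\<close> by simp
qed

text \<open>Uniqueness of coefficients, by induction over the prime factors of \<open>k\<close>: if
  the sum with shift m vanishes identically, \<open>dsum_step\<close> gives the same for the shift p
  m wherever \<open>g p\<close> is nonzero, and points with \<open>g p = 0\<close> are limits of
  those. At the origin the sum reduces to the coefficient itself.\<close>

lemma dsum_vanish_imp_zero:
  assumes B: "\<And>n. norm (H n) \<le> B" and z: "\<And>g. adm g \<Longrightarrow> dsum H g 1 = 0" and k: "k > 0"
  shows "H k = 0"
proof -
  have step: "\<forall>g. adm g \<longrightarrow> dsum H g (p * m) = 0" if p: "prime p" and m: "\<And>g. adm g \<Longrightarrow> dsum H g m = 0" for p m
  proof (intro allI impI)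
    have nz: "dsum H g (p * m) = 0" if "adm g" "g p \<noteq> 0" for g
    proof -
      have "adm (g(p := 0))" using that(1) by (rule adm_upd) simp
      with dsum_step[where F=H and k=m, OF p adm_csum[OF that(1)] B] m that show ?thesis by auto
    qed
    fix g assume g: "adm g"
    show "dsum H g (p * m) = 0"
    proof (cases "g p = 0")
      case True
      have pp: "real p \<ge> 2" using p prime_ge_2_nat[of p] by linarith
      \<comment> \<open>Half the admissible radius 1/p: the convergent sum at \<open>r\<close>
        dominates those at all smaller x, which gives a constant independent of x.\<close>
      define r where "r = 1 / (2 * real p)"
      have r: "0 < r" "r < 1" "r * real p < 1" using pp by (auto simp: r_def field_simps)
      have ch: "csum (g(p := of_real r))" using p adm_csum[OF g] r by (intro csum_upd) auto
      show ?thesis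
      proof (rule eq_0_if_small[OF r(1)])
        fix x assume x: "0 < x" "x \<le> r"
        have a: "adm (g(p := of_real x))" using g
        proof (rule adm_upd)
          have "x * real p \<le> r * real p" using x by (intro mult_right_mono) auto
          with r x show "norm (of_real x :: complex) * real p < 1" by simp
        qed
        have "dsum H g (p * m) = - (of_real x * dsum H (g(p := of_real x)) (p * (p * m)))"
          using dsum_upd[where F=H and x="of_real x" and k="p*m", OF p adm_csum[OF g] _ True B] nz[OF a] x r
          by (auto simp: add_eq_0_iff)
        then have "norm (dsum H g (p * m)) = x * norm (dsum H (g(p := of_real x)) (p * (p * m)))"
          using x by (simp add: norm_mult)
        also have "\<dots> \<le> x * (B * (\<Sum>\<^sub>\<infinity>n\<in>pos. norm (cmf (g(p := of_real x)) n)))"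
          using x by (intro mult_left_mono norm_dsum_le B adm_csum a) auto
        also have "\<dots> \<le> x * (B * (\<Sum>\<^sub>\<infinity>n\<in>pos. norm (cmf (g(p := complex_of_real r)) n)))"
          using x order_trans[OF norm_ge_zero B] by (intro mult_left_mono infsum_cmf_mono ch) auto
        finally show "norm (dsum H g (p * m)) \<le> x * (B * (\<Sum>\<^sub>\<infinity>n\<in>pos. norm (cmf (g(p := complex_of_real r)) n)))" .
      qed
    qed (use nz g in auto)
  qed
  have "\<forall>g. adm g \<longrightarrow> dsum H g k = 0"
    using k
  proof (induction k rule: less_induct)
    case (less k)
    show ?case
    proof (cases "k = 1")
      case False
      then obtain p where p: "prime p" "p dvd k" using prime_factor_nat by blast
      then obtain m where m: "k = p * m" by auto
      with less.prems have "m > 0" "m < k" using p(1) prime_gt_1_nat[of p] by auto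
      then show ?thesis using step[OF p(1), of m] less.IH[of m] m by auto
    qed (use z in auto)
  qed
  then have "dsum H (\<lambda>_. 0) k = 0" by simp
  then show ?thesis by (simp add: dsum_zero)
qed

section \<open>Periodic sequences and slices through many primes of one class\<close>

locale periodic_seq =
  fixes f :: "nat \<Rightarrow> complex" and N :: nat
  assumes N: "N > 0" and per: "f (n + N) = f n"
begin

lemma f_mod: "f (n mod N) = f n"
proof -
  have "f (m + j * N) = f m" for m j
    by (induction j) (use per in \<open>auto simp: add_ac, metis add.assoc add.commute\<close>)
  from this[of "n mod N" "n div N"] show ?thesis by simp
qed

lemma f_cong: "[m = n] (mod N) \<Longrightarrow> f m = f n"
  by (metis f_mod cong_def)

definition Bd :: real where "Bd = Max ((\<lambda>n. norm (f n)) ` {..<N})"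

lemma f_bound: "norm (f n) \<le> Bd"
proof -
  have "norm (f (n mod N)) \<le> Bd" unfolding Bd_def using N by (intro Max_ge) auto
  then show ?thesis by (simp add: f_mod)
qed

lemma Bd_nonneg: "Bd \<ge> 0"
  using order_trans[OF norm_ge_zero f_bound] .

text \<open>Periodicity enters here: the shift counts only modulo \<open>N\<close>, so all primes of
  one residue class act on \<open>dsum\<close> in the same way.\<close>

lemma dsum_cong_mod: "[k = l] (mod N) \<Longrightarrow> dsum f g k = dsum f g l"
  unfolding dsum_def by (intro infsum_cong) (metis f_cong cong_scalar_left)

definition slice :: "(nat \<Rightarrow> complex) \<Rightarrow> nat set \<Rightarrow> complex \<Rightarrow> nat \<Rightarrow> complex" where
  "slice g S w = (\<lambda>p. if p \<in> S then w / of_nat p else g p)"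

lemma slice_adm:
  assumes "adm g" "finite S" "norm w < 1"
  shows "adm (slice g S w)"
proof -
  have "{q. prime q \<and> slice g S w q \<noteq> 0} \<subseteq> S \<union> {p. prime p \<and> g p \<noteq> 0}" by (auto simp: slice_def)
  moreover have "finite (S \<union> {p. prime p \<and> g p \<noteq> 0})" using assms by (simp add: adm_def)
  ultimately have "finite {q. prime q \<and> slice g S w q \<noteq> 0}" by (rule finite_subset)
  moreover have "norm (slice g S w p) * real p < 1" if "prime p" for p
    using that assms by (auto simp: slice_def adm_def norm_divide)
  ultimately show ?thesis by (auto simp: adm_def)
qed

text \<open>The closed disc is allowed, unlike in \<open>slice_adm\<close>: w / p has modulus below
  1 even for |w| = 1. The sum at w = 1 can therefore serve as a majorant on the whole disc.\<close>

lemma slice_csum: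
  assumes "adm g" "finite S" "norm w \<le> 1"
  shows "csum (slice g S w)"
proof (rule csum_finite)
  have "{q. prime q \<and> slice g S w q \<noteq> 0} \<subseteq> S \<union> {p. prime p \<and> g p \<noteq> 0}" by (auto simp: slice_def)
  moreover have "finite (S \<union> {p. prime p \<and> g p \<noteq> 0})" using assms by (simp add: adm_def)
  ultimately show "finite {q. prime q \<and> slice g S w q \<noteq> 0}" by (rule finite_subset)
  fix p :: nat assume p: "prime p"
  have "norm w / real p < 1" using prime_gt_1_nat[OF p] assms(3) by simp
  then show "norm (slice g S w p) < 1" using p assms(1) by (auto simp: slice_def norm_divide adm_norm_less_1)
qed

lemma slice_norm_le: "norm w \<le> 1 \<Longrightarrow> norm (slice g S w p) \<le> norm (slice g S 1 p)"
  by (auto simp: slice_def norm_divide divide_right_mono)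

lemma slice_holomorphic:
  assumes "adm g" "finite S"
  shows "(\<lambda>w. dsum f (slice g S w) k) holomorphic_on ball 0 1"
  unfolding dsum_def
proof (rule holomorphic_infsum)
  show "(\<lambda>n. Bd * norm (cmf (slice g S 1) n)) summable_on pos"
    using slice_csum[OF assms, of 1] by (intro summable_on_cmult_right) (auto simp: csum_def)
  fix n :: nat assume "n \<in> pos"
  show "(\<lambda>w. f (n * k) * cmf (slice g S w) n) holomorphic_on ball 0 1"
  proof (intro holomorphic_intros holomorphic_cmf)
    show "(\<lambda>w. slice g S w p) holomorphic_on ball 0 1" if "prime p" for p
      using prime_gt_0_nat[OF that] by (cases "p \<in> S") (auto simp: slice_def intro!: holomorphic_intros)
  qed
  fix w :: complex assume "w \<in> ball 0 1"
  then have "norm w \<le> 1" by simp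
  then show "norm (f (n * k) * cmf (slice g S w) n) \<le> Bd * norm (cmf (slice g S 1) n)"
    unfolding norm_mult using f_bound Bd_nonneg
    by (intro mult_mono) (auto simp: norm_cmf intro!: cmf_mono slice_norm_le cmf_nonneg)
qed auto

text \<open>Each prime of \<open>S\<close> contributes a geometric series in w / p times the shift
  by \<open>a\<close>. The coefficients of w and w^2 are the complete homogeneous symmetric
  polynomials of the numbers 1/p, namely M and (M^2 + Q) / 2; the second derivative doubles the
  latter.\<close>

lemma slice_derivs:
  assumes g: "adm g" and S: "finite S" "\<And>p. p \<in> S \<Longrightarrow> prime p \<and> [p = a] (mod N) \<and> g p = 0"
  defines "M \<equiv> \<lambda>S. \<Sum>p\<in>S. 1 / (of_nat p :: complex)" and "Q \<equiv> \<lambda>S. \<Sum>p\<in>S. (1 / (of_nat p :: complex))\<^sup>2"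
  shows "deriv (\<lambda>w. dsum f (slice g S w) k) 0 = M S * dsum f g (a * k)"
    "deriv (deriv (\<lambda>w. dsum f (slice g S w) k)) 0 = ((M S)\<^sup>2 + Q S) * dsum f g (a\<^sup>2 * k)"
proof -
  have sl0: "dsum f (slice g S 0) k = dsum f g k" if "\<And>p. p \<in> S \<Longrightarrow> g p = 0" for S k
  proof -
    have "slice g S 0 = g" using that by (auto simp: slice_def)
    then show ?thesis by simp
  qed
  have "\<forall>k. deriv (\<lambda>w. dsum f (slice g S w) k) 0 = M S * dsum f g (a * k) \<and>
    deriv (deriv (\<lambda>w. dsum f (slice g S w) k)) 0 = ((M S)\<^sup>2 + Q S) * dsum f g (a\<^sup>2 * k)"
    using S
  proof (induction S rule: finite_induct)
    case empty
    have "slice g {} = (\<lambda>w. g)" by (auto simp: slice_def)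
    then show ?case by (simp add: M_def Q_def)
  next
    case (insert p S)
    have p: "prime p" "[p = a] (mod N)" "g p = 0" using insert.prems by auto
    have IH: "deriv (\<lambda>w. dsum f (slice g S w) k) 0 = M S * dsum f g (a * k)"
       "deriv (deriv (\<lambda>w. dsum f (slice g S w) k)) 0 = ((M S)\<^sup>2 + Q S) * dsum f g (a\<^sup>2 * k)" for k
      using insert by auto
    have eq: "dsum f (slice g (insert p S) w) k = dsum f (slice g S w) k +
         1 / of_nat p * w * dsum f (slice g (insert p S) w) (a * k)" if "norm w < 1" for w k
    proof -
      have s: "slice g (insert p S) w = (slice g S w)(p := w / of_nat p)" by (auto simp: slice_def)
      have "norm w / real p < 1" using prime_gt_1_nat[OF p(1)] that by simp
      then have "dsum f (slice g (insert p S) w) k = dsum f (slice g S w) k +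
          w / of_nat p * dsum f (slice g (insert p S) w) (p * k)"
        unfolding s using insert g p that
        by (intro dsum_upd[where B = Bd] slice_csum f_bound) (auto simp: slice_def norm_divide)
      also have "dsum f (slice g (insert p S) w) (p * k) = dsum f (slice g (insert p S) w) (a * k)"
        using p(2) by (intro dsum_cong_mod cong_scalar_right)
      finally show ?thesis by simp
    qed
    have hol: "(\<lambda>w. dsum f (slice g (insert p S) w) k) holomorphic_on ball 0 1"
       "(\<lambda>w. dsum f (slice g S w) k) holomorphic_on ball 0 1" for k
      using g insert by (auto intro!: slice_holomorphic)
    have D: "deriv (\<lambda>w. dsum f (slice g (insert p S) w) k) 0 = deriv (\<lambda>w. dsum f (slice g S w) k) 0 +
          1 / of_nat p * dsum f (slice g (insert p S) 0) (a * k)"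
      "deriv (deriv (\<lambda>w. dsum f (slice g (insert p S) w) k)) 0 = deriv (deriv (\<lambda>w. dsum f (slice g S w) k)) 0 +
          2 * (1 / of_nat p) * deriv (\<lambda>w. dsum f (slice g (insert p S) w) (a * k)) 0" for k
      using deriv_add_mult_self[OF hol(1)[of k] hol(2)[of k] hol(1)[of "a * k"] eq] by auto
    have M: "M (insert p S) = M S + 1 / of_nat p" "Q (insert p S) = Q S + (1 / of_nat p)\<^sup>2"
      using insert by (auto simp: M_def Q_def)
    have 1: "deriv (\<lambda>w. dsum f (slice g (insert p S) w) k) 0 = M (insert p S) * dsum f g (a * k)" for k
      using D(1)[of k] IH(1) sl0[of "insert p S" "a * k"] insert.prems
      by (simp add: M algebra_simps)
    moreover have "deriv (deriv (\<lambda>w. dsum f (slice g (insert p S) w) k)) 0 =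
        ((M (insert p S))\<^sup>2 + Q (insert p S)) * dsum f g (a\<^sup>2 * k)" for k
      using D(2)[of k] IH(2) 1[of "a * k"]
      by (simp add: M power2_eq_square algebra_simps)
    ultimately show ?case by blast
  qed
  then show "deriv (\<lambda>w. dsum f (slice g S w) k) 0 = M S * dsum f g (a * k)"
    "deriv (deriv (\<lambda>w. dsum f (slice g S w) k)) 0 = ((M S)\<^sup>2 + Q S) * dsum f g (a\<^sup>2 * k)" by auto
qed

text \<open>Inserting a prime multiplies the majorant by 1 / (1 - 1/p), at most exp (2/p) because
  1/p \<le> 1/2. The growth exponent is thus linear in the sum of reciprocals, against the quadratic
  main term of \<open>slice_derivs\<close>.\<close>

lemma slice_bound:
  assumes g: "adm g" and S: "finite S" "\<And>p. p \<in> S \<Longrightarrow> prime p \<and> g p = 0"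
  shows "(\<Sum>\<^sub>\<infinity>n\<in>pos. norm (cmf (slice g S 1) n)) \<le> (\<Sum>\<^sub>\<infinity>n\<in>pos. norm (cmf g n)) * exp (2 * (\<Sum>p\<in>S. 1 / real p))"
  using S
proof (induction S rule: finite_induct)
  case empty
  have "slice g {} = (\<lambda>w. g)" by (auto simp: slice_def)
  then show ?case by simp
next
  case (insert p S)
  let ?D = "\<lambda>S. \<Sum>\<^sub>\<infinity>n\<in>pos. norm (cmf (slice g S 1) n)"
  let ?h = "\<lambda>p. norm (slice g S 1 p)"
  have D: "?D S = dsum (\<lambda>_. 1) (\<lambda>p. norm (slice g S 1 p)) 1" for S
    by (simp add: dsum_def norm_cmf)
  have p: "prime p" "g p = 0" using insert.prems by auto
  have p2: "real p \<ge> 2" using prime_ge_2_nat[OF p(1)] by linarith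
  have s: "(\<lambda>q. norm (slice g (insert p S) 1 q)) = ?h(p := 1 / real p)" by (auto simp: slice_def norm_divide)
  have "?D (insert p S) = dsum (\<lambda>_. 1) ?h 1 + (1 / real p) * dsum (\<lambda>_. 1) (?h(p := 1 / real p)) (p * 1)"
    unfolding D s
  proof (rule dsum_upd[OF p(1)])
    show "csum ?h" using slice_csum[of g S 1] g insert by (simp add: csum_norm[of "slice g S 1"])
    show "norm (1 / real p) < 1" using p2 by simp
    show "?h p = 0" using insert p by (simp add: slice_def)
    show "norm (1::real) \<le> 1" by simp
  qed
  also have "dsum (\<lambda>_. 1) (?h(p := 1 / real p)) (p * 1) = ?D (insert p S)"
    unfolding D s by (simp add: dsum_def)
  finally have "?D (insert p S) = ?D S + 1 / real p * ?D (insert p S)" unfolding D[of S] .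
  moreover have "d * (1 - y) = d0" if "d = d0 + y * d" for d d0 y :: real
    using that by (simp add: right_diff_distrib mult.commute)
  ultimately have eq: "?D (insert p S) * (1 - 1 / real p) = ?D S" by blast
  define x where "x = 1 / real p"
  have x: "0 < x" "x \<le> 1/2" using p2 by (auto simp: x_def field_simps)
  have "- 2 * x \<le> - x - 2 * x\<^sup>2" using x by (simp add: power2_eq_square field_simps)
  also have "\<dots> \<le> ln (1 - x)" using x by (intro ln_one_minus_pos_lower_bound) auto
  finally have "exp (- 2 * x) \<le> 1 - x" using x by (simp add: ln_ge_iff)
  then have "1 \<le> (1 - x) * exp (2 * x)"
    using mult_right_mono[of "exp (- 2 * x)" "1 - x" "exp (2 * x)"] by (simp add: mult_exp_exp)
  then have "?D (insert p S) \<le> ?D S * exp (2 * x)"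
    using mult_left_mono[of 1 "(1 - x) * exp (2 * x)" "?D (insert p S)"]
      infsum_nonneg[of pos "\<lambda>n. norm (cmf (slice g (insert p S) 1) n)"]
    unfolding eq[folded x_def, symmetric] mult.assoc by simp
  also have "\<dots> \<le> ((\<Sum>\<^sub>\<infinity>n\<in>pos. norm (cmf g n)) * exp (2 * (\<Sum>p\<in>S. 1 / real p))) * exp (2 * x)"
    using insert by (intro mult_right_mono) auto
  also have "\<dots> = (\<Sum>\<^sub>\<infinity>n\<in>pos. norm (cmf g n)) * exp (2 * (\<Sum>p\<in>insert p S. 1 / real p))"
    using insert by (simp add: x_def mult_exp_exp algebra_simps)
  finally show ?case .
qed


section \<open>The character relation for a zero-free lift\<close>

abbreviation divergent_class :: "nat \<Rightarrow> bool" where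
  "divergent_class a \<equiv> \<not> (\<lambda>p. 1 / real p) summable_on {p. prime p \<and> [p = a] (mod N)}"

text \<open>\<open>g\<close> has finite support, so avoiding its primes costs only a finite
  sum.\<close>

lemma divergent_class_large_sums:
  assumes "divergent_class a" "adm g"
  shows "\<exists>S. finite S \<and> (\<forall>p\<in>S. prime p \<and> [p = a] (mod N) \<and> g p = 0) \<and> K < (\<Sum>p\<in>S. 1 / real p)"
proof (rule ccontr)
  assume neg: "\<not> ?thesis"
  let ?A = "{p. prime p \<and> [p = a] (mod N)}"
  have "(\<lambda>p. 1 / real p) summable_on {p\<in>?A. g p = 0}"
  proof (rule nonneg_bdd_above_summable_on)
    show "bdd_above (sum (\<lambda>p. 1 / real p) ` {F. F \<subseteq> {p\<in>?A. g p = 0} \<and> finite F})"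
    proof (rule bdd_aboveI2)
      fix F assume "F \<in> {F. F \<subseteq> {p\<in>?A. g p = 0} \<and> finite F}"
      then have "finite F \<and> (\<forall>p\<in>F. prime p \<and> [p = a] (mod N) \<and> g p = 0)" by auto
      with neg show "(\<Sum>p\<in>F. 1 / real p) \<le> K" by (meson not_le)
    qed
  qed auto
  moreover have "(\<lambda>p. 1 / real p) summable_on {p\<in>?A. g p \<noteq> 0}"
    using assms(2) by (intro summable_on_finite) (auto simp: adm_def intro: rev_finite_subset)
  ultimately have "(\<lambda>p. 1 / real p) summable_on {p\<in>?A. g p = 0} \<union> {p\<in>?A. g p \<noteq> 0}"
    by (intro summable_on_Un_disjoint) auto
  also have "{p\<in>?A. g p = 0} \<union> {p\<in>?A. g p \<noteq> 0} = ?A" by auto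
  finally show False using assms(1) by simp
qed

text \<open>Asserted at every admissible point and not only at the origin, so that it can later be
  used along a moving coordinate.\<close>

lemma dsum_quadratic:
  assumes nz: "\<And>g. adm g \<Longrightarrow> dsum f g 1 \<noteq> 0" and a: "divergent_class a" and g: "adm g"
  shows "dsum f g 1 * dsum f g (a\<^sup>2) = (dsum f g a)\<^sup>2"
proof -
  define e0 e1 e2 where "e0 = dsum f g 1" and "e1 = dsum f g a" and "e2 = dsum f g (a\<^sup>2)"
  have e0: "e0 \<noteq> 0" unfolding e0_def by (rule nz[OF g])
  define C where "C = Bd * (\<Sum>\<^sub>\<infinity>n\<in>pos. norm (cmf g n))"
  have C0: "C \<ge> 0" unfolding C_def using Bd_nonneg by (intro mult_nonneg_nonneg infsum_nonneg) auto
  \<comment> \<open>The growth exponent will be \<open>c0 + 2 * M\<close>; taking C + 1 instead of C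
    gives the strict inequality demanded by \<open>log_second_coeff_bound\<close>.\<close>
  define c0 where "c0 = ln ((C + 1) / norm e0)"
  have c0: "norm e0 * exp c0 = C + 1" using e0 C0 by (simp add: c0_def)
  define W where "W = e2 / e0 - (e1 / e0)\<^sup>2"
  \<comment> \<open>What the estimate leaves after division by M > 1: 16 |c0| + 32 from the growth
    exponent, and \<open>norm (e2 / e0)\<close> from the sum of squared reciprocals, which is at
    most M.\<close>
  define \<alpha> where "\<alpha> = 16 * \<bar>c0\<bar> + 32 + norm (e2 / e0)"
  have main: "norm W * M \<le> \<alpha>" if S: "finite S" "\<forall>p\<in>S. prime p \<and> [p = a] (mod N) \<and> g p = 0"
      and M: "M = (\<Sum>p\<in>S. 1 / real p)" "M > 1" for S M
  proof -
    define Q where "Q = (\<Sum>p\<in>S. (1 / real p)\<^sup>2)"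
    have Q: "0 \<le> Q" "Q \<le> M" unfolding Q_def M
    proof -
      show "0 \<le> (\<Sum>p\<in>S. (1 / real p)\<^sup>2)" by (rule sum_nonneg) auto
      show "(\<Sum>p\<in>S. (1 / real p)\<^sup>2) \<le> (\<Sum>p\<in>S. 1 / real p)"
      proof (rule sum_mono)
        fix p assume "p \<in> S"
        then have "real p \<ge> 1" using S(2) prime_ge_1_nat[of p] by auto
        then show "(1 / real p)\<^sup>2 \<le> 1 / real p" by (simp add: power2_eq_square field_simps)
      qed
    qed
    define \<Phi> where "\<Phi> = (\<lambda>w. dsum f (slice g S w) 1)"
    have "slice g S 0 = g" using S(2) by (auto simp: slice_def)
    then have \<Phi>0: "\<Phi> 0 = e0" by (simp add: \<Phi>_def e0_def)
    have "norm (deriv (deriv \<Phi>) 0 / \<Phi> 0 - (deriv \<Phi> 0 / \<Phi> 0)\<^sup>2) \<le> 16 * (c0 + 2 * M)"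
    proof (rule log_second_coeff_bound)
      show "\<Phi> holomorphic_on ball 0 1" unfolding \<Phi>_def by (rule slice_holomorphic[OF g S(1)])
      fix z :: complex assume z: "norm z < 1"
      show "\<Phi> z \<noteq> 0" unfolding \<Phi>_def by (rule nz[OF slice_adm[OF g S(1) z]])
      have "norm (\<Phi> z) \<le> Bd * (\<Sum>\<^sub>\<infinity>n\<in>pos. norm (cmf (slice g S z) n))"
        unfolding \<Phi>_def using z by (intro norm_dsum_le f_bound slice_csum g S) auto
      also have "\<dots> \<le> Bd * (\<Sum>\<^sub>\<infinity>n\<in>pos. norm (cmf (slice g S 1) n))"
        using z Bd_nonneg by (intro mult_left_mono infsum_cmf_mono slice_csum g S slice_norm_le) auto
      also have "\<dots> \<le> Bd * ((\<Sum>\<^sub>\<infinity>n\<in>pos. norm (cmf g n)) * exp (2 * M))"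
        unfolding M using S by (intro mult_left_mono slice_bound g Bd_nonneg) auto
      also have "\<dots> = C * exp (2 * M)" by (simp add: C_def)
      also have "\<dots> < (C + 1) * exp (2 * M)" by simp
      also have "\<dots> = norm (\<Phi> 0) * exp (c0 + 2 * M)" unfolding \<Phi>0 exp_add c0[symmetric] by simp
      finally show "norm (\<Phi> z) < norm (\<Phi> 0) * exp (c0 + 2 * M)" .
    qed
    moreover have "deriv \<Phi> 0 = of_real M * e1" "deriv (deriv \<Phi>) 0 = of_real (M\<^sup>2 + Q) * e2"
      using slice_derivs[OF g S(1), of a 1] S(2) unfolding \<Phi>_def e1_def e2_def M Q_def by auto
    ultimately have "norm (of_real (M\<^sup>2 + Q) * e2 / e0 - (of_real M * e1 / e0)\<^sup>2) \<le> 16 * (c0 + 2 * M)"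
      by (simp add: \<Phi>0)
    moreover have "of_real (M\<^sup>2 + Q) * e2 / e0 - (of_real M * e1 / e0)\<^sup>2 = of_real (M\<^sup>2) * W + of_real Q * (e2 / e0)"
      by (simp add: W_def algebra_simps power_mult_distrib power_divide add_divide_distrib)
    ultimately have "norm (of_real (M\<^sup>2) * W + of_real Q * (e2 / e0)) \<le> 16 * (c0 + 2 * M)" by simp
    then have "norm (of_real (M\<^sup>2) * W) \<le> 16 * (c0 + 2 * M) + norm (of_real Q * (e2 / e0))"
      using norm_triangle_ineq4[of "of_real (M\<^sup>2) * W + of_real Q * (e2 / e0)" "of_real Q * (e2 / e0)"] by simp
    then have "M\<^sup>2 * norm W \<le> 16 * (c0 + 2 * M) + Q * norm (e2 / e0)"
      using Q by (simp add: norm_mult norm_divide norm_power)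
    also have "\<dots> \<le> 16 * (\<bar>c0\<bar> * M + 2 * M) + M * norm (e2 / e0)"
    proof (rule add_mono)
      have "c0 \<le> \<bar>c0\<bar> * 1" by simp
      also have "\<dots> \<le> \<bar>c0\<bar> * M" using M by (intro mult_left_mono) auto
      finally show "16 * (c0 + 2 * M) \<le> 16 * (\<bar>c0\<bar> * M + 2 * M)" by simp
      show "Q * norm (e2 / e0) \<le> M * norm (e2 / e0)" using Q by (intro mult_right_mono) auto
    qed
    also have "\<dots> = M * \<alpha>" by (simp add: \<alpha>_def algebra_simps)
    finally have "M * (M * norm W) \<le> M * \<alpha>" by (simp add: power2_eq_square mult.assoc)
    then show ?thesis using M by (simp add: mult.commute)
  qed
  have "W = 0"
  proof (rule ccontr)
    assume "W \<noteq> 0"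
    obtain S where S: "finite S" "\<forall>p\<in>S. prime p \<and> [p = a] (mod N) \<and> g p = 0"
        "max 1 (\<alpha> / norm W) < (\<Sum>p\<in>S. 1 / real p)"
      using divergent_class_large_sums[OF a g] by blast
    then have "norm W * (\<Sum>p\<in>S. 1 / real p) \<le> \<alpha>" by (intro main) auto
    moreover have "\<alpha> < norm W * (\<Sum>p\<in>S. 1 / real p)"
      using S(3) \<open>W \<noteq> 0\<close> by (simp add: field_simps)
    ultimately show False by simp
  qed
  then have "e2 * e0 = e1\<^sup>2" using e0 by (simp add: W_def field_simps power2_eq_square)
  then show ?thesis by (simp add: e0_def e1_def e2_def mult.commute)
qed

text \<open>The quadratic relation is used along the coordinate x of one further prime q congruent
  to \<open>a\<close> with \<open>g q = 0\<close>. There the sums satisfy A i = e i + x A (i + 1),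
  and comparing orders in x turns the single relation into a whole geometric progression.\<close>

lemma dsum_geometric:
  assumes nz: "\<And>g. adm g \<Longrightarrow> dsum f g 1 \<noteq> 0" and a: "divergent_class a" and g: "adm g"
  shows "dsum f g 1 * dsum f g (a ^ Suc j) = dsum f g a * dsum f g (a ^ j)"
proof -
  obtain S where S: "finite S" "\<forall>p\<in>S. prime p \<and> [p = a] (mod N) \<and> g p = 0" "0 < (\<Sum>p\<in>S. 1 / real p)"
    using divergent_class_large_sums[OF a g] by blast
  then have "S \<noteq> {}" by auto
  then obtain q where q: "prime q" "[q = a] (mod N)" "g q = 0" using S(2) by blast
  have q2: "real q \<ge> 2" using prime_ge_2_nat[OF q(1)] by linarith
  define r where "r = 1 / (2 * real q)"
  have r: "r > 0" "r < 1" "r * real q < 1" using q2 by (auto simp: r_def field_simps)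
  define h where "h = (\<lambda>x::real. g(q := complex_of_real x))"
  define A where "A = (\<lambda>i x. dsum f (h x) (a ^ i))"
  define e where "e = (\<lambda>i. dsum f g (a ^ i))"
  have admh: "adm (h x)" if "0 < x" "x \<le> r" for x
    unfolding h_def using g
  proof (rule adm_upd)
    have "x * real q \<le> r * real q" using that by (intro mult_right_mono) auto
    then show "norm (complex_of_real x) * real q < 1" using that r by simp
  qed
  have rec: "A i x = e i + of_real x * A (Suc i) x" if x: "0 < x" "x \<le> r" for i x
  proof -
    have "A i x = e i + of_real x * dsum f (h x) (q * a ^ i)"
      unfolding A_def h_def e_def using x r
      by (intro dsum_upd[where B = Bd] q adm_csum g f_bound) auto
    also have "dsum f (h x) (q * a ^ i) = A (Suc i) x"
      unfolding A_def by (rule dsum_cong_mod) (use q(2) in \<open>auto intro: cong_scalar_right\<close>)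
    finally show ?thesis .
  qed
  have quad: "A 0 x * A 2 x = (A 1 x)\<^sup>2" if "0 < x" "x \<le> r" for x
    using dsum_quadratic[OF nz a admh[OF that]] by (simp add: A_def)
  \<comment> \<open>Inserting the recursions for A 0 and A 1 into A 0 A 2 = (A 1)^2 eliminates A
    2.\<close>
  have base: "e 1 * A 0 x = e 0 * A 1 x" if x: "0 < x" "x \<le> r" for x
  proof -
    have "A 0 x * (A 1 x - e 1) = of_real x * (A 0 x * A 2 x)"
      using rec[OF x, of 1] by (simp add: numeral_2_eq_2 algebra_simps)
    also have "\<dots> = A 1 x * (A 0 x - e 0)"
      using rec[OF x, of 0] quad[OF x] by (simp add: power2_eq_square algebra_simps)
    finally show ?thesis by (simp add: algebra_simps)
  qed
  define C where "C = Bd * (\<Sum>\<^sub>\<infinity>n\<in>pos. norm (cmf (h r) n))"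
  have bA: "norm (A i x) \<le> C" if x: "0 < x" "x \<le> r" for i x
  proof -
    have "norm (A i x) \<le> Bd * (\<Sum>\<^sub>\<infinity>n\<in>pos. norm (cmf (h x) n))"
      unfolding A_def by (intro norm_dsum_le f_bound adm_csum admh x)
    also have "\<dots> \<le> C" unfolding C_def
      using x r by (intro mult_left_mono Bd_nonneg infsum_cmf_mono adm_csum admh) (auto simp: h_def)
    finally show ?thesis .
  qed
  define \<delta> where "\<delta> = (\<lambda>i. e 1 * e i - e 0 * e (Suc i))"
  \<comment> \<open>The limit of the relation at x = 0; \<open>bA\<close> makes the error
    O(x).\<close>
  have d0: "\<delta> i = 0" if "\<And>x. 0 < x \<Longrightarrow> x \<le> r \<Longrightarrow> e 1 * A i x = e 0 * A (Suc i) x" for i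
  proof (rule eq_0_if_small[OF r(1)])
    fix x assume x: "0 < x" "x \<le> r"
    have "\<delta> i = - (of_real x * (e 1 * A (Suc i) x - e 0 * A (Suc (Suc i)) x))"
      using that[OF x] rec[OF x, of i] rec[OF x, of "Suc i"] by (simp add: \<delta>_def algebra_simps)
    then have "norm (\<delta> i) = x * norm (e 1 * A (Suc i) x - e 0 * A (Suc (Suc i)) x)"
      using x by (simp add: norm_mult)
    also have "\<dots> \<le> x * (norm (e 1) * C + norm (e 0) * C)"
    proof (intro mult_left_mono)
      have "norm (e 1 * A (Suc i) x - e 0 * A (Suc (Suc i)) x) \<le>
         norm (e 1 * A (Suc i) x) + norm (e 0 * A (Suc (Suc i)) x)" by (rule norm_triangle_ineq4)
      also have "\<dots> \<le> norm (e 1) * C + norm (e 0) * C"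
        unfolding norm_mult by (intro add_mono mult_left_mono bA x) auto
      finally show "norm (e 1 * A (Suc i) x - e 0 * A (Suc (Suc i)) x) \<le> norm (e 1) * C + norm (e 0) * C" .
    qed (use x in auto)
    finally show "norm (\<delta> i) \<le> x * (norm (e 1) * C + norm (e 0) * C)" .
  qed
  \<comment> \<open>Once \<delta> i = 0 is known, subtracting it from the relation at x and dividing
    by x raises the index by one.\<close>
  have all: "e 1 * A i x = e 0 * A (Suc i) x" if "0 < x" "x \<le> r" for i x
    using that
  proof (induction i arbitrary: x)
    case 0
    then show ?case using base by simp
  next
    case (Suc i)
    have "\<delta> i = 0" using d0 Suc.IH by blast
    then have "e 1 * e i = e 0 * e (Suc i)" by (simp add: \<delta>_def)
    then have "of_real x * (e 1 * A (Suc i) x) = of_real x * (e 0 * A (Suc (Suc i)) x)"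
      using Suc.IH[OF Suc.prems] rec[OF Suc.prems, of i] rec[OF Suc.prems, of "Suc i"] by (simp add: algebra_simps)
    then show ?case using Suc.prems by simp
  qed
  have "\<delta> j = 0" using d0 all by blast
  then show ?thesis by (simp add: \<delta>_def e_def)
qed

lemma power_totient_cong: "coprime a N \<Longrightarrow> [a ^ totient N = 1] (mod N)"
  using euler_theorem[of a N] by simp

text \<open>By \<open>dsum_geometric\<close> the values at the shifts a^j form a geometric
  progression, and a^j returns to 1 modulo \<open>N\<close> at j = \<open>totient N\<close>.\<close>

lemma dsum_ratio_root_of_unity:
  assumes nz: "\<And>g. adm g \<Longrightarrow> dsum f g 1 \<noteq> 0" and a: "divergent_class a" "coprime a N" and g: "adm g"
  shows "(dsum f g a / dsum f g 1) ^ totient N = 1"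
proof -
  let ?c = "dsum f g a / dsum f g 1"
  have e0: "dsum f g 1 \<noteq> 0" by (rule nz[OF g])
  have "dsum f g (a ^ j) = ?c ^ j * dsum f g 1" for j
  proof (induction j)
    case (Suc j)
    then show ?case using dsum_geometric[OF nz a(1) g, of j] e0 by (simp add: field_simps)
  qed simp
  from this[of "totient N"] have "?c ^ totient N * dsum f g 1 = dsum f g 1"
    using dsum_cong_mod[OF power_totient_cong[OF a(2)]] by simp
  then show ?thesis using e0 by simp
qed

text \<open>Along the segment t g the ratio is continuous and confined to finitely many roots of
  unity, so it keeps its value at t = 0, where only n = 1 contributes.\<close>

lemma dsum_ratio_constant:
  assumes nz: "\<And>g. adm g \<Longrightarrow> dsum f g 1 \<noteq> 0" and a: "divergent_class a" "coprime a N" and g: "adm g"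
  shows "dsum f g a = f a / f 1 * dsum f g 1"
proof -
  define G where "G = (\<lambda>t::real. \<lambda>p. of_real t * g p)"
  have admG: "adm (G t)" if "t \<in> {0..1}" for t
    unfolding G_def using that by (intro adm_scale g) auto
  have cont: "continuous_on {0..1} (\<lambda>t. dsum f (G t) k)" for k
    unfolding dsum_def
  proof (rule continuous_on_infsum)
    show "(\<lambda>n. Bd * norm (cmf g n)) summable_on pos"
      using adm_csum[OF g] by (intro summable_on_cmult_right) (auto simp: csum_def)
    fix n :: nat assume "n \<in> pos"
    show "continuous_on {0..1} (\<lambda>t. f (n * k) * cmf (G t) n)"
      by (intro continuous_intros continuous_on_cmf) (auto simp: G_def intro!: continuous_intros)
    fix t :: real assume t: "t \<in> {0..1}"
    show "norm (f (n * k) * cmf (G t) n) \<le> Bd * norm (cmf g n)"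
      unfolding norm_mult norm_cmf using t f_bound Bd_nonneg
      by (intro mult_mono cmf_mono cmf_nonneg) (auto simp: G_def norm_mult mult_left_le_one_le)
  qed
  define h where "h = (\<lambda>t. dsum f (G t) a / dsum f (G t) 1)"
  have conth: "continuous_on {0..1} h" unfolding h_def
    by (intro continuous_intros cont) (use nz admG in auto)
  have "totient N > 0" using N by simp
  then have "finite {z::complex. z ^ totient N = 1}" using finite_roots_unity[of "totient N", where 'a = complex] by (simp add: Suc_le_eq)
  moreover have "h ` {0..1} \<subseteq> {z. z ^ totient N = 1}"
    using dsum_ratio_root_of_unity[OF nz a admG] by (auto simp: h_def)
  ultimately have "finite (h ` {0..1})" by (rule rev_finite_subset)
  then have "h constant_on {0..1}"
    using conth by (intro continuous_finite_range_constant) auto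
  then have "h 1 = h 0" by (auto simp: constant_on_def)
  moreover have "G 0 = (\<lambda>_. 0)" "G 1 = g" by (auto simp: G_def)
  ultimately have "dsum f g a / dsum f g 1 = f a / f 1" by (simp add: h_def dsum_zero)
  then show ?thesis using nz[OF g] by (simp add: field_simps)
qed

text \<open>Constancy of the ratio says that the lift of the difference \<open>H\<close> of both
  sides vanishes identically; uniqueness of coefficients turns this into an identity for
  \<open>f\<close> itself.\<close>

lemma f_times_divergent:
  assumes nz: "\<And>g. adm g \<Longrightarrow> dsum f g 1 \<noteq> 0" and a: "divergent_class a" "coprime a N" and n: "n > 0"
  shows "f (n * a) = f a / f 1 * f n"
proof -
  define ch where "ch = f a / f 1"
  define H where "H = (\<lambda>n. f (n * a) - ch * f n)"
  have "H n = 0"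
  proof (rule dsum_vanish_imp_zero[OF _ _ n])
    show "norm (H n) \<le> Bd + norm ch * Bd" for n
      unfolding H_def by (rule order_trans[OF norm_triangle_ineq4])
         (auto simp: norm_mult intro!: add_mono mult_left_mono f_bound)
    fix g assume g: "adm g"
    have "dsum H g 1 = (\<Sum>\<^sub>\<infinity>n\<in>pos. f (n * a) * cmf g n + (- ch) * (f (n * 1) * cmf g n))"
      unfolding dsum_def H_def by (intro infsum_cong) (simp add: algebra_simps)
    also have "\<dots> = dsum f g a + (\<Sum>\<^sub>\<infinity>n\<in>pos. (- ch) * (f (n * 1) * cmf g n))"
      unfolding dsum_def
      by (intro infsum_add summable_on_cmult_right dsum_summable[where F=f and B=Bd] adm_csum g f_bound)
    also have "(\<Sum>\<^sub>\<infinity>n\<in>pos. (- ch) * (f (n * 1) * cmf g n)) = (- ch) * dsum f g 1"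
      unfolding dsum_def by (rule infsum_cmult_right')
    finally show "dsum H g 1 = 0" using dsum_ratio_constant[OF nz a g] by (simp add: ch_def)
  qed
  then show ?thesis by (simp add: H_def ch_def)
qed

text \<open>Thus \<open>f a / f 1\<close> is a Dirichlet character in \<open>a\<close>: a zero-free Bohr lift involves only one.\<close>

lemma f_times_coprime:
  assumes nz: "\<And>g. adm g \<Longrightarrow> dsum f g 1 \<noteq> 0" and a: "coprime a N" and n: "n > 0"
  shows "f (n * a) = f a / f 1 * f n"
proof -
  have f1: "f 1 \<noteq> 0" using nz[of "\<lambda>_. 0"] by (simp add: dsum_zero)
  \<comment> \<open>Being good depends only on the class modulo \<open>N\<close> and is preserved by
    products, so it suffices to find a good representative of the class of \<open>a\<close>.\<close>
  define G where "G = (\<lambda>a. \<forall>n>0. f (n * a) = f a / f 1 * f n)"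
  have Gcong: "G b" if "G a" "[a = b] (mod N)" for a b
    using that f_cong[OF that(2)] f_cong[OF cong_scalar_left[OF that(2)]] by (metis G_def)
  have Gmult: "G (a * b)" if "G a" "G b" "a > 0" for a b
  proof -
    have eq: "f (n * (a * b)) = f b / f 1 * (f a / f 1 * f n)" if "n > 0" for n
    proof -
      have "f (n * (a * b)) = f ((n * a) * b)" by (simp add: mult.assoc)
      also have "\<dots> = f b / f 1 * f (n * a)" using \<open>G b\<close> \<open>a > 0\<close> that by (auto simp: G_def)
      finally show ?thesis using \<open>G a\<close> that by (simp add: G_def)
    qed
    from eq[of 1] have "f (a * b) / f 1 = f b / f 1 * (f a / f 1)" using f1 by simp
    then show ?thesis unfolding G_def using eq by (simp add: mult.assoc)
  qed
  \<comment> \<open>Bad primes lie in the finitely many classes with convergent sum of reciprocals,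
    so they are sparse enough for \<open>ex_residue_avoiding_primes\<close>.\<close>
  define Bad where "Bad = {p. prime p \<and> coprime p N \<and> \<not> G p}"
  have sub: "Bad \<subseteq> (\<Union>b\<in>{b\<in>{..<N}. \<not> divergent_class b}. {p. prime p \<and> [p = b] (mod N)})"
  proof
    fix p assume p: "p \<in> Bad"
    have c: "[p mod N = p] (mod N)" by (simp add: cong_def)
    have "\<not> divergent_class (p mod N)"
    proof
      assume "divergent_class (p mod N)"
      moreover have "coprime (p mod N) N" using p N by (simp add: Bad_def)
      ultimately have "G (p mod N)" unfolding G_def using f_times_divergent[OF nz] by blast
      then show False using Gcong[OF _ c] p by (simp add: Bad_def)
    qed
    then show "p \<in> (\<Union>b\<in>{b\<in>{..<N}. \<not> divergent_class b}. {p. prime p \<and> [p = b] (mod N)})"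
      using p N by (intro UN_I[of "p mod N"]) (auto simp: Bad_def cong_def)
  qed
  have "(\<lambda>p. 1 / real p) summable_on (\<Union>b\<in>I. {p. prime p \<and> [p = b] (mod N)})"
    if "finite I" "\<forall>b\<in>I. \<not> divergent_class b" for I
    using that
  proof (induction I rule: finite_induct)
    case (insert b I)
    let ?A = "{p. prime p \<and> [p = b] (mod N)}" and ?U = "\<Union>b\<in>I. {p. prime p \<and> [p = b] (mod N)}"
    have A: "(\<lambda>p. 1 / real p) summable_on ?A" using insert.prems by blast
    have U: "(\<lambda>p. 1 / real p) summable_on ?U" using insert.prems insert.IH by blast
    have "(\<lambda>p. 1 / real p) summable_on (?U - ?A)" by (rule summable_on_subset_banach[OF U]) blast
    then have "(\<lambda>p. 1 / real p) summable_on (?A \<union> (?U - ?A))" by (rule summable_on_Un_disjoint[OF A _ Diff_disjoint])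
    moreover have "?A \<union> (?U - ?A) = (\<Union>b\<in>insert b I. {p. prime p \<and> [p = b] (mod N)})" by blast
    ultimately show ?case by simp
  qed simp
  then have smU: "(\<lambda>p. 1 / real p) summable_on (\<Union>b\<in>{b\<in>{..<N}. \<not> divergent_class b}. {p. prime p \<and> [p = b] (mod N)})"
    by (rule meta_mp) simp_all
  have smB: "(\<lambda>p. 1 / real p) summable_on Bad"
    by (rule summable_on_subset_banach[OF smU sub])
  \<comment> \<open>All prime factors of this representative are good, since it is prime to
    \<open>N\<close> and avoids \<open>Bad\<close>.\<close>
  obtain m where m: "m > 0" "[m = a] (mod N)" "\<forall>p\<in>Bad. \<not> p dvd m"
    using ex_residue_avoiding_primes[OF N _ smB, of a] by (auto simp: Bad_def)
  have cm: "coprime m N" using m(2) a by (metis cong_imp_coprime cong_sym)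
  have "G k" if "k > 0" "k dvd m" for k
    using that
  proof (induction k rule: less_induct)
    case (less k)
    show ?case
    proof (cases "k = 1")
      case False
      then obtain p where p: "prime p" "p dvd k" using prime_factor_nat by blast
      then obtain l where l: "k = p * l" by auto
      with less.prems have l': "l > 0" "l < k" "l dvd m" using p(1) prime_gt_1_nat[of p] by (auto dest: dvd_mult_right)
      have "p dvd m" using p less.prems by (meson dvd_trans)
      moreover from this have "coprime p N" using coprime_divisors[of p m N N] cm by simp
      ultimately have "G p" using m(3) p by (auto simp: Bad_def)
      then show ?thesis unfolding l using less.IH l' p by (intro Gmult) (auto simp: prime_gt_0_nat)
    next
      case True
      then show ?thesis using f1 by (simp add: G_def)
    qed
  qed
  then have "G m" using m by simp
  then have "G a" using Gcong m(2) by blast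
  then show ?thesis using n by (simp add: G_def)
qed

lemma norm_ratio_coprime:
  assumes nz: "\<And>g. adm g \<Longrightarrow> dsum f g 1 \<noteq> 0" and a: "coprime a N"
  shows "norm (f a / f 1) = 1"
proof -
  have f1: "f 1 \<noteq> 0" using nz[of "\<lambda>_. 0"] by (simp add: dsum_zero)
  have "f (a ^ j) = (f a / f 1) ^ j * f 1" if "a > 0" for j
  proof (induction j)
    case (Suc j)
    then show ?case using f_times_coprime[OF nz a, of "a ^ j"] that f1 by (simp add: mult.commute)
  qed simp
  then have "(f a / f 1) ^ totient N = 1" if "a > 0"
    using f_cong[OF power_totient_cong[OF a]] f1 that by simp
  then have "norm (f a / f 1) ^ totient N = 1" if "a > 0"
    using that by (metis norm_one norm_power)
  moreover have "totient N > 0" using N by simp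
  ultimately have "norm (f a / f 1) = 1" if "a > 0"
    using that power_eq_imp_eq_base[of "norm (f a / f 1)" "totient N" 1] by simp
  \<comment> \<open>\<open>coprime 0 N\<close> forces N = 1, and then f is constant.\<close>
  moreover have "f 0 = f 1" if "a = 0"
    using a that f_cong[of 0 1] by (simp add: cong_def)
  ultimately show ?thesis using f1 by (cases "a = 0") auto
qed

end

lemma infsum_tail_small:
  fixes h :: "nat \<Rightarrow> real"
  assumes "h summable_on pos" "\<And>n. h n \<ge> 0" "e > 0"
  shows "\<exists>Y0. \<forall>Y\<ge>Y0. infsum h {Y<..} < e"
proof -
  have "(h has_sum infsum h pos) pos" using assms(1) by (rule has_sum_infsum)
  then have "eventually (\<lambda>X. dist (sum h X) (infsum h pos) < e) (finite_subsets_at_top pos)"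
    using assms(3) unfolding has_sum_def by (rule tendstoD)
  then obtain X where X: "finite X" "X \<subseteq> pos" "dist (sum h X) (infsum h pos) < e"
    unfolding eventually_finite_subsets_at_top by blast
  show ?thesis
  proof (intro exI[of _ "Max (insert 0 X)"] allI impI)
    fix Y assume Y: "Max (insert 0 X) \<le> Y"
    have sub: "X \<subseteq> {0<..Y}"
    proof
      fix x assume x: "x \<in> X"
      then have "x \<le> Max (insert 0 X)" using X(1) by (intro Max_ge) auto
      with Y x X(2) show "x \<in> {0<..Y}" by auto
    qed
    have sY: "h summable_on {Y<..}" by (rule summable_on_subset_banach[OF assms(1)]) auto
    have "infsum h pos = infsum h ({0<..Y} \<union> {Y<..})" by (rule arg_cong[of _ _ "infsum h"]) auto
    also have "\<dots> = infsum h {0<..Y} + infsum h {Y<..}" by (rule infsum_Un_disjoint) (auto simp: sY)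
    also have "infsum h {0<..Y} = sum h {0<..Y}" by simp
    finally have "infsum h {Y<..} = infsum h pos - sum h {0<..Y}" by simp
    also have "\<dots> \<le> infsum h pos - sum h X" using sub assms(2) by (intro diff_left_mono sum_mono2) auto
    also have "\<dots> < e" using X(3) by (simp add: dist_real_def)
    finally show "infsum h {Y<..} < e" .
  qed
qed

lemma csum_powr:
  assumes "Re s > 1"
  shows "csum (\<lambda>p. of_nat p powr (- s) :: complex)"
proof -
  have "summable (\<lambda>n. real n powr (- Re s))" using assms by (simp add: summable_real_powr_iff)
  then have "(\<lambda>n. real n powr (- Re s)) summable_on UNIV"
    by (intro summable_nonneg_imp_summable_on) auto
  then have "(\<lambda>n. real n powr (- Re s)) summable_on pos" by (rule summable_on_subset_banach) auto
  then show ?thesis unfolding csum_def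
    by (rule summable_on_cong[THEN iffD1, rotated]) (auto simp: cmf_powr norm_powr_real_powr)
qed

lemma norm_nat_powr: "n > 0 \<Longrightarrow> norm (of_nat n powr s :: complex) = real n powr Re s"
  by (simp add: norm_powr_real_powr)

subsection \<open>Dirichlet convolution\<close>

definition dconv :: "(nat \<Rightarrow> 'a::comm_ring_1) \<Rightarrow> (nat \<Rightarrow> 'a) \<Rightarrow> nat \<Rightarrow> 'a" where
  "dconv a b n = (\<Sum>d | d dvd n. a d * b (n div d))"

text \<open>The inverse for \<open>dconv\<close>, the defining equation being solved for the term d
  = n. The value 0 at 0 lets the polynomial bound below hold for all n.\<close>

function dinv :: "(nat \<Rightarrow> 'a::field) \<Rightarrow> nat \<Rightarrow> 'a" where
  "dinv a n = (if n = 0 then 0 else if n = 1 then 1 / a 1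
     else - (1 / a 1) * (\<Sum>d\<in>{d. d dvd n \<and> d < n}. a (n div d) * dinv a d))"
  by auto
termination by (relation "Wellfounded.measure snd") auto

declare dinv.simps [simp del]

lemma dconv_dinv:
  assumes "a 1 \<noteq> 0" "n > 0"
  shows "dconv a (dinv a) n = (if n = 1 then 1 else 0)"
proof -
  have "bij_betw (\<lambda>d. n div d) {d. d dvd n} {d. d dvd n}"
    using assms(2) by (intro bij_betw_byWitness[where f' = "\<lambda>d. n div d"]) auto
  then have "dconv a (dinv a) n = (\<Sum>d | d dvd n. a (n div d) * dinv a (n div (n div d)))"
    unfolding dconv_def by (intro sum.reindex_bij_betw[symmetric])
  also have "\<dots> = (\<Sum>d | d dvd n. a (n div d) * dinv a d)"
    using assms(2) by (intro sum.cong) auto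
  also have "{d. d dvd n} = insert n {d. d dvd n \<and> d < n}"
    using assms(2) by (auto dest: dvd_imp_le)
  also have "(\<Sum>d\<in>\<dots>. a (n div d) * dinv a d) = a 1 * dinv a n + (\<Sum>d | d dvd n \<and> d < n. a (n div d) * dinv a d)"
    using assms(2) by (subst sum.insert) auto
  also have "\<dots> = (if n = 1 then 1 else 0)"
  proof (cases "n = 1")
    case True
    then have "{d. d dvd n \<and> d < n} = {}" by auto
    then show ?thesis using True assms(1) by (simp only: sum.empty) (simp add: dinv.simps)
  next
    case False
    then show ?thesis using assms by (subst dinv.simps) simp
  qed
  finally show ?thesis .
qed

text \<open>Stated for any completely multiplicative weight, so that it covers Dirichlet series (g p
  = p^-s) and Bohr lifts (g p = z_p) at once.\<close>

lemma infsum_dconv: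
  fixes a b g :: "nat \<Rightarrow> 'a::{banach,real_normed_field}"
  assumes a: "(\<lambda>n. norm (a n * cmf g n)) summable_on pos" and b: "(\<lambda>n. norm (b n * cmf g n)) summable_on pos"
  shows "(\<Sum>\<^sub>\<infinity>n\<in>pos. a n * cmf g n) * (\<Sum>\<^sub>\<infinity>n\<in>pos. b n * cmf g n) = (\<Sum>\<^sub>\<infinity>n\<in>pos. dconv a b n * cmf g n)"
proof -
  let ?F = "\<lambda>(m,n). (a m * cmf g m) * (b n * cmf g n)"
  let ?S = "Sigma pos (\<lambda>n. {d. d dvd n})"
  let ?i = "\<lambda>(n,d). (d, n div d)"
  have sm: "?F summable_on pos \<times> pos" by (rule abs_summable_summable[OF abs_summable_on_times[OF a b]])
  have bij: "bij_betw ?i ?S (pos \<times> pos)"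
    by (rule bij_betw_byWitness[where f' = "\<lambda>(m,n). (m * n, m)"]) (auto simp: dvd_pos_nat)
  have sm2: "(\<lambda>x. ?F (?i x)) summable_on ?S"
    using sm by (subst summable_on_reindex_bij_betw[OF bij, of ?F])
  have "(\<Sum>\<^sub>\<infinity>n\<in>pos. a n * cmf g n) * (\<Sum>\<^sub>\<infinity>n\<in>pos. b n * cmf g n) =
      (\<Sum>\<^sub>\<infinity>m\<in>pos. \<Sum>\<^sub>\<infinity>n\<in>pos. (a m * cmf g m) * (b n * cmf g n))"
    by (simp add: infsum_cmult_right' infsum_cmult_left')
  also have "\<dots> = infsum ?F (pos \<times> pos)"
    using infsum_Sigma'_banach[of "\<lambda>m n. (a m * cmf g m) * (b n * cmf g n)" pos "\<lambda>_. pos"] sm by simp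
  also have "\<dots> = infsum (\<lambda>x. ?F (?i x)) ?S" by (rule infsum_reindex_bij_betw[OF bij, symmetric])
  also have "\<dots> = (\<Sum>\<^sub>\<infinity>n\<in>pos. \<Sum>\<^sub>\<infinity>d\<in>{d. d dvd n}. ?F (?i (n, d)))"
    using infsum_Sigma'_banach[of "\<lambda>n d. ?F (?i (n, d))" pos "\<lambda>n. {d. d dvd n}"] sm2 by (simp add: case_prod_unfold)
  also have "\<dots> = (\<Sum>\<^sub>\<infinity>n\<in>pos. dconv a b n * cmf g n)"
  proof (rule infsum_cong)
    fix n :: nat assume n: "n \<in> pos"
    have "(\<Sum>\<^sub>\<infinity>d\<in>{d. d dvd n}. ?F (?i (n, d))) = (\<Sum>d | d dvd n. (a d * cmf g d) * (b (n div d) * cmf g (n div d)))"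
      using n by (subst infsum_finite) auto
    also have "\<dots> = (\<Sum>d | d dvd n. (a d * b (n div d)) * cmf g n)"
    proof (rule sum.cong)
      fix d assume "d \<in> {d. d dvd n}"
      then obtain e where "n = d * e" by auto
      then show "(a d * cmf g d) * (b (n div d) * cmf g (n div d)) = (a d * b (n div d)) * cmf g n"
        using n by (simp add: cmf_mult)
    qed auto
    finally show "(\<Sum>\<^sub>\<infinity>d\<in>{d. d dvd n}. ?F (?i (n, d))) = dconv a b n * cmf g n"
      by (simp add: dconv_def sum_distrib_right)
  qed
  finally show ?thesis .
qed

lemma sum_inverse_squares_le: "(\<Sum>d\<in>{2..n}. 1 / (real d)\<^sup>2) \<le> 1"
proof -
  have "(\<Sum>d\<in>{2..n}. 1 / (real d)\<^sup>2) \<le> 1 - 1 / real n" if "n \<ge> 1" for n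
    using that
  proof (induction n rule: nat_induct_at_least)
    case (Suc n)
    have "(\<Sum>d\<in>{2..Suc n}. 1 / (real d)\<^sup>2) = (\<Sum>d\<in>{2..n}. 1 / (real d)\<^sup>2) + 1 / (real (Suc n))\<^sup>2"
      using Suc by simp
    also have "\<dots> \<le> 1 - 1 / real n + 1 / (real (Suc n) * real n)"
      using Suc by (intro add_mono Suc.IH) (simp add: power2_eq_square frac_le mult_left_mono)
    also have "\<dots> = 1 - 1 / real (Suc n)"
    proof -
      have "real n > 0" using Suc by simp
      then show ?thesis by (simp add: divide_simps) (simp add: algebra_simps)
    qed
    finally show ?case .
  qed auto
  from this[of n] show ?thesis by (cases "n \<ge> 1") (auto intro: order_trans)
qed

text \<open>Unfolding the recursion with d = n / e and e \<ge> 2, a bound n^k reproduces itself with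
  the factor r times the sum of e^-k, which is at most 1 for large k.\<close>

lemma dinv_poly_bound:
  fixes a :: "nat \<Rightarrow> complex"
  assumes a1: "a 1 \<noteq> 0" and B: "\<And>n. norm (a n) \<le> B"
  shows "\<exists>k C. \<forall>n. norm (dinv a n) \<le> C * real n ^ k"
proof -
  define r where "r = B / norm (a 1)"
  obtain k0 where k0: "r < 2 ^ k0" using real_arch_pow[of 2 r] by auto
  \<comment> \<open>2^k0 absorbs r; the remaining exponent 2 makes the sum of 1 / e^2 over e \<ge> 2
    at most 1.\<close>
  define k where "k = k0 + 2"
  have r0: "r > 0" using a1 B[of 1] by (auto simp: r_def intro!: divide_pos_pos order_less_le_trans[OF _ B[of 1]])
  have "norm (dinv a n) \<le> 1 / norm (a 1) * real n ^ k" for n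
  proof (induction n rule: less_induct)
    case (less n)
    consider "n = 0" | "n = 1" | "n \<ge> 2" by linarith
    then show ?case
    proof cases
      case 3
      have fin: "finite {d. d dvd n \<and> d < n}" by auto
      have "norm (dinv a n) = 1 / norm (a 1) * norm (\<Sum>d\<in>{d. d dvd n \<and> d < n}. a (n div d) * dinv a d)"
        using 3 by (subst dinv.simps) (simp add: norm_divide)
      also have "\<dots> \<le> 1 / norm (a 1) * (\<Sum>d\<in>{d. d dvd n \<and> d < n}. B * (1 / norm (a 1) * real d ^ k))"
      proof (intro mult_left_mono order_trans[OF norm_sum] sum_mono)
        fix d assume "d \<in> {d. d dvd n \<and> d < n}"
        then show "norm (a (n div d) * dinv a d) \<le> B * (1 / norm (a 1) * real d ^ k)"
          unfolding norm_mult using less.IH B order_trans[OF norm_ge_zero B] by (intro mult_mono) auto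
      qed auto
      also have "\<dots> = 1 / norm (a 1) * (r * (\<Sum>d\<in>{d. d dvd n \<and> d < n}. real d ^ k))"
        by (simp add: r_def sum_distrib_left mult.assoc)
      also have "(\<Sum>d\<in>{d. d dvd n \<and> d < n}. real d ^ k) = (\<Sum>e\<in>(\<lambda>d. n div d) ` {d. d dvd n \<and> d < n}. (real n / real e) ^ k)"
      proof (subst sum.reindex)
        show "inj_on (\<lambda>d. n div d) {d. d dvd n \<and> d < n}"
        proof (rule inj_onI)
          fix d e assume "d \<in> {d. d dvd n \<and> d < n}" "e \<in> {d. d dvd n \<and> d < n}" and eq: "n div d = n div e"
          moreover have "n div (n div d) = d" if "d dvd n" for d using that 3 by (elim dvdE) auto
          ultimately show "d = e" by (metis (mono_tags, lifting) mem_Collect_eq)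
        qed
        show "(\<Sum>d | d dvd n \<and> d < n. real d ^ k) = sum ((\<lambda>e. (real n / real e) ^ k) \<circ> (div) n) {d. d dvd n \<and> d < n}"
          using 3 by (intro sum.cong) (auto simp: real_of_nat_div)
      qed
      also have "\<dots> \<le> (\<Sum>e\<in>{2..n}. (real n / real e) ^ k)"
      proof (intro sum_mono2 subsetI)
        fix e assume "e \<in> (\<lambda>d. n div d) ` {d. d dvd n \<and> d < n}"
        then obtain d where d: "d dvd n" "d < n" "e = n div d" by auto
        then have n: "n = d * e" by (metis dvd_mult_div_cancel)
        have "e \<noteq> 0" using n 3 by (intro notI) simp
        moreover have "e \<noteq> 1" using n d(2) by (intro notI) simp
        moreover have "e \<le> n" unfolding d(3) by (rule div_le_dividend)
        ultimately show "e \<in> {2..n}" by simp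
      qed auto
      also have "\<dots> \<le> (\<Sum>e\<in>{2..n}. real n ^ k / 2 ^ k0 * (1 / (real e)\<^sup>2))"
      proof (rule sum_mono)
        fix e assume e: "e \<in> {2..n}"
        have "2 ^ k0 \<le> real e ^ k0" using e by (intro power_mono) auto
        then have "2 ^ k0 * (real e)\<^sup>2 \<le> real e ^ k" unfolding k_def power_add by (intro mult_right_mono) auto
        then have "real n ^ k / real e ^ k \<le> real n ^ k / (2 ^ k0 * (real e)\<^sup>2)"
          using e by (intro divide_left_mono) auto
        then show "(real n / real e) ^ k \<le> real n ^ k / 2 ^ k0 * (1 / (real e)\<^sup>2)" by (simp add: power_divide)
      qed
      also have "\<dots> = real n ^ k / 2 ^ k0 * (\<Sum>e\<in>{2..n}. 1 / (real e)\<^sup>2)" by (simp add: sum_distrib_left)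
      also have "\<dots> \<le> real n ^ k / 2 ^ k0 * 1" by (intro mult_left_mono sum_inverse_squares_le) auto
      also have "1 / norm (a 1) * (r * (real n ^ k / 2 ^ k0 * 1)) = 1 / norm (a 1) * real n ^ k * (r / 2 ^ k0)"
        by simp
      also have "\<dots> \<le> 1 / norm (a 1) * real n ^ k * 1" using k0 by (intro mult_left_mono) auto
      finally show ?thesis using r0 by (simp add: mult_left_mono divide_right_mono)
    qed (auto simp: dinv.simps norm_divide)
  qed
  then show ?thesis by blast
qed

section \<open>Zero-freeness of the Dirichlet series from finitely many variables\<close>

context periodic_seq begin

text \<open>The exponent is 1 + s because the coefficients are \<open>f n / n\<close>; boundedness
  of \<open>f\<close> then gives absolute convergence for Re s > 0.\<close>

definition Lser :: "complex \<Rightarrow> complex" where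
  "Lser s = (\<Sum>\<^sub>\<infinity>n\<in>pos. f n * of_nat n powr (- (1 + s)))"

lemma Lser_dsum: "Lser s = dsum f (\<lambda>p. of_nat p powr (- (1 + s))) 1"
  unfolding Lser_def dsum_def by (rule infsum_cong) (simp add: cmf_powr)

text \<open>The point belonging to s has infinitely many nonzero coordinates, so the hypothesis does
  not apply to it directly. It is truncated to the primes dividing \<open>N\<close> and a finite set
  \<open>T\<close>. By \<open>f_times_coprime\<close> the primes of \<open>T\<close> split off as
  exact Euler factors whose inverses have product at most \<open>exp Z\<close> in modulus; the
  resulting lower bound is independent of \<open>T\<close> and survives the passage to all
  primes.\<close>

lemma Lser_nonzero:
  assumes nz: "\<And>g. adm g \<Longrightarrow> dsum f g 1 \<noteq> 0" and s: "Re s > 0"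
  shows "Lser s \<noteq> 0"
proof -
  define g :: "nat \<Rightarrow> complex" where "g = (\<lambda>p. of_nat p powr (- (1 + s)))"
  have cg: "csum g" unfolding g_def using s by (intro csum_powr) auto
  have normg: "norm (g p) = real p powr (- (1 + Re s))" if "p > 0" for p
    using that by (simp add: g_def norm_nat_powr)
  have gl1: "norm (g p) < 1" if "prime p" for p
    using prime_gt_1_nat[OF that] s normg[of p] powr_less_cancel_iff[of "real p" "- (1 + Re s)" 0] by simp
  \<comment> \<open>The primes dividing \<open>N\<close> are kept for every \<open>T\<close>,
    because \<open>f_times_coprime\<close> provides an Euler factor only at the others.\<close>
  define h where "h = (\<lambda>T p. if p \<in> T \<or> p dvd N then g p else 0)"
  have ch: "csum (h T)" for T by (rule csum_mono[OF cg]) (auto simp: h_def)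
  have "finite {p. prime p \<and> h {} p \<noteq> 0}"
  proof (rule finite_subset)
    show "{p. prime p \<and> h {} p \<noteq> 0} \<subseteq> {p. p dvd N}" by (auto simp: h_def split: if_splits)
    show "finite {p. p dvd N}" using N by (rule finite_divisors_nat)
  qed
  moreover have "norm (h {} p) * real p < 1" if "prime p" for p
  proof -
    have p: "real p > 1" using prime_gt_1_nat[OF that] by simp
    have "norm (h {} p) * real p \<le> norm (g p) * real p" by (auto simp: h_def)
    also have "\<dots> = real p powr (- (1 + Re s)) * real p powr 1" using p normg[of p] by simp
    also have "\<dots> = real p powr (- Re s)" by (simp only: powr_add[symmetric]) simp
    also have "\<dots> < 1" using p s powr_less_cancel_iff[of "real p" "- Re s" 0] by simp
    finally show ?thesis .
  qed
  ultimately have "adm (h {})" by (simp add: adm_def)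
  then have nz0: "dsum f (h {}) 1 \<noteq> 0" by (rule nz)
  define Z where "Z = (\<Sum>\<^sub>\<infinity>n\<in>pos. norm (cmf g n))"
  have prod: "dsum f (h T) 1 * (\<Prod>p\<in>T. 1 - f p / f 1 * g p) = dsum f (h {}) 1"
    if "finite T" "\<forall>p\<in>T. prime p \<and> coprime p N" for T
    using that
  proof (induction T rule: finite_induct)
    case (insert p T)
    have p: "prime p" "coprime p N" using insert by auto
    have ndvd: "\<not> p dvd N"
      using p(2) coprime_common_divisor[of p N p] prime_gt_1_nat[OF p(1)] by auto
    have up: "h (insert p T) = (h T)(p := g p)" by (auto simp: h_def)
    have "dsum f (h (insert p T)) 1 = dsum f (h T) 1 + g p * dsum f (h (insert p T)) (p * 1)"
      unfolding up using gl1[OF p(1)] insert ndvd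
      by (intro dsum_upd[where B=Bd] p ch f_bound) (auto simp: h_def)
    also have "dsum f (h (insert p T)) (p * 1) = (\<Sum>\<^sub>\<infinity>n\<in>pos. f p / f 1 * (f (n * 1) * cmf (h (insert p T)) n))"
      unfolding dsum_def using f_times_coprime[OF nz p(2)] by (intro infsum_cong) auto
    also have "\<dots> = f p / f 1 * dsum f (h (insert p T)) 1" unfolding dsum_def by (rule infsum_cmult_right')
    finally have "dsum f (h (insert p T)) 1 - g p * (f p / f 1 * dsum f (h (insert p T)) 1) = dsum f (h T) 1"
      by (metis add_diff_cancel_right')
    then have eq: "dsum f (h (insert p T)) 1 * (1 - f p / f 1 * g p) = dsum f (h T) 1"
      by (simp only: right_diff_distrib mult_ac mult_1_right mult_1_left)
    have "dsum f (h (insert p T)) 1 * (\<Prod>p\<in>insert p T. 1 - f p / f 1 * g p) =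
       dsum f (h (insert p T)) 1 * (1 - f p / f 1 * g p) * (\<Prod>p\<in>T. 1 - f p / f 1 * g p)"
      using insert by (simp add: mult.assoc)
    also have "\<dots> = dsum f (h {}) 1" unfolding eq using insert by auto
    finally show ?case .
  qed simp
  have lower: "norm (dsum f (h {}) 1) \<le> norm (dsum f (h T) 1) * exp Z"
    if T: "finite T" "\<forall>p\<in>T. prime p \<and> coprime p N" for T
  proof -
    have "norm (\<Prod>p\<in>T. 1 - f p / f 1 * g p) \<le> (\<Prod>p\<in>T. exp (norm (g p)))"
      unfolding prod_norm[symmetric]
    proof (rule prod_mono, safe)
      fix p assume "p \<in> T"
      then have "norm (f p / f 1 * g p) = norm (g p)"
        using norm_ratio_coprime[OF nz, of p] T unfolding norm_mult by simp
      then have "norm (1 - f p / f 1 * g p) \<le> 1 + norm (g p)"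
        using norm_triangle_ineq4[of 1 "f p / f 1 * g p"] by simp
      also have "\<dots> \<le> exp (norm (g p))" by (rule exp_ge_add_one_self)
      finally show "norm (1 - f p / f 1 * g p) \<le> exp (norm (g p))" .
    qed auto
    also have "\<dots> = exp (\<Sum>p\<in>T. norm (g p))" by (rule exp_sum[OF T(1), symmetric])
    also have "(\<Sum>p\<in>T. norm (g p)) = (\<Sum>p\<in>T. norm (cmf g p))" using T by (intro sum.cong) (auto simp: cmf_prime)
    also have "\<dots> \<le> Z" unfolding Z_def using cg T
      by (intro finite_sum_le_infsum) (auto simp: csum_def prime_gt_0_nat)
    finally have "norm (\<Prod>p\<in>T. 1 - f p / f 1 * g p) \<le> exp Z" by simp
    then show ?thesis unfolding prod[OF T, symmetric] norm_mult by (intro mult_left_mono) auto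
  qed
  \<comment> \<open>The lower bound common to all truncations; \<open>Y\<close> is then so large
    that truncating at \<open>Y\<close> changes the sum by less than \<delta>.\<close>
  define \<delta> where "\<delta> = norm (dsum f (h {}) 1) / exp Z"
  have \<delta>: "\<delta> > 0" using nz0 by (simp add: \<delta>_def)
  have "(\<lambda>n. Bd * norm (cmf g n)) summable_on pos" using cg by (intro summable_on_cmult_right) (auto simp: csum_def)
  then obtain Y where Y: "(\<Sum>\<^sub>\<infinity>n\<in>{Y<..}. Bd * norm (cmf g n)) < \<delta>"
    using infsum_tail_small[of "\<lambda>n. Bd * norm (cmf g n)" \<delta>] \<delta> Bd_nonneg by auto
  define T where "T = {p\<in>{..Y}. prime p \<and> coprime p N}"
  have T: "finite T" "\<forall>p\<in>T. prime p \<and> coprime p N" by (auto simp: T_def)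
  have hc: "cmf (h T) n = (if \<forall>p. prime p \<longrightarrow> p dvd n \<longrightarrow> p \<in> T \<or> p dvd N then cmf g n else 0)" if "n > 0" for n
  proof (cases "\<forall>p. prime p \<longrightarrow> p dvd n \<longrightarrow> p \<in> T \<or> p dvd N")
    case True
    then have "cmf (h T) n = cmf g n" using that by (intro cmf_cong) (auto simp: h_def)
    then show ?thesis using True by simp
  next
    case False
    then obtain p where "prime p" "p dvd n" "h T p = 0" by (auto simp: h_def)
    then have "cmf (h T) n = 0" using that by (intro cmf_eq_0)
    then show ?thesis by (simp only: False if_False)
  qed
  have small: "cmf (h T) n = cmf g n" if "n > 0" "n \<le> Y" for n
  proof -
    have "p \<in> T \<or> p dvd N" if p: "prime p" "p dvd n" for p
    proof -
      have "p \<le> Y" using dvd_imp_le[OF p(2) \<open>n > 0\<close>] \<open>n \<le> Y\<close> by simp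
      then show ?thesis using p prime_imp_coprime[of p N] by (auto simp: T_def)
    qed
    then show ?thesis using hc[OF that(1)] by simp
  qed
  have sd: "(\<lambda>n. f (n * 1) * cmf g n) summable_on pos" "(\<lambda>n. f (n * 1) * cmf (h T) n) summable_on pos"
    by (rule dsum_summable[where B=Bd and F=f], rule cg ch, rule f_bound)+
  have "norm (dsum f g 1 - dsum f (h T) 1) = norm (\<Sum>\<^sub>\<infinity>n\<in>pos. f (n * 1) * cmf g n + (- 1) * (f (n * 1) * cmf (h T) n))"
    unfolding infsum_add[OF sd(1) summable_on_cmult_right[OF sd(2), of "- 1"]] infsum_cmult_right' dsum_def by simp
  also have "(\<Sum>\<^sub>\<infinity>n\<in>pos. f (n * 1) * cmf g n + (- 1) * (f (n * 1) * cmf (h T) n)) =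
       (\<Sum>\<^sub>\<infinity>n\<in>{Y<..}. f n * (cmf g n - cmf (h T) n))"
    by (rule infsum_cong_neutral) (auto simp: small algebra_simps)
  also have "norm \<dots> \<le> (\<Sum>\<^sub>\<infinity>n\<in>{Y<..}. Bd * norm (cmf g n))"
  proof -
    have smY: "(\<lambda>n. Bd * norm (cmf g n)) summable_on {Y<..}"
      by (intro summable_on_cmult_right summable_on_subset_banach[OF cg[unfolded csum_def]]) auto
    have le: "norm (f n * (cmf g n - cmf (h T) n)) \<le> Bd * norm (cmf g n)" if "n \<in> {Y<..}" for n
    proof -
      have "cmf (h T) n = cmf g n \<or> cmf (h T) n = 0"
      proof -
        have "n > 0" using that by simp
        from hc[OF this] show ?thesis by argo
      qed
      then have "norm (cmf g n - cmf (h T) n) \<le> norm (cmf g n)" by auto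
      then show ?thesis unfolding norm_mult by (intro mult_mono f_bound Bd_nonneg) auto
    qed
    have ab: "(\<lambda>n. norm (f n * (cmf g n - cmf (h T) n))) summable_on {Y<..}"
      by (rule summable_on_comparison_test[OF smY]) (use le in auto)
    show ?thesis by (rule order_trans[OF norm_infsum_bound[OF ab] infsum_mono[OF ab smY le]])
  qed
  also have "\<dots> < \<delta>" by (rule Y)
  also have "\<delta> \<le> norm (dsum f (h T) 1)" using lower[OF T] by (simp add: \<delta>_def field_simps)
  finally have "dsum f g 1 \<noteq> 0" by auto
  then show ?thesis by (simp add: Lser_dsum g_def)
qed

end

section \<open>Coefficients of a Dirichlet series bounded on a half plane\<close>

lemma convex_vertical_line: "convex {s. Re s = x}"
  unfolding convex_def by (auto simp: distrib_right[symmetric])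


text \<open>The primitive of \<open>n\<^sup>s A(s)\<close> grows like \<open>u n * s\<close> along a vertical line far to the right, and
  its growth along vertical lines does not depend on the line.\<close>

lemma dirichlet_coeff_bound:
  fixes u :: "nat \<Rightarrow> complex"
  assumes hol: "A holomorphic_on {s. Re s > \<tau>}" and bd: "\<And>s. Re s > \<tau> \<Longrightarrow> norm (A s) \<le> K"
    and ac: "(\<lambda>m. norm (u m) * real m powr (- c)) summable_on pos"
    and eq: "\<And>s. Re s = c \<Longrightarrow> A s = (\<Sum>\<^sub>\<infinity>m\<in>pos. u m * of_nat m powr (- s))"
    and \<sigma>: "\<tau> < \<sigma>" "\<sigma> < c" and n: "n > 0"
  shows "norm (u n) \<le> real n powr \<sigma> * K"
proof (rule field_le_epsilon)
  fix e :: real assume e: "e > 0"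
  let ?S = "{s. Re s > \<tau>}"
  define g where "g = (\<lambda>s. of_nat n powr s * A s)"
  have K0: "K \<ge> 0" using order_trans[OF norm_ge_zero bd[of "of_real \<sigma>"]] \<sigma> by simp
  have "g holomorphic_on ?S" unfolding g_def using n by (intro holomorphic_intros hol) auto
  moreover have "open ?S" by (simp add: open_halfspace_Re_gt)
  moreover have "convex ?S" by (simp add: convex_halfspace_Re_gt)
  ultimately obtain G where G: "\<And>s. s \<in> ?S \<Longrightarrow> (G has_field_derivative g s) (at s within ?S)"
    using holomorphic_convex_primitive' by metis
  then have G: "(G has_field_derivative g s) (at s)" if "Re s > \<tau>" for s
    using that \<open>open ?S\<close> by (metis at_within_open mem_Collect_eq)
  have gb: "norm (g s) \<le> real n powr Re s * K" if "Re s > \<tau>" for s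
    unfolding g_def norm_mult norm_nat_powr[OF n] using bd[OF that] by (intro mult_left_mono) auto
  define e' where "e' = e / (2 * real n powr c)"
  have e': "e' > 0" using e n by (simp add: e'_def)
  obtain M where M: "M \<ge> n" "(\<Sum>\<^sub>\<infinity>m\<in>{M<..}. norm (u m) * real m powr (- c)) < e'"
    using infsum_tail_small[OF ac _ e'] by (metis (no_types, lifting) linorder_le_cases mult_nonneg_nonneg norm_ge_zero powr_ge_zero)
  define J where "J = {0<..M} - {n}"
  \<comment> \<open>n^s m^-s = exp (s l m) with l m nonzero for m different from n, so these terms
    have primitives bounded on vertical lines; only m = n produces linear growth.\<close>
  define l where "l = (\<lambda>m. complex_of_real (ln (real n / real m)))"
  have l: "l m \<noteq> 0" if "m \<in> J" for m using that n by (auto simp: l_def J_def)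
  have pw: "of_nat n powr s * of_nat m powr (- s) = exp (s * l m)" if "m > 0" for m s
    using that n by (simp add: powr_def l_def ln_div exp_add[symmetric] Ln_of_nat algebra_simps exp_diff exp_minus field_simps)
  define G1 where "G1 = (\<lambda>s. u n * s + (\<Sum>m\<in>J. u m * exp (s * l m) / l m))"
  have G1: "(G1 has_field_derivative (\<Sum>m\<in>{0<..M}. u m * (of_nat n powr s * of_nat m powr (- s)))) (at s)" for s
  proof -
    have "{0<..M} = insert n J" using n M by (auto simp: J_def)
    moreover have "n \<notin> J" "finite J" by (auto simp: J_def)
    moreover have "of_nat n powr s * of_nat n powr (- s) = (1::complex)"
      using n pw[of n s] by (simp add: l_def)
    ultimately have "(\<Sum>m\<in>{0<..M}. u m * (of_nat n powr s * of_nat m powr (- s))) =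
         u n + (\<Sum>m\<in>J. u m * (of_nat n powr s * of_nat m powr (- s)))" by simp
    also have "(\<Sum>m\<in>J. u m * (of_nat n powr s * of_nat m powr (- s))) = (\<Sum>m\<in>J. u m * exp (s * l m))"
      by (intro sum.cong) (auto simp: pw J_def)
    also have "(G1 has_field_derivative (u n + (\<Sum>m\<in>J. u m * exp (s * l m)))) (at s)"
      unfolding G1_def by (auto intro!: derivative_eq_intros sum.cong simp: l)
    finally show ?thesis .
  qed
  define C where "C = (\<Sum>m\<in>J. norm (u m) * (real n / real m) powr c / norm (l m))"
  have tail: "norm (g s - (\<Sum>m\<in>{0<..M}. u m * (of_nat n powr s * of_nat m powr (- s)))) \<le> e / 2" if s: "Re s = c" for s
  proof -
    have ac': "(\<lambda>m. norm (u m * of_nat m powr (- s))) summable_on pos"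
      using ac by (rule summable_on_cong[THEN iffD1, rotated]) (auto simp: norm_mult norm_nat_powr s)
    then have sm: "(\<lambda>m. u m * of_nat m powr (- s)) summable_on pos" by (rule abs_summable_summable)
    have "A s = infsum (\<lambda>m. u m * of_nat m powr (- s)) ({0<..M} \<union> {M<..})"
      unfolding eq[OF s] by (rule arg_cong[of _ _ "infsum _"]) auto
    also have "\<dots> = (\<Sum>\<^sub>\<infinity>m\<in>{0<..M}. u m * of_nat m powr (- s)) + (\<Sum>\<^sub>\<infinity>m\<in>{M<..}. u m * of_nat m powr (- s))"
      by (rule infsum_Un_disjoint) (auto intro: summable_on_subset_banach[OF sm])
    finally have As: "A s = (\<Sum>m\<in>{0<..M}. u m * of_nat m powr (- s)) + (\<Sum>\<^sub>\<infinity>m\<in>{M<..}. u m * of_nat m powr (- s))" by simp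
    have "g s - (\<Sum>m\<in>{0<..M}. u m * (of_nat n powr s * of_nat m powr (- s))) =
        of_nat n powr s * (\<Sum>\<^sub>\<infinity>m\<in>{M<..}. u m * of_nat m powr (- s))"
      unfolding g_def As by (simp add: distrib_left sum_distrib_left mult_ac)
    also have "norm \<dots> = real n powr c * norm (\<Sum>\<^sub>\<infinity>m\<in>{M<..}. u m * of_nat m powr (- s))"
      by (simp add: norm_mult norm_nat_powr[OF n] s)
    also have "norm (\<Sum>\<^sub>\<infinity>m\<in>{M<..}. u m * of_nat m powr (- s)) \<le> (\<Sum>\<^sub>\<infinity>m\<in>{M<..}. norm (u m * of_nat m powr (- s)))"
      by (rule norm_infsum_bound) (auto intro: summable_on_subset_banach[OF ac'])
    also have "\<dots> = (\<Sum>\<^sub>\<infinity>m\<in>{M<..}. norm (u m) * real m powr (- c))"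
      by (rule infsum_cong) (auto simp: norm_mult norm_nat_powr s)
    also have "\<dots> \<le> e'" using M by simp
    finally have "norm (g s - (\<Sum>m\<in>{0<..M}. u m * (of_nat n powr s * of_nat m powr (- s)))) \<le> real n powr c * e'"
      by (simp add: mult_left_mono)
    also have "real n powr c * e' = e / 2" using n by (simp add: e'_def)
    finally show ?thesis .
  qed
  \<comment> \<open>The increment of \<open>G\<close> over a vertical segment of length 2 T. On Re s
    = \<sigma> it is at most 2 T n^\<sigma> K, and moving the segment to Re s = c costs two
    horizontal pieces. There it agrees up to T e with the increment of \<open>G1\<close>, which is 2
    i T times \<open>u n\<close> up to 2 C. For large T only the terms proportional to T
    count.\<close>
  have key: "2 * T * norm (u n) \<le> 2 * T * (real n powr \<sigma> * K) + 2 * ((c - \<sigma>) * (real n powr c * K)) + T * e + 2 * C"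
    if T: "T > 0" for T
  proof -
    define P where "P = (\<lambda>x y. Complex x y)"
    have seg1: "norm (G (P \<sigma> T) - G (P \<sigma> (- T))) \<le> real n powr \<sigma> * K * norm (P \<sigma> T - P \<sigma> (- T))"
    proof (rule field_differentiable_bound[where S = "{s. Re s = \<sigma>}"])
      fix s assume "s \<in> {s. Re s = \<sigma>}"
      then have s: "Re s = \<sigma>" by simp
      then show "(G has_field_derivative g s) (at s within {s. Re s = \<sigma>})"
        using \<sigma> by (intro has_field_derivative_at_within[OF G]) auto
      show "norm (g s) \<le> real n powr \<sigma> * K" using gb[of s] s \<sigma> by simp
    qed (auto simp: P_def convex_vertical_line)
    have seg2: "norm (G (P c y) - G (P \<sigma> y)) \<le> real n powr c * K * norm (P c y - P \<sigma> y)" for y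
    proof (rule field_differentiable_bound[where S = "closed_segment (P \<sigma> y) (P c y)"])
      fix s assume "s \<in> closed_segment (P \<sigma> y) (P c y)"
      then have s: "\<sigma> \<le> Re s" "Re s \<le> c"
        using \<sigma> by (auto simp: closed_segment_same_Im P_def closed_segment_eq_real_ivl)
      then show "(G has_field_derivative g s) (at s within closed_segment (P \<sigma> y) (P c y))"
        using \<sigma> by (intro has_field_derivative_at_within[OF G]) auto
      have "norm (g s) \<le> real n powr Re s * K" using s \<sigma> by (intro gb) auto
      also have "\<dots> \<le> real n powr c * K" using s n K0 by (intro mult_right_mono powr_mono) auto
      finally show "norm (g s) \<le> real n powr c * K" .
    qed auto
    have seg3: "norm ((G (P c T) - G1 (P c T)) - (G (P c (- T)) - G1 (P c (- T)))) \<le> e / 2 * norm (P c T - P c (- T))"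
    proof (rule field_differentiable_bound[where S = "{s. Re s = c}" and f = "\<lambda>s. G s - G1 s"
          and f' = "\<lambda>s. g s - (\<Sum>m\<in>{0<..M}. u m * (of_nat n powr s * of_nat m powr (- s)))"])
      fix s assume "s \<in> {s. Re s = c}"
      then show "((\<lambda>s. G s - G1 s) has_field_derivative g s - (\<Sum>m\<in>{0<..M}. u m * (of_nat n powr s * of_nat m powr (- s))))
           (at s within {s. Re s = c})"
        using \<sigma> by (intro has_field_derivative_at_within[OF DERIV_diff[OF G G1]]) auto
    qed (use tail in \<open>auto simp: P_def convex_vertical_line\<close>)
    have nP: "norm (P x T - P x (- T)) = 2 * T" "norm (P c y - P \<sigma> y) = c - \<sigma>" for x y
      using T \<sigma> by (auto simp: P_def complex_diff cmod_def real_sqrt_mult)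
    have C: "norm (\<Sum>m\<in>J. u m * exp (P c y * l m) / l m) \<le> C" for y
      unfolding C_def
    proof (intro order_trans[OF norm_sum] sum_mono)
      fix m assume m: "m \<in> J"
      then have "(real n / real m) powr c = exp (c * ln (real n / real m))" using n by (simp add: powr_def J_def)
      then show "norm (u m * exp (P c y * l m) / l m) \<le> norm (u m) * (real n / real m) powr c / norm (l m)"
        by (simp add: norm_mult norm_divide l_def P_def)
    qed
    define Y where "Y = (\<lambda>y. \<Sum>m\<in>J. u m * exp (P c y * l m) / l m)"
    have "u n * (P c T - P c (- T)) = (G1 (P c T) - G1 (P c (- T))) - (Y T - Y (- T))"
      by (simp add: G1_def Y_def algebra_simps)
    then have "norm (u n) * norm (P c T - P c (- T)) = norm ((G1 (P c T) - G1 (P c (- T))) - (Y T - Y (- T)))"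
      by (metis norm_mult)
    also have "\<dots> \<le> norm (G1 (P c T) - G1 (P c (- T))) + norm (Y T - Y (- T))" by (rule norm_triangle_ineq4)
    also have "norm (Y T - Y (- T)) \<le> norm (Y T) + norm (Y (- T))" by (rule norm_triangle_ineq4)
    also have "\<dots> \<le> C + C" using C unfolding Y_def by (intro add_mono)
    finally have "norm (u n) * (2 * T) \<le> norm (G1 (P c T) - G1 (P c (- T))) + (C + C)" unfolding nP by simp
    also have "norm (G1 (P c T) - G1 (P c (- T))) \<le> norm (G (P c T) - G (P c (- T))) + e / 2 * (2 * T)"
      using seg3 norm_triangle_ineq4[of "G (P c T) - G (P c (- T))" "(G (P c T) - G1 (P c T)) - (G (P c (- T)) - G1 (P c (- T)))"]
      unfolding nP by (simp add: algebra_simps)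
    also have "norm (G (P c T) - G (P c (- T))) \<le> norm (G (P \<sigma> T) - G (P \<sigma> (- T))) + 2 * (real n powr c * K * (c - \<sigma>))"
    proof -
      have "G (P c T) - G (P c (- T)) = (G (P \<sigma> T) - G (P \<sigma> (- T))) + ((G (P c T) - G (P \<sigma> T)) - (G (P c (- T)) - G (P \<sigma> (- T))))"
        by simp
      from arg_cong[OF this, of norm] show ?thesis
        using seg2[of T] seg2[of "- T"] norm_triangle_ineq[of "G (P \<sigma> T) - G (P \<sigma> (- T))" "(G (P c T) - G (P \<sigma> T)) - (G (P c (- T)) - G (P \<sigma> (- T)))"]
          norm_triangle_ineq4[of "G (P c T) - G (P \<sigma> T)" "G (P c (- T)) - G (P \<sigma> (- T))"] unfolding nP
        by linarith
    qed
    also have "norm (G (P \<sigma> T) - G (P \<sigma> (- T))) \<le> real n powr \<sigma> * K * (2 * T)" using seg1 unfolding nP .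
    finally show ?thesis by (simp add: algebra_simps)
  qed
  show "norm (u n) \<le> real n powr \<sigma> * K + e"
  proof (rule ccontr)
    assume neg: "\<not> ?thesis"
    define D where "D = 2 * ((c - \<sigma>) * (real n powr c * K)) + 2 * C"
    define T where "T = (\<bar>D\<bar> + 1) / e"
    have T: "T > 0" using e by (simp add: T_def)
    have "2 * T * (real n powr \<sigma> * K + e) \<le> 2 * T * norm (u n)" using neg T by (intro mult_left_mono) auto
    also have "\<dots> \<le> 2 * T * (real n powr \<sigma> * K) + T * e + D" using key[OF T] by (simp add: D_def)
    finally have "T * e \<le> D" by (simp add: algebra_simps)
    moreover have "T * e = \<bar>D\<bar> + 1" using e by (simp add: T_def)
    ultimately show False by linarith
  qed
qed

section \<open>Lower bound and inversion of the Dirichlet series\<close>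

context periodic_seq begin

lemma Lser_term_le: "n > 0 \<Longrightarrow> \<sigma> \<le> Re s \<Longrightarrow> norm (f n * of_nat n powr (- (1 + s))) \<le> Bd * real n powr (- (1 + \<sigma>))"
  unfolding norm_mult using f_bound Bd_nonneg by (intro mult_mono) (auto simp: norm_nat_powr intro!: powr_mono)

lemma powr_summable_on: "\<sigma> > 0 \<Longrightarrow> (\<lambda>n. C * real n powr (- (1 + \<sigma>))) summable_on pos"
proof -
  assume "\<sigma> > 0"
  then have "summable (\<lambda>n. real n powr (- (1 + \<sigma>)))" by (simp add: summable_real_powr_iff)
  then have "(\<lambda>n. real n powr (- (1 + \<sigma>))) summable_on UNIV"
    by (intro summable_nonneg_imp_summable_on) auto
  then have "(\<lambda>n. real n powr (- (1 + \<sigma>))) summable_on pos" by (rule summable_on_subset_banach) simp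
  then show ?thesis by (rule summable_on_cmult_right)
qed

lemma Lser_abs_summable: "Re s > 0 \<Longrightarrow> (\<lambda>n. norm (f n * of_nat n powr (- (1 + s)))) summable_on pos"
  by (rule summable_on_comparison_test[OF powr_summable_on[of "Re s" Bd]]) (use Lser_term_le in auto)

lemma Lser_holomorphic: "\<sigma> > 0 \<Longrightarrow> Lser holomorphic_on {s. Re s > \<sigma>}"
  unfolding Lser_def
proof (rule holomorphic_infsum[where M = "\<lambda>n. Bd * real n powr (- (1 + \<sigma>))"])
  assume "\<sigma> > 0"
  then show "(\<lambda>n. Bd * real n powr (- (1 + \<sigma>))) summable_on pos" by (rule powr_summable_on)
  fix n :: nat assume n: "n \<in> pos"
  show "(\<lambda>s. f n * of_nat n powr (- (1 + s))) holomorphic_on {s. Re s > \<sigma>}"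
    using n by (intro holomorphic_intros) auto
  show "norm (f n * of_nat n powr (- (1 + s))) \<le> Bd * real n powr (- (1 + \<sigma>))" if "s \<in> {s. Re s > \<sigma>}" for s
    using n that by (intro Lser_term_le) auto
qed (rule open_halfspace_Re_gt)

lemma Lser_bound: "\<sigma> > 0 \<Longrightarrow> \<sigma> \<le> Re s \<Longrightarrow> norm (Lser s) \<le> (\<Sum>\<^sub>\<infinity>n\<in>pos. Bd * real n powr (- (1 + \<sigma>)))"
proof -
  assume a: "\<sigma> > 0" "\<sigma> \<le> Re s"
  have ab: "(\<lambda>n. norm (f n * of_nat n powr (- (1 + s)))) summable_on pos" using a by (intro Lser_abs_summable) auto
  have "norm (Lser s) \<le> (\<Sum>\<^sub>\<infinity>n\<in>pos. norm (f n * of_nat n powr (- (1 + s))))"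
    unfolding Lser_def by (rule norm_infsum_bound[OF ab])
  also have "\<dots> \<le> (\<Sum>\<^sub>\<infinity>n\<in>pos. Bd * real n powr (- (1 + \<sigma>)))"
    by (rule infsum_mono[OF ab powr_summable_on[OF a(1)] Lser_term_le]) (use a in auto)
  finally show ?thesis .
qed

text \<open>All terms but the first are O(2^(-Re s)). This confines small values to a vertical
  strip.\<close>

lemma Lser_large:
  assumes "f 1 \<noteq> 0"
  shows "\<exists>R>1. \<forall>s. Re s \<ge> R \<longrightarrow> norm (Lser s) \<ge> norm (f 1) / 2"
proof -
  define C where "C = (\<Sum>\<^sub>\<infinity>n\<in>{1<..}. Bd * real n powr (- 2))"
  have sm: "(\<lambda>n. Bd * real n powr (- 2)) summable_on {1<..}"
    by (rule summable_on_subset_banach[of _ pos]) (use powr_summable_on[of 1 Bd] in auto)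
  have C0: "C \<ge> 0" unfolding C_def using Bd_nonneg by (intro infsum_nonneg) auto
  have est: "norm (Lser s - f 1) \<le> C * 2 powr (1 - Re s)" if s: "Re s \<ge> 1" for s
  proof -
    have ab: "(\<lambda>n. norm (f n * of_nat n powr (- (1 + s)))) summable_on {1<..}"
      by (rule summable_on_subset_banach[of _ pos]) (use Lser_abs_summable[of s] s in auto)
    have "Lser s = infsum (\<lambda>n. f n * of_nat n powr (- (1 + s))) ({1} \<union> {1<..})"
      unfolding Lser_def by (rule arg_cong[of _ _ "infsum _"]) auto
    also have "\<dots> = f 1 + (\<Sum>\<^sub>\<infinity>n\<in>{1<..}. f n * of_nat n powr (- (1 + s)))"
      using abs_summable_summable[OF ab] by (subst infsum_Un_disjoint) auto
    finally have "norm (Lser s - f 1) = norm (\<Sum>\<^sub>\<infinity>n\<in>{1<..}. f n * of_nat n powr (- (1 + s)))" by simp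
    also have "\<dots> \<le> (\<Sum>\<^sub>\<infinity>n\<in>{1<..}. norm (f n * of_nat n powr (- (1 + s))))" by (rule norm_infsum_bound[OF ab])
    also have "\<dots> \<le> (\<Sum>\<^sub>\<infinity>n\<in>{1<..}. Bd * real n powr (- 2) * 2 powr (1 - Re s))"
    proof (rule infsum_mono[OF ab])
      show "(\<lambda>n. Bd * real n powr (- 2) * 2 powr (1 - Re s)) summable_on {1<..}" by (rule summable_on_cmult_left[OF sm])
      fix n :: nat assume n: "n \<in> {1<..}"
      have "norm (f n * of_nat n powr (- (1 + s))) \<le> Bd * real n powr (- (1 + Re s))" using n by (intro Lser_term_le) auto
      also have "real n powr (- (1 + Re s)) = real n powr (- 2) * real n powr (1 - Re s)"
        by (simp add: powr_add[symmetric])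
      also have "real n powr (1 - Re s) \<le> 2 powr (1 - Re s)"
        using n s by (intro powr_mono2') auto
      finally show "norm (f n * of_nat n powr (- (1 + s))) \<le> Bd * real n powr (- 2) * 2 powr (1 - Re s)"
        using Bd_nonneg by (simp add: mult_left_mono mult.assoc)
    qed
    also have "\<dots> = C * 2 powr (1 - Re s)" unfolding C_def by (rule infsum_cmult_left')
    finally show ?thesis .
  qed
  have "((\<lambda>x. C * 2 powr (1 - x)) \<longlongrightarrow> 0) at_top" by real_asymp
  then have "eventually (\<lambda>x. C * 2 powr (1 - x) < norm (f 1) / 2) at_top"
    using assms by (intro order_tendstoD) auto
  then obtain R0 where R0: "\<And>x. x \<ge> R0 \<Longrightarrow> C * 2 powr (1 - x) < norm (f 1) / 2"
    unfolding eventually_at_top_linorder by blast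
  show ?thesis
  proof (intro exI[of _ "max 2 R0"] conjI allI impI)
    fix s assume "Re s \<ge> max 2 R0"
    then have "norm (Lser s - f 1) < norm (f 1) / 2" using est[of s] R0[of "Re s"] by auto
    then show "norm (Lser s) \<ge> norm (f 1) / 2"
      using norm_triangle_ineq2[of "f 1" "f 1 - Lser s"] by (simp add: norm_minus_commute)
  qed auto
qed

text \<open>A zero-free Dirichlet series is bounded away from 0: otherwise a normal-family limit of vertical
  translates has a zero, which Hurwitz's theorem forbids.\<close>

lemma Lser_lower_bound:
  assumes nz: "\<And>s. Re s > 0 \<Longrightarrow> Lser s \<noteq> 0" and f1: "f 1 \<noteq> 0" and \<sigma>: "\<sigma> > 0"
  shows "\<exists>m>0. \<forall>s. Re s > \<sigma> \<longrightarrow> norm (Lser s) \<ge> m"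
proof (rule ccontr)
  assume neg: "\<not> ?thesis"
  obtain R where R: "R > 1" "\<And>s. Re s \<ge> R \<Longrightarrow> norm (Lser s) \<ge> norm (f 1) / 2" using Lser_large[OF f1] by blast
  have "\<exists>s. Re s > \<sigma> \<and> norm (Lser s) < min (norm (f 1) / 2) (1 / real (Suc j))" for j
  proof -
    have "min (norm (f 1) / 2) (1 / real (Suc j)) > 0" using f1 by simp
    then show ?thesis using neg by (meson not_le)
  qed
  then obtain t where t: "\<And>j. Re (t j) > \<sigma>" "\<And>j. norm (Lser (t j)) < min (norm (f 1) / 2) (1 / real (Suc j))"
    by metis
  \<comment> \<open>Points with small value stay left of \<open>R\<close>, so their real parts have
    a convergent subsequence; the possibly unbounded imaginary parts are translated away
    below.\<close>
  have tR: "Re (t j) \<in> {\<sigma>..R}" for j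
    using t(1)[of j] t(2)[of j] R(2)[of "t j"] by (cases "Re (t j) \<le> R") auto
  obtain x r1 where x: "x \<in> {\<sigma>..R}" "strict_mono r1" "((\<lambda>j. Re (t j)) \<circ> r1) \<longlonglongrightarrow> x"
    using compact_Icc[of \<sigma> R] tR unfolding compact_def by (metis (no_types, lifting))
  \<comment> \<open>Starting at \<sigma> / 2 makes the limit x \<ge> \<sigma> an interior
    point.\<close>
  define S where "S = {s. Re s > \<sigma> / 2}"
  have S: "open S" "connected S" unfolding S_def
    by (rule open_halfspace_Re_gt, rule convex_connected, rule convex_halfspace_Re_gt)
  define F where "F = (\<lambda>j s. Lser (s + \<i> * of_real (Im (t (r1 j)))))"
  have holF: "F j holomorphic_on S" for j
  proof -
    have "(Lser \<circ> (\<lambda>s. s + \<i> * of_real (Im (t (r1 j))))) holomorphic_on S"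
      by (rule holomorphic_on_compose_gen[OF _ Lser_holomorphic[of "\<sigma> / 2"]])
         (use \<sigma> in \<open>auto simp: S_def intro!: holomorphic_intros\<close>)
    then show ?thesis by (simp add: F_def o_def)
  qed
  have bF: "norm (F j s) \<le> (\<Sum>\<^sub>\<infinity>n\<in>pos. Bd * real n powr (- (1 + \<sigma> / 2)))" if "s \<in> S" for j s
    unfolding F_def using \<sigma> that by (intro Lser_bound) (auto simp: S_def)
  obtain g r where g: "g holomorphic_on S" "strict_mono r" "\<And>x. x \<in> S \<Longrightarrow> (\<lambda>n. F (r n) x) \<longlonglongrightarrow> g x"
      "\<And>K. compact K \<Longrightarrow> K \<subseteq> S \<Longrightarrow> uniform_limit K (F \<circ> r) g sequentially"
    by (rule Montel[OF S(1), of "range F" F]) (use holF bF in blast)+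
  have xS: "of_real y \<in> S" if "y \<in> {\<sigma>..R}" for y using that \<sigma> by (auto simp: S_def)
  define K where "K = complex_of_real ` {\<sigma>..R}"
  have K: "compact K" "K \<subseteq> S" unfolding K_def using xS by (auto intro!: compact_continuous_image continuous_intros)
  define y where "y = (\<lambda>j. complex_of_real (Re (t (r1 (r j)))))"
  have ylim: "y \<longlonglongrightarrow> of_real x"
    using LIMSEQ_subseq_LIMSEQ[OF x(3) g(2)] unfolding y_def by (auto intro!: tendsto_of_real simp: o_def)
  have gx0: "g (of_real x) = 0"
  proof -
    have "isCont g (of_real x)"
      using g(1) S(1) xS[OF x(1)] by (metis continuous_on_eq_continuous_at holomorphic_on_imp_continuous_on)
    then have 1: "(\<lambda>j. g (y j)) \<longlonglongrightarrow> g (of_real x)" using ylim by (rule isCont_tendsto_compose)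
    have "(\<lambda>j. F (r j) (y j) - g (y j)) \<longlonglongrightarrow> 0"
    proof (rule tendstoI)
      fix e :: real assume "e > 0"
      then have "eventually (\<lambda>j. \<forall>z\<in>K. dist ((F \<circ> r) j z) (g z) < e) sequentially"
        using g(4)[OF K] by (rule uniform_limitD[rotated])
      then show "eventually (\<lambda>j. dist (F (r j) (y j) - g (y j)) 0 < e) sequentially"
        by eventually_elim (use tR in \<open>auto simp: K_def y_def dist_norm\<close>)
    qed
    moreover have "(\<lambda>j. F (r j) (y j)) \<longlonglongrightarrow> 0"
    proof (rule Lim_null_comparison)
      have "strict_mono (r1 \<circ> r)" using x(2) g(2) by (rule strict_mono_o)
      then have ge: "r1 (r j) \<ge> j" for j using seq_suble[of "r1 \<circ> r" j] by simp
      show "eventually (\<lambda>j. norm (F (r j) (y j)) \<le> 1 / real (Suc j)) sequentially"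
      proof (intro always_eventually allI)
        fix j
        have "y j + \<i> * of_real (Im (t (r1 (r j)))) = t (r1 (r j))" by (simp add: y_def complex_eq_iff)
        then have "norm (F (r j) (y j)) = norm (Lser (t (r1 (r j))))" by (simp add: F_def)
        also have "\<dots> \<le> 1 / real (Suc (r1 (r j)))" using t(2)[of "r1 (r j)"] by simp
        also have "\<dots> \<le> 1 / real (Suc j)" using ge[of j] by (intro divide_left_mono) auto
        finally show "norm (F (r j) (y j)) \<le> 1 / real (Suc j)" .
      qed
      show "(\<lambda>j. 1 / real (Suc j)) \<longlonglongrightarrow> 0" by real_asymp
    qed
    ultimately have "(\<lambda>j. F (r j) (y j) - (F (r j) (y j) - g (y j))) \<longlonglongrightarrow> 0 - 0" by (intro tendsto_diff)
    then have "(\<lambda>j. g (y j)) \<longlonglongrightarrow> 0" by simp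
    then show ?thesis using 1 LIMSEQ_unique by blast
  qed
  \<comment> \<open>\<open>g\<close> vanishes at x, whereas at \<open>R\<close> every translate has
    modulus at least |f 1| / 2; this excludes the degenerate case of Hurwitz's theorem.\<close>
  have "\<not> g constant_on S"
  proof
    assume "g constant_on S"
    then have "g (of_real R) = 0" using gx0 xS x(1) \<sigma> R(1) unfolding constant_on_def
      by (metis atLeastAtMost_iff order.trans order_refl)
    moreover have "norm (g (of_real R)) \<ge> norm (f 1) / 2"
    proof (rule tendsto_lowerbound)
      have "\<sigma> \<le> R" using x(1) by simp
      then show "(\<lambda>n. norm (F (r n) (of_real R))) \<longlonglongrightarrow> norm (g (of_real R))" using xS[of R] by (intro tendsto_norm g(3)) auto
      show "eventually (\<lambda>n. norm (f 1) / 2 \<le> norm (F (r n) (of_real R))) sequentially"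
        unfolding F_def by (intro always_eventually allI R(2)) auto
    qed auto
    ultimately show False using f1 by simp
  qed
  then have "g (of_real x) \<noteq> 0"
    using holF nz \<sigma> xS[OF x(1)]
    by (intro Hurwitz_no_zeros[where S = S and \<F> = "F \<circ> r", OF S _ g(1) g(4)]) (auto simp: F_def S_def o_def)
  then show False using gx0 by simp
qed

text \<open>Finitely many coordinates of modulus below 1 leave room for some \<sigma> > 0 with |z_p|
  p^\<sigma> < 1 at all of them. Since the Dirichlet inverse \<open>u\<close> is O(n^\<sigma>), its
  lift converges absolutely at the point, and \<open>infsum_dconv\<close> exhibits it as the inverse
  of \<open>dsum f g 1\<close>.\<close>

lemma dsum_nonzero_of_Lser_nonzero:
  assumes nz: "\<And>s. Re s > 0 \<Longrightarrow> Lser s \<noteq> 0" and f1: "f 1 \<noteq> 0" and g: "adm g"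
  shows "dsum f g 1 \<noteq> 0"
proof -
  define a where "a = (\<lambda>n. f n / of_nat n)"
  define u where "u = dinv a"
  have a1: "a 1 \<noteq> 0" using f1 by (simp add: a_def)
  have aB: "norm (a n) \<le> Bd" for n
  proof (cases "n = 0")
    case False
    then have "norm (f n) / real n \<le> norm (f n) / 1" by (intro divide_left_mono) auto
    then show ?thesis using f_bound[of n] by (simp add: a_def norm_divide)
  qed (simp add: a_def Bd_nonneg)
  obtain k C where kC: "\<And>n. norm (u n) \<le> C * real n ^ k" unfolding u_def using dinv_poly_bound[where a=a, OF a1 aB] by blast
  \<comment> \<open>The polynomial bound supplies a line Re s = c on which the series of
    \<open>u\<close> converges absolutely, the starting point of
    \<open>dirichlet_coeff_bound\<close>; the summand 2 makes its terms O(m^-2).\<close>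
  define c where "c = real k + 2"
  have uc: "(\<lambda>m. norm (u m) * real m powr (- c)) summable_on pos"
  proof (rule summable_on_comparison_test[OF powr_summable_on[of 1 C]])
    fix m :: nat assume m: "m \<in> pos"
    have "norm (u m) * real m powr (- c) \<le> C * real m ^ k * real m powr (- c)" using kC by (intro mult_right_mono) auto
    also have "\<dots> = C * (real m powr real k * real m powr (- c))" using m by (simp add: powr_realpow)
    also have "\<dots> = C * real m powr (- (1 + 1))" by (simp add: powr_add[symmetric] c_def)
    finally show "norm (u m) * real m powr (- c) \<le> C * real m powr (- (1 + 1))" .
  qed auto
  have inv: "inverse (Lser s) = (\<Sum>\<^sub>\<infinity>m\<in>pos. u m * of_nat m powr (- s))" if s: "Re s = c" for s
  proof -
    let ?h = "\<lambda>p. of_nat p powr (- s) :: complex"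
    have s0: "Re s > 0" using s by (simp add: c_def)
    have aeq: "a n * cmf ?h n = f n * of_nat n powr (- (1 + s))" if "n > 0" for n
    proof -
      have "of_nat n powr (- (1 + s)) = of_nat n powr (- 1) * (of_nat n powr (- s) :: complex)"
        by (simp add: powr_add[symmetric])
      also have "of_nat n powr (- 1) = (1 / of_nat n :: complex)" using that by (simp add: powr_minus field_simps)
      finally show ?thesis using that by (simp add: a_def cmf_powr)
    qed
    have "(\<Sum>\<^sub>\<infinity>n\<in>pos. a n * cmf ?h n) * (\<Sum>\<^sub>\<infinity>n\<in>pos. u n * cmf ?h n) = (\<Sum>\<^sub>\<infinity>n\<in>pos. dconv a u n * cmf ?h n)"
    proof (rule infsum_dconv)
      show "(\<lambda>n. norm (a n * cmf ?h n)) summable_on pos"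
        using Lser_abs_summable[OF s0] by (rule summable_on_cong[THEN iffD1, rotated]) (simp add: aeq)
      show "(\<lambda>n. norm (u n * cmf ?h n)) summable_on pos"
        using uc by (rule summable_on_cong[THEN iffD1, rotated]) (simp add: norm_mult cmf_powr norm_nat_powr s)
    qed
    also have "\<dots> = (\<Sum>\<^sub>\<infinity>n\<in>{1::nat}. 1)"
      by (rule infsum_cong_neutral) (auto simp: u_def dconv_dinv[of a, OF a1])
    also have "(\<Sum>\<^sub>\<infinity>n\<in>pos. a n * cmf ?h n) = Lser s" unfolding Lser_def by (rule infsum_cong) (simp add: aeq)
    also have "(\<Sum>\<^sub>\<infinity>n\<in>pos. u n * cmf ?h n) = (\<Sum>\<^sub>\<infinity>m\<in>pos. u m * of_nat m powr (- s))"
      by (rule infsum_cong) (simp add: cmf_powr)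
    finally have "Lser s * (\<Sum>\<^sub>\<infinity>m\<in>pos. u m * of_nat m powr (- s)) = 1" by simp
    then show ?thesis by (rule inverse_unique)
  qed
  have ub: "\<exists>M. \<forall>n>0. norm (u n) \<le> real n powr \<sigma> * M" if \<sigma>: "0 < \<sigma>" "\<sigma> < 1" for \<sigma>
  proof -
    have "\<sigma> / 2 > 0" using \<sigma> by simp
    then obtain m where m: "m > 0" "\<And>s. Re s > \<sigma> / 2 \<Longrightarrow> norm (Lser s) \<ge> m" using Lser_lower_bound[OF nz f1] by blast
    have "norm (u n) \<le> real n powr \<sigma> * (1 / m)" if n: "n > 0" for n
    proof (rule dirichlet_coeff_bound[where A = "\<lambda>s. inverse (Lser s)" and u = u and c = c and \<tau> = "\<sigma> / 2" and K = "1 / m"])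
      show "(\<lambda>s. inverse (Lser s)) holomorphic_on {s. Re s > \<sigma> / 2}"
        using \<sigma> nz by (intro holomorphic_intros Lser_holomorphic) auto
      show "norm (inverse (Lser s)) \<le> 1 / m" if "Re s > \<sigma> / 2" for s
        unfolding norm_inverse using le_imp_inverse_le[OF m(2)[OF that] m(1)] by (simp add: inverse_eq_divide)
      show "inverse (Lser s) = (\<Sum>\<^sub>\<infinity>m\<in>pos. u m * of_nat m powr (- s))" if "Re s = c" for s
        by (rule inv[OF that])
    qed (use \<sigma> n uc in \<open>auto simp: c_def\<close>)
    then show ?thesis by blast
  qed
  define z where "z = (\<lambda>p. g p * of_nat p)"
  let ?S = "{p. prime p \<and> g p \<noteq> 0}"
  have finS: "finite ?S" using g by (simp add: adm_def)
  have "\<forall>\<^sub>F \<sigma> in at_right 0. \<forall>p\<in>?S. norm (z p) * real p powr \<sigma> < 1"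
  proof (rule eventually_ball_finite[OF finS], safe)
    fix p :: nat assume p: "prime p" "g p \<noteq> 0"
    have p0: "real p > 0" using prime_gt_0_nat[OF p(1)] by simp
    have "((\<lambda>\<sigma>. norm (z p) * real p powr \<sigma>) \<longlongrightarrow> norm (z p) * real p powr 0) (at_right 0)"
      using p0 by (intro tendsto_intros) auto
    moreover have "norm (z p) * real p powr 0 < 1" using g p p0 by (auto simp: z_def adm_def norm_mult)
    ultimately show "\<forall>\<^sub>F \<sigma> in at_right 0. norm (z p) * real p powr \<sigma> < 1" by (rule order_tendstoD)
  qed
  moreover have "\<forall>\<^sub>F \<sigma> in at_right (0::real). 0 < \<sigma> \<and> \<sigma> < 1" by (simp add: eventually_at_right_field) (rule exI[of _ 1], auto)
  ultimately have "\<forall>\<^sub>F \<sigma> in at_right 0. (\<forall>p\<in>?S. norm (z p) * real p powr \<sigma> < 1) \<and> 0 < \<sigma> \<and> \<sigma> < 1"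
    by eventually_elim auto
  then obtain \<sigma> where \<sigma>: "\<And>p. p \<in> ?S \<Longrightarrow> norm (z p) * real p powr \<sigma> < 1" "0 < \<sigma>" "\<sigma> < 1"
    using eventually_happens'[of "at_right (0::real)"] by auto
  obtain M where M: "\<And>n. n > 0 \<Longrightarrow> norm (u n) \<le> real n powr \<sigma> * M" using ub[OF \<sigma>(2,3)] by blast
  have cz: "cmf z n = cmf g n * of_nat n" if "n > 0" for n
    using that by (simp add: z_def cmf_mult_fun cmf_of_nat)
  define w where "w = (\<lambda>p. norm (z p) * real p powr \<sigma>)"
  have cw: "csum w"
  proof (rule csum_finite)
    show "finite {p. prime p \<and> w p \<noteq> 0}" by (rule finite_subset[OF _ finS]) (auto simp: w_def z_def)
    show "norm (w p) < 1" if "prime p" for p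
      using \<sigma>(1)[of p] that by (cases "g p = 0") (auto simp: w_def z_def)
  qed
  have cwn: "cmf w n = norm (cmf z n) * real n powr \<sigma>" if "n > 0" for n
  proof -
    have "real n powr \<sigma> = cmf (\<lambda>p. real p powr \<sigma>) n"
      using that by (intro cmf_unique) (auto simp: powr_mult)
    then show ?thesis by (simp add: w_def cmf_mult_fun norm_cmf)
  qed
  have "(\<Sum>\<^sub>\<infinity>n\<in>pos. a n * cmf z n) * (\<Sum>\<^sub>\<infinity>n\<in>pos. u n * cmf z n) = (\<Sum>\<^sub>\<infinity>n\<in>pos. dconv a u n * cmf z n)"
  proof (rule infsum_dconv)
    show "(\<lambda>n. norm (a n * cmf z n)) summable_on pos"
      using dsum_abs_summable[where F=f and k=1, OF adm_csum[OF g] f_bound]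
      by (rule summable_on_cong[THEN iffD1, rotated]) (simp add: a_def cz norm_mult norm_divide)
    show "(\<lambda>n. norm (u n * cmf z n)) summable_on pos"
    proof (rule summable_on_comparison_test)
      show "(\<lambda>n. M * norm (cmf w n)) summable_on pos" using cw by (intro summable_on_cmult_right) (simp add: csum_def)
      fix n :: nat assume "n \<in> pos"
      then have n: "n > 0" by simp
      have "norm (u n * cmf z n) \<le> real n powr \<sigma> * M * norm (cmf z n)"
        unfolding norm_mult using M[OF n] by (intro mult_right_mono) auto
      also have "\<dots> = M * norm (cmf w n)" by (simp add: cwn[OF n] abs_mult)
      finally show "norm (u n * cmf z n) \<le> M * norm (cmf w n)" .
    qed auto
  qed
  also have "\<dots> = (\<Sum>\<^sub>\<infinity>n\<in>{1::nat}. 1)"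
    by (rule infsum_cong_neutral) (auto simp: u_def dconv_dinv[of a, OF a1])
  also have "(\<Sum>\<^sub>\<infinity>n\<in>pos. a n * cmf z n) = dsum f g 1"
    unfolding dsum_def by (rule infsum_cong) (simp add: a_def cz)
  finally show ?thesis by auto
qed

end

subsection \<open>Closed invariant subspaces of square-summable sequences\<close>

definition l2 :: "(nat \<Rightarrow> complex) \<Rightarrow> bool" where
  "l2 x \<longleftrightarrow> (\<lambda>n. (norm (x n))\<^sup>2) summable_on UNIV"

definition nsq :: "(nat \<Rightarrow> complex) \<Rightarrow> real" where
  "nsq x = (\<Sum>\<^sub>\<infinity>n. (norm (x n))\<^sup>2)"

text \<open>The effect on sine coefficients of passing from \<phi> to its dilate at k x, and on
  Dirichlet series of multiplication by k^-s.\<close>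

definition dil :: "nat \<Rightarrow> (nat \<Rightarrow> complex) \<Rightarrow> nat \<Rightarrow> complex" where
  "dil k x n = (if k dvd n then x (n div k) else 0)"

inductive_set dspan :: "(nat \<Rightarrow> complex) \<Rightarrow> (nat \<Rightarrow> complex) set" for a where
  zero: "(\<lambda>_. 0) \<in> dspan a"
| step: "x \<in> dspan a \<Longrightarrow> k > 0 \<Longrightarrow> (\<lambda>n. x n + c * dil k a n) \<in> dspan a"

text \<open>An infinite sum that does not converge has value 0 by convention, so smallness of
  \<open>nsq\<close> means something only together with \<open>l2\<close>.\<close>

definition dclosure :: "(nat \<Rightarrow> complex) \<Rightarrow> (nat \<Rightarrow> complex) \<Rightarrow> bool" where
  "dclosure a b \<longleftrightarrow> (\<forall>e>0. \<exists>x\<in>dspan a. l2 (\<lambda>n. b n - x n) \<and> nsq (\<lambda>n. b n - x n) < e)"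

text \<open>The factor 2 does duty for Minkowski's inequality in both l2 and L2; hence the
  tolerances \<open>e / 4\<close> in the approximation arguments.\<close>

lemma sq_norm_add_le: "(norm (x + y))\<^sup>2 \<le> 2 * (norm x)\<^sup>2 + 2 * (norm y)\<^sup>2" for x y :: "'a::real_normed_vector"
proof -
  have "(norm (x + y))\<^sup>2 \<le> (norm x + norm y)\<^sup>2" by (intro power_mono norm_triangle_ineq) auto
  also have "\<dots> \<le> 2 * (norm x)\<^sup>2 + 2 * (norm y)\<^sup>2"
    using sum_squares_bound[of "norm x" "norm y"] by (simp add: power2_sum)
  finally show ?thesis .
qed

lemma l2_add:
  assumes "l2 x" "l2 y"
  shows "l2 (\<lambda>n. x n + y n)" "nsq (\<lambda>n. x n + y n) \<le> 2 * nsq x + 2 * nsq y"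
proof -
  have s: "(\<lambda>n. 2 * (norm (x n))\<^sup>2 + 2 * (norm (y n))\<^sup>2) summable_on UNIV"
    using assms unfolding l2_def by (intro summable_on_add summable_on_cmult_right)
  show l: "l2 (\<lambda>n. x n + y n)" unfolding l2_def
    by (rule summable_on_comparison_test[OF s]) (auto intro: sq_norm_add_le)
  have "nsq (\<lambda>n. x n + y n) \<le> (\<Sum>\<^sub>\<infinity>n. 2 * (norm (x n))\<^sup>2 + 2 * (norm (y n))\<^sup>2)"
    unfolding nsq_def by (rule infsum_mono[OF l[unfolded l2_def] s sq_norm_add_le])
  also have "\<dots> = 2 * nsq x + 2 * nsq y"
    using assms unfolding nsq_def l2_def
    by (subst infsum_add) (auto intro!: summable_on_cmult_right simp: infsum_cmult_right')
  finally show "nsq (\<lambda>n. x n + y n) \<le> 2 * nsq x + 2 * nsq y" .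
qed

lemma l2_scale:
  shows "l2 x \<Longrightarrow> l2 (\<lambda>n. c * x n)" "nsq (\<lambda>n. c * x n) = (norm c)\<^sup>2 * nsq x"
  unfolding l2_def nsq_def norm_mult power_mult_distrib
  by (auto intro: summable_on_cmult_right simp: infsum_cmult_right')

lemma l2_dil:
  assumes k: "k > 0"
  shows "l2 x \<Longrightarrow> l2 (dil k x)" "nsq (dil k x) = nsq x"
proof -
  have inj: "inj ((*) k)" using k by (auto simp: inj_def)
  have comp: "(\<lambda>n. (norm (dil k x n))\<^sup>2) \<circ> (*) k = (\<lambda>n. (norm (x n))\<^sup>2)"
    using k by (auto simp: dil_def)
  have "(\<lambda>n. (norm (dil k x n))\<^sup>2) summable_on UNIV \<longleftrightarrow> (\<lambda>n. (norm (dil k x n))\<^sup>2) summable_on range ((*) k)"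
    by (rule summable_on_cong_neutral) (auto simp: dil_def dvd_def)
  also have "\<dots> \<longleftrightarrow> (\<lambda>n. (norm (x n))\<^sup>2) summable_on UNIV"
    unfolding summable_on_reindex[OF inj] comp ..
  finally show "l2 x \<Longrightarrow> l2 (dil k x)" by (simp add: l2_def)
  have "nsq (dil k x) = infsum (\<lambda>n. (norm (dil k x n))\<^sup>2) (range ((*) k))"
    unfolding nsq_def by (rule infsum_cong_neutral) (auto simp: dil_def dvd_def)
  also have "\<dots> = nsq x" unfolding infsum_reindex[OF inj] comp nsq_def ..
  finally show "nsq (dil k x) = nsq x" .
qed

lemma dil_dil: "j > 0 \<Longrightarrow> dil j (dil k a) = dil (j * k) a"
proof
  fix n assume j: "j > 0"
  show "dil j (dil k a) n = dil (j * k) a n"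
  proof (cases "j dvd n")
    case True
    then obtain m where n: "n = j * m" by auto
    then show ?thesis using j by (simp add: dil_def)
  next
    case False
    then show ?thesis by (auto simp: dil_def dest: dvd_mult_left)
  qed
qed

lemma dil_1 [simp]: "dil (Suc 0) a = a"
  by (auto simp: dil_def)

lemma dspan_base: "a \<in> dspan a"
  using dspan.step[OF dspan.zero[of a], of 1 1] by simp

lemma dspan_dil: "x \<in> dspan a \<Longrightarrow> j > 0 \<Longrightarrow> dil j x \<in> dspan a"
proof (induction rule: dspan.induct)
  case zero
  have "dil j (\<lambda>_. 0) = (\<lambda>_. 0)" by (auto simp: dil_def)
  then show ?case by (simp add: dspan.zero)
next
  case (step x k c)
  have "dil j (\<lambda>n. x n + c * dil k a n) = (\<lambda>n. dil j x n + c * dil j (dil k a) n)"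
    by (auto simp: dil_def)
  then show ?case using step dspan.step[of "dil j x" a "j * k" c] by (simp add: dil_dil)
qed

lemma dspan_add_scale: "y \<in> dspan a \<Longrightarrow> x \<in> dspan a \<Longrightarrow> (\<lambda>n. x n + c * y n) \<in> dspan a"
proof (induction rule: dspan.induct)
  case (step y k d)
  then have "(\<lambda>n. (x n + c * y n) + (c * d) * dil k a n) \<in> dspan a" by (intro dspan.step) auto
  then show ?case by (simp add: algebra_simps)
qed simp

lemma dspan_explicit: "x \<in> dspan a \<Longrightarrow> \<exists>N c. \<forall>n. x n = (\<Sum>k=1..N. c k * dil k a n)"
proof (induction rule: dspan.induct)
  case zero
  show ?case by (intro exI[of _ "0::nat"]) auto
next
  case (step x k d)
  then obtain N c where c: "\<And>n. x n = (\<Sum>k=1..N. c k * dil k a n)" by blast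
  define c' where "c' = (\<lambda>j. (if j \<le> N then c j else 0) + (if j = k then d else 0))"
  have "x n + d * dil k a n = (\<Sum>j=1..max N k. c' j * dil j a n)" for n
  proof -
    have "(\<Sum>j=1..max N k. c' j * dil j a n) = (\<Sum>j=1..max N k. if j \<le> N then c j * dil j a n else 0) +
        (\<Sum>j=1..max N k. if j = k then d * dil j a n else 0)"
      unfolding sum.distrib[symmetric] by (intro sum.cong) (auto simp: c'_def algebra_simps)
    also have "(\<Sum>j=1..max N k. if j = k then d * dil j a n else 0) = d * dil k a n"
      using step by (subst sum.delta) auto
    also have "(\<Sum>j=1..max N k. if j \<le> N then c j * dil j a n else 0) = x n"
      unfolding c by (rule sum.mono_neutral_cong_right) auto
    finally show ?thesis by simp
  qed
  then show ?case by blast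
qed

lemma dclosure_add_dil:
  assumes b: "dclosure a b" and b': "dclosure a b'" and k: "k > 0"
  shows "dclosure a (\<lambda>n. b n + c * dil k b' n)"
  unfolding dclosure_def
proof (intro allI impI)
  fix e :: real assume e: "e > 0"
  define M where "M = (norm c)\<^sup>2 + 1"
  have M: "M > 0" unfolding M_def by (simp add: add_nonneg_pos)
  have "e / 4 > 0" using e by simp
  then obtain x where x: "x \<in> dspan a" "l2 (\<lambda>n. b n - x n)" "nsq (\<lambda>n. b n - x n) < e / 4"
    using b unfolding dclosure_def by blast
  have "e / (4 * M) > 0" using e M by simp
  then obtain x' where x': "x' \<in> dspan a" "l2 (\<lambda>n. b' n - x' n)" "nsq (\<lambda>n. b' n - x' n) < e / (4 * M)"
    using b' unfolding dclosure_def by blast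
  have eq: "(\<lambda>n. b n + c * dil k b' n - (x n + c * dil k x' n)) =
      (\<lambda>n. (b n - x n) + c * dil k (\<lambda>n. b' n - x' n) n)"
    by (auto simp: dil_def algebra_simps)
  have l: "l2 (\<lambda>n. c * dil k (\<lambda>n. b' n - x' n) n)" by (intro l2_scale l2_dil k x')
  have "nsq (\<lambda>n. (b n - x n) + c * dil k (\<lambda>n. b' n - x' n) n) \<le>
      2 * nsq (\<lambda>n. b n - x n) + 2 * ((norm c)\<^sup>2 * nsq (\<lambda>n. b' n - x' n))"
    using l2_add(2)[OF x(2) l] unfolding l2_scale(2) l2_dil(2)[OF k] .
  also have "(norm c)\<^sup>2 * nsq (\<lambda>n. b' n - x' n) \<le> M * (e / (4 * M))"
    using x' by (intro mult_mono) (auto simp: M_def nsq_def intro!: infsum_nonneg)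
  also have "2 * nsq (\<lambda>n. b n - x n) < 2 * (e / 4)" using x by simp
  finally have "nsq (\<lambda>n. (b n - x n) + c * dil k (\<lambda>n. b' n - x' n) n) < e" using M by simp
  moreover have "(\<lambda>n. x n + c * dil k x' n) \<in> dspan a"
    by (intro dspan_add_scale dspan_dil x x' k)
  ultimately show "\<exists>y\<in>dspan a. l2 (\<lambda>n. b n + c * dil k b' n - y n) \<and> nsq (\<lambda>n. b n + c * dil k b' n - y n) < e"
    using l2_add(1)[OF x(2) l] unfolding eq[symmetric] by (intro bexI[of _ "\<lambda>n. x n + c * dil k x' n"] conjI)
qed

lemma dclosure_dspan_self: "x \<in> dspan a \<Longrightarrow> dclosure a x"
  unfolding dclosure_def by (auto intro!: bexI[of _ x] simp: l2_def nsq_def)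

lemma dclosure_dspan: "x \<in> dspan b \<Longrightarrow> dclosure a b \<Longrightarrow> dclosure a x"
  by (induction rule: dspan.induct) (auto intro: dclosure_add_dil dclosure_dspan_self dspan.zero)

lemma dclosure_limit:
  assumes "\<And>e. e > 0 \<Longrightarrow> \<exists>b'. dclosure a b' \<and> l2 (\<lambda>n. b n - b' n) \<and> nsq (\<lambda>n. b n - b' n) < e"
  shows "dclosure a b"
  unfolding dclosure_def
proof (intro allI impI)
  fix e :: real assume e: "e > 0"
  then have e4: "e / 4 > 0" by simp
  then obtain b' where b': "dclosure a b'" "l2 (\<lambda>n. b n - b' n)" "nsq (\<lambda>n. b n - b' n) < e / 4" using assms by blast
  then obtain x where x: "x \<in> dspan a" "l2 (\<lambda>n. b' n - x n)" "nsq (\<lambda>n. b' n - x n) < e / 4"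
    using e4 unfolding dclosure_def by blast
  show "\<exists>x\<in>dspan a. l2 (\<lambda>n. b n - x n) \<and> nsq (\<lambda>n. b n - x n) < e"
    using l2_add[OF b'(2) x(2)] b'(3) x(1,3) by (intro bexI[of _ x]) auto
qed

text \<open>Permits the chain from the sine coefficients through an auxiliary polynomial to the unit
  sequence.\<close>

lemma dclosure_trans: "dclosure a b \<Longrightarrow> dclosure b c \<Longrightarrow> dclosure a c"
  by (rule dclosure_limit) (metis dclosure_def dclosure_dspan)

subsection \<open>Polynomials without zeros in the unit disc\<close>

text \<open>The series of \<open>F (r * w)\<close>; being multiplicative in \<open>F\<close>, it can
  be followed factor by factor.\<close>

definition fps_scale :: "complex \<Rightarrow> complex fps \<Rightarrow> complex fps" where
  "fps_scale r F = Abs_fps (\<lambda>n. r ^ n * fps_nth F n)"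

lemma fps_scale_mult: "fps_scale r (F * G) = fps_scale r F * fps_scale r G"
proof (rule fps_ext)
  fix n
  have "r ^ n * (\<Sum>i=0..n. fps_nth F i * fps_nth G (n - i)) =
     (\<Sum>i=0..n. r ^ i * fps_nth F i * (r ^ (n - i) * fps_nth G (n - i)))"
    unfolding sum_distrib_left
  proof (rule sum.cong)
    fix i assume "i \<in> {0..n}"
    then have "r ^ n = r ^ i * r ^ (n - i)" by (simp add: power_add[symmetric])
    then show "r ^ n * (fps_nth F i * fps_nth G (n - i)) = r ^ i * fps_nth F i * (r ^ (n - i) * fps_nth G (n - i))" by simp
  qed simp
  then show "fps_nth (fps_scale r (F * G)) n = fps_nth (fps_scale r F * fps_scale r G) n"
    by (simp add: fps_scale_def fps_mult_nth)
qed

lemma sum_norm_fps_mult_le: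
  fixes F G :: "complex fps"
  assumes "\<And>X. (\<Sum>n\<le>X. norm (fps_nth F n)) \<le> A" "\<And>X. (\<Sum>n\<le>X. norm (fps_nth G n)) \<le> B"
  shows "(\<Sum>n\<le>X. norm (fps_nth (F * G) n)) \<le> A * (B::real)"
proof -
  have "(\<Sum>n\<le>X. norm (fps_nth (F * G) n)) \<le> (\<Sum>n\<le>X. \<Sum>i=0..n. norm (fps_nth F i) * norm (fps_nth G (n - i)))"
    unfolding fps_mult_nth norm_mult[symmetric] by (intro sum_mono norm_sum)
  also have "\<dots> = (\<Sum>(n,i)\<in>Sigma {..X} (\<lambda>n. {0..n}). norm (fps_nth F i) * norm (fps_nth G (n - i)))"
    by (subst sum.Sigma) auto
  also have "\<dots> = (\<Sum>(i,j)\<in>{(i,j). i + j \<le> X}. norm (fps_nth F i) * norm (fps_nth G j))"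
    by (rule sum.reindex_bij_witness[where i = "\<lambda>(i,j). (i + j, i)" and j = "\<lambda>(n,i). (i, n - i)"]) auto
  also have "\<dots> \<le> (\<Sum>(i,j)\<in>{..X} \<times> {..X}. norm (fps_nth F i) * norm (fps_nth G j))"
    by (intro sum_mono2) auto
  also have "\<dots> = (\<Sum>n\<le>X. norm (fps_nth F n)) * (\<Sum>n\<le>X. norm (fps_nth G n))"
    by (simp add: sum_product sum.cartesian_product)
  also have "\<dots> \<le> A * B"
    by (intro mult_mono assms order_trans[OF sum_nonneg assms(1)] sum_nonneg) auto
  finally show ?thesis .
qed

lemma sup_norm_fps_mult_le:
  fixes F G :: "complex fps"
  assumes "\<And>n. norm (fps_nth F n) \<le> A" "\<And>X. (\<Sum>n\<le>X. norm (fps_nth G n)) \<le> B"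
  shows "norm (fps_nth (F * G) n) \<le> A * (B::real)"
proof -
  have "norm (fps_nth (F * G) n) \<le> (\<Sum>i=0..n. norm (fps_nth F i) * norm (fps_nth G (n - i)))"
    unfolding fps_mult_nth norm_mult[symmetric] by (rule norm_sum)
  also have "\<dots> \<le> (\<Sum>i=0..n. A * norm (fps_nth G (n - i)))" by (intro sum_mono mult_right_mono assms) auto
  also have "\<dots> = A * (\<Sum>i\<le>n. norm (fps_nth G i))"
    unfolding sum_distrib_left by (rule sum.reindex_bij_witness[where i = "\<lambda>i. n - i" and j = "\<lambda>i. n - i"]) auto
  also have "\<dots> \<le> A * B" by (intro mult_left_mono assms order_trans[OF norm_ge_zero assms(1)])
  finally show ?thesis .
qed

text \<open>\<open>H\<close> is the series of Q(w) / Q(r w). A factor (1 - b w) / (1 - r b w) with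
  |b| \<le> 1 has constant term 1 and further coefficients of modulus at most (1 - r) r^(n - 1):
  absolute sum at most 2, distance from 1 at most 1 - r in the largest coefficient. Both bounds are
  carried through an induction over the roots.\<close>

lemma zero_free_poly_quotient_bounds:
  fixes Q :: "complex poly"
  assumes "degree Q \<le> D" "\<And>z. norm z < 1 \<Longrightarrow> poly Q z \<noteq> 0" "0 < r" "r < 1"
  defines "U \<equiv> inverse (fps_of_poly Q)"
  defines "H \<equiv> fps_of_poly Q * fps_scale (of_real r) U"
  shows "norm (fps_nth U n) \<le> real (Suc n) ^ D / norm (poly Q 0)"
    and "(\<Sum>n\<le>X. norm (fps_nth H n)) \<le> 2 ^ D"
    and "norm (fps_nth (H - 1) n) \<le> (2 ^ D - 1) * (1 - r)"
proof -
  have "(\<forall>n. norm (fps_nth (inverse (fps_of_poly Q)) n) \<le> real (Suc n) ^ D / norm (poly Q 0)) \<and>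
    (\<forall>X. (\<Sum>n\<le>X. norm (fps_nth (fps_of_poly Q * fps_scale (of_real r) (inverse (fps_of_poly Q))) n)) \<le> 2 ^ D) \<and>
    (\<forall>n. norm (fps_nth (fps_of_poly Q * fps_scale (of_real r) (inverse (fps_of_poly Q)) - 1) n) \<le> (2 ^ D - 1) * (1 - r))"
    using assms(1,2)
  proof (induction D arbitrary: Q)
    case 0
    then obtain c where Q: "Q = [:c:]" by (auto elim: degree_eq_zeroE)
    have c: "c \<noteq> 0" using 0(2)[of 0] by (simp add: Q)
    have i: "inverse (fps_of_poly Q) = fps_const (inverse c)" using c by (simp add: Q fps_of_poly_const fps_const_inverse)
    have s: "fps_scale (of_real r) (fps_const (inverse c)) = fps_const (inverse c)"
      by (rule fps_ext) (auto simp: fps_scale_def)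
    have h: "fps_of_poly Q * fps_const (inverse c) = 1" using c by (simp add: Q fps_of_poly_const)
    have one: "(\<Sum>n\<le>X. norm (fps_nth (1::complex fps) n)) = 1" for X
    proof -
      have "(\<Sum>n\<le>X. norm (fps_nth (1::complex fps) n)) = (\<Sum>n\<le>X. if n = 0 then 1 else 0)" by (intro sum.cong) auto
      then show ?thesis by simp
    qed
    show ?case unfolding i s h using one c by (auto simp: Q norm_inverse divide_inverse)
  next
    case (Suc D)
    show ?case
    proof (cases "degree Q = 0")
      case True
      then have "degree Q \<le> D" by simp
      note IH = Suc.IH[OF this Suc.prems(2)]
      have "real (Suc n) ^ D / norm (poly Q 0) \<le> real (Suc n) ^ Suc D / norm (poly Q 0)" for n
        by (intro divide_right_mono power_increasing) auto
      moreover have "(2::real) ^ D \<le> 2 ^ Suc D" by simp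
      moreover have "(2 ^ D - 1) * (1 - r) \<le> (2 ^ Suc D - 1) * (1 - r)" using assms(4) by (intro mult_right_mono) auto
      ultimately show ?thesis using IH by (meson order_trans)
    next
      case False
      then obtain z where z: "poly Q z = 0" using Fundamental_Theorem_Algebra.fundamental_theorem_of_algebra[of Q] by (auto simp: constant_degree)
      then have z1: "norm z \<ge> 1" using Suc.prems(2)[of z] by (meson not_le)
      then have z0: "z \<noteq> 0" by auto
      obtain Q1 where Q1: "Q = [:- z, 1:] * Q1" using z by (auto simp: poly_eq_0_iff_dvd elim: dvdE)
      \<comment> \<open>Factors are normalised as 1 - b w, so splitting one off keeps the constant
        term \<open>poly Q 0\<close> of the first bound.\<close>
      define b where "b = 1 / z"
      have b: "norm b \<le> 1" using z1 z0 by (simp add: b_def norm_divide field_simps)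
      define Q2 where "Q2 = Polynomial.smult (- z) Q1"
      have "[:1, - b:] * Q2 = Polynomial.smult (- z) [:1, - b:] * Q1"
        unfolding Q2_def mult_smult_left mult_smult_right ..
      also have "Polynomial.smult (- z) [:1, - b:] = [:- z, 1:]" using z0 by (simp add: b_def)
      finally have Q: "Q = [:1, - b:] * Q2" using Q1 by simp
      have Q0: "Q \<noteq> 0" using False by auto
      have "Q2 \<noteq> 0" using Q0 Q by auto
      moreover have "b \<noteq> 0" using z0 by (simp add: b_def)
      ultimately have "degree Q = 1 + degree Q2" unfolding Q by (subst degree_mult_eq) auto
      then have dQ2: "degree Q2 \<le> D" using Suc.prems(1) by simp
      have nz2: "poly Q2 w \<noteq> 0" if "norm w < 1" for w using Suc.prems(2)[OF that] by (auto simp: Q)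
      note IH = Suc.IH[OF dQ2 nz2]
      let ?U2 = "inverse (fps_of_poly Q2)" and ?L = "fps_of_poly [:1, - b:]"
      define I where "I = Abs_fps (\<lambda>n. b ^ n)"
      have LX: "?L = 1 - fps_const b * fps_X" by (simp add: fps_of_poly_linear' fps_of_poly_pCons)
      have LI: "?L * I = 1"
      proof (rule fps_ext)
        fix n
        have "fps_nth (?L * I) n = fps_nth I n - b * fps_nth (fps_X * I) n"
          unfolding LX by (simp add: left_diff_distrib mult.assoc)
        also have "\<dots> = fps_nth 1 n" by (cases n) (auto simp: I_def fps_X_mult_nth)
        finally show "fps_nth (?L * I) n = fps_nth 1 n" .
      qed
      have L0: "fps_nth ?L 0 \<noteq> 0" by simp
      have invL: "inverse ?L = I" using LI L0 by (metis fps_inverse_unique)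
      have U: "inverse (fps_of_poly Q) = ?U2 * I"
        unfolding Q fps_of_poly_mult using invL by (simp add: fps_inverse_mult mult.commute)
      define E where "E = ?L * fps_scale (of_real r) I"
      have En: "fps_nth E n = (if n = 0 then 1 else - (of_real (1 - r)) * b * (of_real r * b) ^ (n - 1))" for n
      proof -
        have "fps_nth E n = fps_nth (fps_scale (of_real r) I) n - b * fps_nth (fps_X * fps_scale (of_real r) I) n"
          unfolding E_def LX by (simp add: left_diff_distrib mult.assoc)
        also have "\<dots> = (if n = 0 then 1 else - (of_real (1 - r)) * b * (of_real r * b) ^ (n - 1))"
          by (cases n) (auto simp: I_def fps_X_mult_nth fps_scale_def power_mult_distrib algebra_simps)
        finally show ?thesis .
      qed
      have Eb: "norm (fps_nth E (Suc n)) \<le> (1 - r) * r ^ n" for n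
      proof -
        have "norm (fps_nth E (Suc n)) = (1 - r) * r ^ n * norm b ^ Suc n"
          using assms(3,4) by (simp add: En norm_mult norm_power power_mult_distrib del: of_real_diff)
        also have "\<dots> \<le> (1 - r) * r ^ n * 1"
          using assms(3,4) b by (intro mult_left_mono power_le_one) auto
        finally show ?thesis by simp
      qed
      have E1: "(\<Sum>n\<le>X. norm (fps_nth E n)) \<le> 2" for X
      proof (cases X)
        case (Suc Y)
        have "(\<Sum>n\<le>X. norm (fps_nth E n)) = norm (fps_nth E 0) + (\<Sum>n\<le>Y. norm (fps_nth E (Suc n)))"
          unfolding Suc by (rule sum.atMost_Suc_shift)
        also have "\<dots> \<le> 1 + (\<Sum>n\<le>Y. (1 - r) * r ^ n)" using Eb by (intro add_mono sum_mono) (auto simp: En)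
        also have "(\<Sum>n\<le>Y. (1 - r) * r ^ n) = 1 - r ^ Suc Y"
          using sum_gp_basic[of r Y] by (simp add: sum_distrib_left)
        also have "1 + (1 - r ^ Suc Y) \<le> 2" using assms(3) by simp
        finally show ?thesis .
      qed (simp add: En)
      have Einf: "norm (fps_nth (E - 1) n) \<le> 1 - r" for n
      proof (cases n)
        case (Suc m)
        have "(1 - r) * r ^ m \<le> (1 - r) * 1" using assms(3,4) by (intro mult_left_mono power_le_one) auto
        then show ?thesis using Eb[of m] by (simp add: Suc)
      qed (use assms(4) in \<open>simp add: En\<close>)
      define H2 where "H2 = fps_of_poly Q2 * fps_scale (of_real r) ?U2"
      have H: "fps_of_poly Q * fps_scale (of_real r) (inverse (fps_of_poly Q)) = H2 * E"
        unfolding U fps_scale_mult unfolding Q fps_of_poly_mult E_def H2_def by (simp add: mult_ac)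
      have "norm (fps_nth (inverse (fps_of_poly Q)) n) \<le> real (Suc n) ^ Suc D / norm (poly Q 0)" for n
      proof -
        have "norm (fps_nth (inverse (fps_of_poly Q)) n) \<le> (\<Sum>i=0..n. norm (fps_nth ?U2 i) * norm (fps_nth I (n - i)))"
          unfolding U fps_mult_nth norm_mult[symmetric] by (rule norm_sum)
        also have "\<dots> \<le> (\<Sum>i=0..n. real (Suc n) ^ D / norm (poly Q 0) * 1)"
        proof (intro sum_mono mult_mono)
          fix i assume i: "i \<in> {0..n}"
          have "norm (fps_nth ?U2 i) \<le> real (Suc i) ^ D / norm (poly Q2 0)" using IH by blast
          also have "\<dots> \<le> real (Suc n) ^ D / norm (poly Q2 0)" using i by (intro divide_right_mono power_mono) auto
          also have "poly Q2 0 = poly Q 0" by (simp add: Q)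
          finally show "norm (fps_nth ?U2 i) \<le> real (Suc n) ^ D / norm (poly Q 0)" .
          show "norm (fps_nth I (n - i)) \<le> 1" using b by (simp add: I_def norm_power power_le_one)
        qed auto
        also have "\<dots> = real (Suc n) ^ Suc D / norm (poly Q 0)" by simp
        finally show ?thesis .
      qed
      moreover have "(\<Sum>n\<le>X. norm (fps_nth (H2 * E) n)) \<le> 2 ^ D * 2" for X
        using IH E1 unfolding H2_def by (intro sum_norm_fps_mult_le) auto
      moreover have "norm (fps_nth (H2 * E - 1) n) \<le> (2 ^ Suc D - 1) * (1 - r)" for n
      proof -
        \<comment> \<open>The largest-coefficient distance d from 1 becomes at most 2 d + (1 - r),
          the factor 2 being the absolute sum of \<open>E\<close>; this recursion produces the
          constant \<open>2 ^ D - 1\<close>.\<close>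
        have "H2 * E - 1 = (H2 - 1) * E + (E - 1)" by (simp add: algebra_simps)
        then have "norm (fps_nth (H2 * E - 1) n) \<le> norm (fps_nth ((H2 - 1) * E) n) + norm (fps_nth (E - 1) n)"
          by (metis fps_add_nth norm_triangle_ineq)
        also have "norm (fps_nth ((H2 - 1) * E) n) \<le> ((2 ^ D - 1) * (1 - r)) * 2"
          using IH E1 unfolding H2_def by (intro sup_norm_fps_mult_le) blast+
        also have "((2 ^ D - 1) * (1 - r)) * 2 + norm (fps_nth (E - 1) n) \<le> ((2 ^ D - 1) * (1 - r)) * 2 + (1 - r)"
          using Einf by simp
        also have "\<dots> = (2 ^ Suc D - 1) * (1 - r)" by (simp add: algebra_simps)
        finally show ?thesis by simp
      qed
      ultimately show ?thesis unfolding H by (simp add: mult.commute)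
    qed
  qed
  then show "norm (fps_nth U n) \<le> real (Suc n) ^ D / norm (poly Q 0)"
    "(\<Sum>n\<le>X. norm (fps_nth H n)) \<le> 2 ^ D" "norm (fps_nth (H - 1) n) \<le> (2 ^ D - 1) * (1 - r)"
    unfolding U_def H_def by blast+
qed

text \<open>One \<open>r\<close> and one \<open>X\<close> must serve a whole family of polynomials:
  the slices of a polynomial in several variables share these bounds, and the multiplier built from
  them must not depend on the slice.\<close>

lemma zero_free_poly_truncated_inverse:
  fixes c0 L e :: real
  assumes "c0 > 0" "L \<ge> 0" "e > 0"
  shows "\<exists>r X. 0 < r \<and> r < 1 \<and> (\<forall>Q::complex poly. degree Q \<le> D \<longrightarrow> (\<forall>z. norm z < 1 \<longrightarrow> poly Q z \<noteq> 0) \<longrightarrow>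
     norm (poly Q 0) = c0 \<longrightarrow> (\<Sum>i\<le>D. norm (poly.coeff Q i)) \<le> L \<longrightarrow>
     (\<Sum>n\<le>X + D. (norm (fps_nth (fps_of_poly Q *
        Abs_fps (\<lambda>n. if n \<le> X then of_real r ^ n * fps_nth (inverse (fps_of_poly Q)) n else 0) - 1) n))\<^sup>2) \<le> e)"
proof -
  \<comment> \<open>A square sum is at most the largest entry times the absolute sum, here
    \<open>2 ^ D * (1 - r)\<close> times \<open>2 ^ D + 1\<close>; the last 1 accounts for the
    subtracted unit series.\<close>
  define K where "K = (2 ^ D * (2 ^ D + 1) :: real)"
  have K: "K > 0" unfolding K_def by (intro mult_pos_pos) (auto simp: add_pos_pos)
  define r where "r = max (1/2) (1 - e / (2 * K))"
  have r: "0 < r" "r < 1" "K * (1 - r) \<le> e / 2"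
    using assms(3) K by (auto simp: r_def field_simps max_def)
  have "(\<lambda>X. real D * (L * (real (X + D + 1) ^ D * r ^ X / c0))\<^sup>2) \<longlonglongrightarrow> 0"
  proof -
    have "(\<lambda>X. real (X + D + 1) ^ D * r ^ X) \<longlonglongrightarrow> 0" using r by real_asymp
    then have "(\<lambda>X. real D * (L * ((real (X + D + 1) ^ D * r ^ X) / c0))\<^sup>2) \<longlonglongrightarrow> real D * (L * (0 / c0))\<^sup>2"
      using assms(1) by (intro tendsto_intros) auto
    then show ?thesis by simp
  qed
  then have "eventually (\<lambda>X. real D * (L * (real (X + D + 1) ^ D * r ^ X / c0))\<^sup>2 < e / 2) sequentially"
    using assms(3) by (intro order_tendstoD) auto
  then obtain Y where Y: "real D * (L * (real (Y + D + 1) ^ D * r ^ Y / c0))\<^sup>2 < e / 2"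
    by (auto simp: eventually_sequentially)
  \<comment> \<open>Coefficients of the product with index above X meet only entries of
    \<open>V\<close> with index above X - D = Y, where r^Y outweighs the polynomial growth. Beyond X
    + D the product vanishes.\<close>
  define X where "X = Y + D"
  show ?thesis
  proof (intro exI[of _ r] exI[of _ X] conjI allI impI r)
    fix Q :: "complex poly"
    assume Q: "degree Q \<le> D" "\<forall>z. norm z < 1 \<longrightarrow> poly Q z \<noteq> 0" "norm (poly Q 0) = c0" "(\<Sum>i\<le>D. norm (poly.coeff Q i)) \<le> L"
    define U where "U = inverse (fps_of_poly Q)"
    define H where "H = fps_of_poly Q * fps_scale (of_real r) U"
    define V where "V = Abs_fps (\<lambda>n. if n \<le> X then of_real r ^ n * fps_nth U n else 0)"
    note bounds = zero_free_poly_quotient_bounds[OF Q(1) _ r(1,2), folded U_def, folded H_def]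
    have U: "norm (fps_nth U n) \<le> real (Suc n) ^ D / c0" for n using bounds(1) Q by auto
    have H1: "(\<Sum>n\<le>X. norm (fps_nth H n)) \<le> 2 ^ D" for X using bounds(2) Q by auto
    have H2: "norm (fps_nth (H - 1) n) \<le> (2 ^ D - 1) * (1 - r)" for n using bounds(3) Q by auto
    have low: "fps_nth (fps_of_poly Q * V) n = fps_nth H n" if "n \<le> X" for n
      unfolding H_def fps_mult_nth using that by (intro sum.cong) (auto simp: V_def fps_scale_def)
    have "(\<Sum>n\<le>X. (norm (fps_nth (fps_of_poly Q * V - 1) n))\<^sup>2) = (\<Sum>n\<le>X. (norm (fps_nth (H - 1) n))\<^sup>2)"
      by (intro sum.cong) (auto simp: low)
    also have "\<dots> \<le> (\<Sum>n\<le>X. (2 ^ D - 1) * (1 - r) * norm (fps_nth (H - 1) n))"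
      unfolding power2_eq_square by (intro sum_mono mult_right_mono H2) auto
    also have "\<dots> = (2 ^ D - 1) * (1 - r) * (\<Sum>n\<le>X. norm (fps_nth (H - 1) n))" by (simp add: sum_distrib_left)
    also have "\<dots> \<le> (2 ^ D * (1 - r)) * (2 ^ D + 1)"
    proof (intro mult_mono)
      have "(\<Sum>n\<le>X. norm (fps_nth (H - 1) n)) \<le> (\<Sum>n\<le>X. norm (fps_nth H n) + (if n = 0 then 1 else 0))"
      proof (rule sum_mono)
        fix n
        show "norm (fps_nth (H - 1) n) \<le> norm (fps_nth H n) + (if n = 0 then 1 else 0)"
          using norm_triangle_ineq4[of "fps_nth H n" "fps_nth 1 n"] by (cases "n = 0") auto
      qed
      also have "\<dots> \<le> 2 ^ D + 1" using H1[of X] by (simp add: sum.distrib)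
      finally show "(\<Sum>n\<le>X. norm (fps_nth (H - 1) n)) \<le> 2 ^ D + 1" .
    qed (use r in \<open>auto intro: sum_nonneg\<close>)
    also have "\<dots> = K * (1 - r)" by (simp add: K_def)
    also have "\<dots> \<le> e / 2" by (rule r)
    finally have A: "(\<Sum>n\<le>X. (norm (fps_nth (fps_of_poly Q * V - 1) n))\<^sup>2) \<le> e / 2" .
    have high: "norm (fps_nth (fps_of_poly Q * V) n) \<le> L * (real (Y + D + 1) ^ D * r ^ Y / c0)" if n: "n \<in> {X<..X + D}" for n
    proof -
      have V: "norm (fps_nth V j) \<le> real (Y + D + 1) ^ D * r ^ Y / c0" if "j > Y" for j
      proof (cases "j \<le> X")
        case True
        have "norm (fps_nth V j) = r ^ j * norm (fps_nth U j)" using True r by (simp add: V_def norm_mult norm_power)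
        also have "\<dots> \<le> r ^ Y * (real (Y + D + 1) ^ D / c0)"
        proof (intro mult_mono)
          show "r ^ j \<le> r ^ Y" using that r by (intro power_decreasing) auto
          have "real (Suc j) ^ D / c0 \<le> real (Y + D + 1) ^ D / c0"
            using True assms(1) by (intro divide_right_mono power_mono) (auto simp: X_def)
          then show "norm (fps_nth U j) \<le> real (Y + D + 1) ^ D / c0" using U[of j] by simp
        qed (use r in auto)
        finally show ?thesis by (simp add: mult.commute)
      qed (use r assms(1) in \<open>simp add: V_def\<close>)
      have "norm (fps_nth (fps_of_poly Q * V) n) \<le> (\<Sum>i=0..n. norm (poly.coeff Q i) * norm (fps_nth V (n - i)))"
        unfolding fps_mult_nth fps_of_poly_nth norm_mult[symmetric] by (rule norm_sum)
      also have "\<dots> = (\<Sum>i\<le>D. norm (poly.coeff Q i) * norm (fps_nth V (n - i)))"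
        using n Q(1) by (intro sum.mono_neutral_right) (auto simp: X_def Polynomial.coeff_eq_0)
      also have "\<dots> \<le> (\<Sum>i\<le>D. norm (poly.coeff Q i) * (real (Y + D + 1) ^ D * r ^ Y / c0))"
        using n by (intro sum_mono mult_left_mono V) (auto simp: X_def)
      also have "\<dots> \<le> L * (real (Y + D + 1) ^ D * r ^ Y / c0)"
        unfolding sum_distrib_right[symmetric] using Q(4) r assms(1) by (intro mult_right_mono) auto
      finally show ?thesis .
    qed
    have "(\<Sum>n\<in>{X<..X + D}. (norm (fps_nth (fps_of_poly Q * V - 1) n))\<^sup>2) \<le>
        (\<Sum>n\<in>{X<..X + D}. (L * (real (Y + D + 1) ^ D * r ^ Y / c0))\<^sup>2)"
      using high by (intro sum_mono power_mono) auto
    also have "\<dots> < e / 2" using Y by simp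
    finally have B: "(\<Sum>n\<in>{X<..X + D}. (norm (fps_nth (fps_of_poly Q * V - 1) n))\<^sup>2) < e / 2" .
    have "{..X + D} = {..X} \<union> {X<..X + D}" by auto
    then have "(\<Sum>n\<le>X + D. (norm (fps_nth (fps_of_poly Q * V - 1) n))\<^sup>2) =
        (\<Sum>n\<le>X. (norm (fps_nth (fps_of_poly Q * V - 1) n))\<^sup>2) + (\<Sum>n\<in>{X<..X + D}. (norm (fps_nth (fps_of_poly Q * V - 1) n))\<^sup>2)"
      by (simp only:) (rule sum.union_disjoint; auto)
    also have "\<dots> \<le> e" using A B by simp
    finally show "(\<Sum>n\<le>X + D. (norm (fps_nth (fps_of_poly Q *
        Abs_fps (\<lambda>n. if n \<le> X then of_real r ^ n * fps_nth (inverse (fps_of_poly Q)) n else 0) - 1) n))\<^sup>2) \<le> e"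
      unfolding V_def U_def .
  qed
qed

section \<open>Mean values along vertical lines\<close>

lemma mean_powers_tendsto:
  fixes w :: complex
  assumes "norm w = 1"
  shows "(\<lambda>J. (\<Sum>j<J. w ^ j) / of_nat J) \<longlonglongrightarrow> (if w = 1 then 1 else 0)"
proof (cases "w = 1")
  case True
  have "eventually (\<lambda>J. (\<Sum>j<J. w ^ j) / of_nat J = 1) sequentially"
    using eventually_gt_at_top[of 0] by eventually_elim (simp add: True)
  then show ?thesis using True by (simp add: tendsto_eventually)
next
  case False
  have "(\<lambda>J. (\<Sum>j<J. w ^ j) / of_nat J) \<longlonglongrightarrow> 0"
  proof (rule Lim_null_comparison)
    show "eventually (\<lambda>J. norm ((\<Sum>j<J. w ^ j) / of_nat J) \<le> (2 / norm (w - 1)) / real J) sequentially"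
    proof (intro always_eventually allI)
      fix J
      have "norm (\<Sum>j<J. w ^ j) = norm (w ^ J - 1) / norm (w - 1)"
        using False by (simp add: geometric_sum norm_divide)
      also have "\<dots> \<le> 2 / norm (w - 1)"
        using norm_triangle_ineq4[of "w ^ J" 1] assms by (intro divide_right_mono) (auto simp: norm_power)
      finally show "norm ((\<Sum>j<J. w ^ j) / of_nat J) \<le> (2 / norm (w - 1)) / real J"
        using divide_right_mono[of _ _ "real J"] by (simp only: norm_divide norm_of_nat)
    qed
    show "(\<lambda>J. (2 / norm (w - 1)) / real J) \<longlonglongrightarrow> 0" by real_asymp
  qed
  then show ?thesis using False by simp
qed

text \<open>The functions \<open>n powr (i t)\<close> are orthogonal in the mean, so averaging the
  hypothesis over t leaves the square sum. Averaging over discrete times \<open>h * j\<close>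
  reduces this to means of powers of unimodular numbers.\<close>

lemma sum_sq_le_sup_vertical:
  fixes x :: "nat \<Rightarrow> complex"
  assumes I: "finite I" and W: "\<And>d. d \<in> I \<Longrightarrow> finite (W d) \<and> 0 \<notin> W d"
    and b: "\<And>t::real. (\<Sum>d\<in>I. (norm (\<Sum>n\<in>W d. x n * of_nat n powr (\<i> * of_real t)))\<^sup>2) \<le> e"
  shows "(\<Sum>d\<in>I. \<Sum>n\<in>W d. (norm (x n))\<^sup>2) \<le> e"
proof -
  define F where "F = (\<Union>d\<in>I. W d)"
  have F: "finite F" "0 \<notin> F" using I W by (auto simp: F_def)
  \<comment> \<open>So small that any two values \<open>h * ln n\<close> differ by at most 1 < 2 pi:
    distinct n keep distinct phases.\<close>
  define h where "h = 1 / (1 + (\<Sum>n\<in>F. ln (real n)))"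
  have S0: "ln (real n) \<ge> 0" if "n \<in> F" for n using that F by (intro ln_ge_zero) (cases n; auto)
  have Sp: "1 + (\<Sum>n\<in>F. ln (real n)) > 0" using S0 sum_nonneg[of F "\<lambda>n. ln (real n)"] by simp
  have h: "h > 0" using Sp by (simp add: h_def)
  have hl: "0 \<le> h * ln (real n)" "h * ln (real n) \<le> 1" if "n \<in> F" for n
  proof -
    show "0 \<le> h * ln (real n)" using h S0[OF that] by simp
    have "ln (real n) \<le> (\<Sum>n\<in>F. ln (real n))" by (rule member_le_sum[OF that S0 F(1)]) auto
    then show "h * ln (real n) \<le> 1" using Sp by (simp add: h_def field_simps)
  qed
  define w where "w = (\<lambda>n m. exp (\<i> * of_real (h * ln (real n) - h * ln (real m))))"
  have w1: "w n m = 1 \<longleftrightarrow> n = m" if "n \<in> F" "m \<in> F" for n m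
  proof
    assume "w n m = 1"
    then obtain k :: int where k: "h * ln (real n) - h * ln (real m) = real_of_int (2 * k) * pi"
      unfolding w_def exp_eq_1 by auto
    have "\<bar>h * ln (real n) - h * ln (real m)\<bar> \<le> 1" using hl[OF that(1)] hl[OF that(2)] by linarith
    then have "\<bar>real_of_int (2 * k)\<bar> * pi \<le> 1" unfolding k abs_mult by simp
    moreover have "\<bar>real_of_int (2 * k)\<bar> * pi \<ge> 1" if "k \<noteq> 0"
    proof -
      have "\<bar>real_of_int (2 * k)\<bar> \<ge> 1" using that by linarith
      then have "1 * 1 \<le> \<bar>real_of_int (2 * k)\<bar> * pi" using pi_ge_two by (intro mult_mono) auto
      then show ?thesis by simp
    qed
    moreover have "\<bar>real_of_int (2 * k)\<bar> * pi \<noteq> 1"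
    proof (cases "k = 0")
      case False
      have "\<bar>real_of_int (2 * k)\<bar> \<ge> 1" using False by linarith
      then have "1 * 2 \<le> \<bar>real_of_int (2 * k)\<bar> * pi" using pi_ge_two by (intro mult_mono) auto
      then show ?thesis by simp
    qed simp
    ultimately have "k = 0" by force
    then have "ln (real n) = ln (real m)" using k h by simp
    moreover have "real n > 0" "real m > 0" using that F by (auto intro: Suc_leI gr0I)
    ultimately show "n = m" by simp
  qed (simp add: w_def)
  have wn: "norm (w n m) = 1" for n m unfolding w_def by (simp add: norm_exp_eq_Re)
  have pw: "of_nat n powr (\<i> * of_real (h * real j)) * cnj (of_nat m powr (\<i> * of_real (h * real j))) = w n m ^ j"
    if "n \<in> F" "m \<in> F" for n m j
  proof -
    have nm: "n \<noteq> 0" "m \<noteq> 0" using that F by (auto intro: ccontr)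
    have "of_nat n powr (\<i> * of_real (h * real j)) = exp (\<i> * of_real (h * real j) * of_real (ln (real n)))"
      "cnj (of_nat m powr (\<i> * of_real (h * real j))) = exp (- \<i> * of_real (h * real j) * of_real (ln (real m)))"
      using nm by (auto simp: powr_def Ln_of_nat exp_cnj)
    then have "of_nat n powr (\<i> * of_real (h * real j)) * cnj (of_nat m powr (\<i> * of_real (h * real j))) =
        exp (\<i> * of_real (h * real j) * of_real (ln (real n)) + - \<i> * of_real (h * real j) * of_real (ln (real m)))"
      by (simp only: exp_add)
    also have "\<dots> = exp (of_nat j * (\<i> * of_real (h * ln (real n) - h * ln (real m))))"
      by (rule arg_cong[of _ _ exp]) (simp add: algebra_simps)
    also have "\<dots> = w n m ^ j" by (simp only: exp_of_nat_mult w_def)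
    finally show ?thesis .
  qed
  define g where "g = (\<lambda>j. \<Sum>d\<in>I. (norm (\<Sum>n\<in>W d. x n * of_nat n powr (\<i> * of_real (h * real j))))\<^sup>2)"
  have g: "complex_of_real (g j) = (\<Sum>d\<in>I. \<Sum>n\<in>W d. \<Sum>m\<in>W d. x n * cnj (x m) * w n m ^ j)" for j
  proof -
    have "complex_of_real (g j) = (\<Sum>d\<in>I. (\<Sum>n\<in>W d. x n * of_nat n powr (\<i> * of_real (h * real j))) *
        cnj (\<Sum>n\<in>W d. x n * of_nat n powr (\<i> * of_real (h * real j))))"
      unfolding g_def of_real_sum complex_norm_square ..
    also have "\<dots> = (\<Sum>d\<in>I. \<Sum>n\<in>W d. \<Sum>m\<in>W d. x n * cnj (x m) * w n m ^ j)"
    proof (rule sum.cong[OF refl])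
      fix d assume d: "d \<in> I"
      have sub: "W d \<subseteq> F" using d by (auto simp: F_def)
      show "(\<Sum>n\<in>W d. x n * of_nat n powr (\<i> * of_real (h * real j))) *
        cnj (\<Sum>n\<in>W d. x n * of_nat n powr (\<i> * of_real (h * real j))) = (\<Sum>n\<in>W d. \<Sum>m\<in>W d. x n * cnj (x m) * w n m ^ j)"
        unfolding cnj_sum sum_product
      proof (intro sum.cong refl)
        fix n m assume "n \<in> W d" "m \<in> W d"
        then have "n \<in> F" "m \<in> F" using sub by auto
        from pw[OF this, of j, symmetric] show "x n * of_nat n powr (\<i> * of_real (h * real j)) * cnj (x m * of_nat m powr (\<i> * of_real (h * real j))) =
            x n * cnj (x m) * w n m ^ j" by simp
      qed
    qed
    finally show ?thesis .
  qed
  have avg: "(\<Sum>j<J. complex_of_real (g j)) / of_nat J = (\<Sum>d\<in>I. \<Sum>n\<in>W d. \<Sum>m\<in>W d. x n * cnj (x m) * ((\<Sum>j<J. w n m ^ j) / of_nat J))" for J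
  proof -
    have "(\<Sum>j<J. complex_of_real (g j)) = (\<Sum>d\<in>I. \<Sum>n\<in>W d. \<Sum>m\<in>W d. \<Sum>j<J. x n * cnj (x m) * w n m ^ j)"
      unfolding g by (simp only: sum.swap[of _ _ "{..<J}"])
    then show ?thesis by (simp add: sum_divide_distrib sum_distrib_left)
  qed
  have "(\<lambda>J. (\<Sum>j<J. complex_of_real (g j)) / of_nat J) \<longlonglongrightarrow>
     (\<Sum>d\<in>I. \<Sum>n\<in>W d. \<Sum>m\<in>W d. x n * cnj (x m) * (if w n m = 1 then 1 else 0))"
    unfolding avg by (intro tendsto_intros mean_powers_tendsto wn)
  also have "(\<Sum>d\<in>I. \<Sum>n\<in>W d. \<Sum>m\<in>W d. x n * cnj (x m) * (if w n m = 1 then 1 else 0)) =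
     of_real (\<Sum>d\<in>I. \<Sum>n\<in>W d. (norm (x n))\<^sup>2)"
    unfolding of_real_sum
  proof (intro sum.cong refl)
    fix d n assume d: "d \<in> I" "n \<in> W d"
    have "(\<Sum>m\<in>W d. x n * cnj (x m) * (if w n m = 1 then 1 else 0)) = (\<Sum>m\<in>W d. if m = n then x n * cnj (x m) else 0)"
    proof (rule sum.cong[OF refl])
      fix m assume "m \<in> W d"
      then have "n \<in> F" "m \<in> F" using d by (auto simp: F_def)
      from w1[OF this] show "x n * cnj (x m) * (if w n m = 1 then 1 else 0) = (if m = n then x n * cnj (x m) else 0)" by auto
    qed
    also have "\<dots> = of_real ((norm (x n))\<^sup>2)" using d W unfolding complex_norm_square by simp
    finally show "(\<Sum>m\<in>W d. x n * cnj (x m) * (if w n m = 1 then 1 else 0)) = complex_of_real ((norm (x n))\<^sup>2)" .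
  qed
  finally have "(\<lambda>J. complex_of_real ((\<Sum>j<J. g j) / real J)) \<longlonglongrightarrow> of_real (\<Sum>d\<in>I. \<Sum>n\<in>W d. (norm (x n))\<^sup>2)" by simp
  then have lim: "(\<lambda>J. (\<Sum>j<J. g j) / real J) \<longlonglongrightarrow> (\<Sum>d\<in>I. \<Sum>n\<in>W d. (norm (x n))\<^sup>2)"
    unfolding tendsto_of_real_iff .
  show ?thesis
  proof (rule tendsto_upperbound[OF lim])
    show "eventually (\<lambda>J. (\<Sum>j<J. g j) / real J \<le> e) sequentially"
      using eventually_gt_at_top[of 0]
    proof eventually_elim
      fix J :: nat assume J: "J > 0"
      have "(\<Sum>j<J. g j) \<le> (\<Sum>j<J. e)" unfolding g_def by (intro sum_mono b)
      then show "(\<Sum>j<J. g j) / real J \<le> e" using J by (simp add: field_simps)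
    qed
  qed auto
qed

section \<open>Slices by total degree and the polynomial case of cyclicity\<close>

definition grade :: "nat set \<Rightarrow> nat \<Rightarrow> nat set" where
  "grade S d = {n. n > 0 \<and> bigomega n = d \<and> (\<forall>p. prime p \<longrightarrow> p dvd n \<longrightarrow> p \<in> S)}"

lemma finite_grade: "finite S \<Longrightarrow> finite (grade S d)"
proof -
  assume S: "finite S"
  have "n \<le> Max (insert 1 S) ^ bigomega n" if "n \<in> grade S d" for n
  proof -
    have n: "n > 0" "\<forall>p. prime p \<longrightarrow> p dvd n \<longrightarrow> p \<in> S" using that by (auto simp: grade_def)
    have "\<Prod>\<^sub># M \<le> Max (insert 1 S) ^ size M" if "set_mset M \<subseteq> S" for M
      using that
    proof (induction M)
      case (add p M)
      have "p \<le> Max (insert 1 S)" using add.prems S by (intro Max_ge) auto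
      then show ?case using add by (auto intro!: mult_mono)
    qed auto
    from this[of "prime_factorization n"] n show ?thesis by (auto simp: bigomega_def in_prime_factors_iff)
  qed
  then have "grade S d \<subseteq> {..Max (insert 1 S) ^ d}" by (auto simp: grade_def)
  then show ?thesis using finite_subset by blast
qed

lemma grade_mult: "k \<in> grade S i \<Longrightarrow> m \<in> grade S j \<Longrightarrow> k * m \<in> grade S (i + j)"
  by (auto simp: grade_def bigomega_mult prime_dvd_mult_iff)

lemma grade_dvd: "n \<in> grade S d \<Longrightarrow> n = k * m \<Longrightarrow> k \<in> grade S (bigomega k) \<and> m \<in> grade S (d - bigomega k) \<and> bigomega k \<le> d"
  by (auto simp: grade_def bigomega_mult)

text \<open>The power series in w of the Bohr lift at the coordinates
  \<open>w * p powr (i t)\<close> for p in \<open>S\<close>: the term of n has degree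
  \<open>bigomega n\<close>.\<close>

definition gfps :: "nat set \<Rightarrow> real \<Rightarrow> (nat \<Rightarrow> complex) \<Rightarrow> complex fps" where
  "gfps S t x = Abs_fps (\<lambda>d. \<Sum>n\<in>grade S d. x n * of_nat n powr (\<i> * of_real t))"

text \<open>The number of prime factors is additive, and a product lies over \<open>S\<close>
  exactly when both factors do.\<close>

lemma gfps_dconv:
  assumes S: "finite S"
  shows "gfps S t (dconv x y) = gfps S t x * gfps S t y"
proof (rule fps_ext)
  fix d
  let ?e = "\<lambda>n. of_nat n powr (\<i> * of_real t) :: complex"
  have fin: "finite {k. k dvd n}" if "n \<in> grade S d" for n using that by (auto simp: grade_def)
  have "fps_nth (gfps S t (dconv x y)) d = (\<Sum>n\<in>grade S d. \<Sum>k | k dvd n. x k * y (n div k) * ?e n)"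
    by (simp add: gfps_def dconv_def sum_distrib_right)
  also have "\<dots> = (\<Sum>(n,k)\<in>Sigma (grade S d) (\<lambda>n. {k. k dvd n}). x k * y (n div k) * ?e n)"
    using fin by (subst sum.Sigma) (auto simp: finite_grade[OF S])
  also have "\<dots> = (\<Sum>(i,k,m)\<in>Sigma {0..d} (\<lambda>i. grade S i \<times> grade S (d - i)). (x k * ?e k) * (y m * ?e m))"
  proof (rule sum.reindex_bij_witness[where i = "\<lambda>(i,k,m). (k * m, k)" and j = "\<lambda>(n,k). (bigomega k, k, n div k)"])
    fix a assume "a \<in> Sigma (grade S d) (\<lambda>n. {k. k dvd n})"
    then obtain n k where a: "a = (n, k)" "n \<in> grade S d" "k dvd n" by auto
    then obtain m where m: "n = k * m" by auto
    have n0: "n > 0" using a by (simp add: grade_def)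
    show "(\<lambda>(i,k,m). (k * m, k)) ((\<lambda>(n,k). (bigomega k, k, n div k)) a) = a" using a by simp
    show "(\<lambda>(n,k). (bigomega k, k, n div k)) a \<in> Sigma {0..d} (\<lambda>i. grade S i \<times> grade S (d - i))"
      using grade_dvd[OF a(2) m] n0 by (simp add: a m)
    have "?e n = ?e k * ?e m" using n0 unfolding m by (simp add: powr_times_real)
    then show "(case (\<lambda>(n,k). (bigomega k, k, n div k)) a of (i,k,m) \<Rightarrow> (x k * ?e k) * (y m * ?e m)) =
       (case a of (n,k) \<Rightarrow> x k * y (n div k) * ?e n)" using n0 by (simp add: a m)
  next
    fix b assume "b \<in> Sigma {0..d} (\<lambda>i. grade S i \<times> grade S (d - i))"
    then obtain i k m where b: "b = (i, k, m)" "i \<le> d" "k \<in> grade S i" "m \<in> grade S (d - i)" by auto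
    then have 0: "k > 0" "bigomega k = i" by (auto simp: grade_def)
    show "(\<lambda>(n,k). (bigomega k, k, n div k)) ((\<lambda>(i,k,m). (k * m, k)) b) = b" using b 0 by simp
    show "(\<lambda>(i,k,m). (k * m, k)) b \<in> Sigma (grade S d) (\<lambda>n. {k. k dvd n})"
      using grade_mult[OF b(3,4)] b by simp
  qed
  also have "\<dots> = (\<Sum>i=0..d. \<Sum>(k,m)\<in>grade S i \<times> grade S (d - i). (x k * ?e k) * (y m * ?e m))"
    by (subst sum.Sigma) (auto simp: finite_grade[OF S])
  also have "\<dots> = fps_nth (gfps S t x * gfps S t y) d"
    by (simp add: fps_mult_nth gfps_def sum_product sum.cartesian_product)
  finally show "fps_nth (gfps S t (dconv x y)) d = fps_nth (gfps S t x * gfps S t y) d" .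
qed

lemma dspan_sum: "finite V \<Longrightarrow> 0 \<notin> V \<Longrightarrow> (\<lambda>n. \<Sum>k\<in>V. v k * dil k q n) \<in> dspan q"
proof (induction V rule: finite_induct)
  case (insert k V)
  then have "(\<lambda>n. (\<Sum>k\<in>V. v k * dil k q n) + v k * dil k q n) \<in> dspan q" by (intro dspan.step) auto
  then show ?case using insert by (simp add: add.commute)
qed (simp add: dspan.zero)

lemma bigomega_eq_0: "n > 0 \<Longrightarrow> bigomega n = 0 \<longleftrightarrow> n = 1"
  by (auto simp: bigomega_def prime_factorization_empty_iff)

lemma grade_0: "grade S 0 = {1}"
  by (auto simp: grade_def bigomega_eq_0)

lemma grade_disjoint: "n \<in> grade S d \<Longrightarrow> n \<in> grade S d' \<Longrightarrow> d = d'"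
  by (simp add: grade_def)

text \<open>The slices \<open>Q t\<close> have no zeros in the disc and share degree bound, constant
  term and coefficient bound, so one truncation works for all t. The error of the resulting
  multiplier is small on every slice, and \<open>sum_sq_le_sup_vertical\<close> converts this into
  smallness in l2.\<close>

theorem dclosure_zero_free_polynomial:
  assumes A: "finite A" "0 \<notin> A" "\<And>n. n \<notin> A \<Longrightarrow> q n = 0"
    and nz: "\<And>t z. norm z < 1 \<Longrightarrow> (\<Sum>n\<in>A. q n * of_nat n powr (\<i> * of_real t) * z ^ bigomega n) \<noteq> 0"
  shows "dclosure q (\<lambda>n. if n = 1 then 1 else 0)"
proof -
  define S where "S = {p. prime p \<and> (\<exists>n\<in>A. p dvd n)}"
  have "S \<subseteq> (\<Union>n\<in>A. {p. p dvd n})" by (auto simp: S_def)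
  moreover have "finite (\<Union>n\<in>A. {p. p dvd n})"
    using A by (intro finite_UN_I) (metis bot_nat_0.not_eq_extremum finite_divisors_nat)+
  ultimately have S: "finite S" by (rule finite_subset)
  have Agr: "n \<in> grade S (bigomega n)" if "n \<in> A" for n
    using that A(2) by (auto simp: grade_def S_def intro: ccontr)
  define D where "D = Max (insert 0 (bigomega ` A))"
  have D: "bigomega n \<le> D" if "n \<in> A" for n using that A(1) unfolding D_def by (intro Max_ge) auto
  let ?e = "\<lambda>t n. of_nat n powr (\<i> * of_real t) :: complex"
  have ne: "norm (?e t n) = 1" if "n > 0" for t n using that by (simp add: norm_nat_powr)
  define Q where "Q = (\<lambda>t. \<Sum>n\<in>A. Polynomial.monom (q n * ?e t n) (bigomega n))"
  have coeffQ: "poly.coeff (Q t) d = (\<Sum>n\<in>grade S d. q n * ?e t n)" for t d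
  proof -
    have "poly.coeff (Q t) d = (\<Sum>n\<in>A. if bigomega n = d then q n * ?e t n else 0)"
      unfolding Q_def coeff_sum by (intro sum.cong) auto
    also have "\<dots> = (\<Sum>n\<in>A \<inter> {n. bigomega n = d}. q n * ?e t n)" using A(1) by (simp add: sum.inter_restrict)
    also have "\<dots> = (\<Sum>n\<in>grade S d. q n * ?e t n)"
    proof (rule sum.mono_neutral_left)
      show "A \<inter> {n. bigomega n = d} \<subseteq> grade S d" using Agr by auto
      show "\<forall>n\<in>grade S d - A \<inter> {n. bigomega n = d}. q n * ?e t n = 0"
        using A(3) by (auto simp: grade_def)
    qed (rule finite_grade[OF S])
    finally show ?thesis .
  qed
  have fpsQ: "fps_of_poly (Q t) = gfps S t q" for t
    by (rule fps_ext) (simp add: gfps_def coeffQ)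
  have polyQ: "poly (Q t) z = (\<Sum>n\<in>A. q n * ?e t n * z ^ bigomega n)" for t z
    by (simp add: Q_def poly_sum poly_monom)
  have degQ: "degree (Q t) \<le> D" for t
    unfolding Q_def by (intro degree_sum_le A order_trans[OF degree_monom_le] D)
  have Q0: "poly (Q t) 0 = q 1" for t
    by (simp add: poly_0_coeff_0 coeffQ grade_0)
  have q1: "q 1 \<noteq> 0" using nz[of 0 0] Q0[of 0] polyQ[of 0 0] by simp
  define L where "L = (\<Sum>n\<in>A. norm (q n))"
  have L: "(\<Sum>i\<le>D. norm (poly.coeff (Q t) i)) \<le> L" for t
  proof -
    have "(\<Sum>i\<le>D. norm (poly.coeff (Q t) i)) \<le> (\<Sum>i\<le>D. \<Sum>n\<in>A. if bigomega n = i then norm (q n) else 0)"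
    proof (rule sum_mono)
      fix i
      have "norm (poly.coeff (Q t) i) \<le> (\<Sum>n\<in>A. norm (poly.coeff (Polynomial.monom (q n * ?e t n) (bigomega n)) i))"
        unfolding Q_def coeff_sum by (rule norm_sum)
      also have "\<dots> = (\<Sum>n\<in>A. if bigomega n = i then norm (q n) else 0)"
        using A(2) by (intro sum.cong) (auto simp: norm_mult ne intro!: ne gr0I)
      finally show "norm (poly.coeff (Q t) i) \<le> (\<Sum>n\<in>A. if bigomega n = i then norm (q n) else 0)" .
    qed
    also have "\<dots> = (\<Sum>n\<in>A. \<Sum>i\<le>D. if bigomega n = i then norm (q n) else 0)" by (rule sum.swap)
    also have "\<dots> = L" unfolding L_def using D by (intro sum.cong) auto
    finally show ?thesis .
  qed
  define u where "u = dinv q"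
  define \<delta> :: "nat \<Rightarrow> complex" where "\<delta> = (\<lambda>n. if n = 1 then 1 else 0)"
  have g\<delta>: "gfps S t \<delta> = 1" for t
  proof (rule fps_ext)
    fix d
    have "fps_nth (gfps S t \<delta>) d = (\<Sum>n\<in>grade S d. if n = 1 then 1 else 0)"
      by (auto simp: gfps_def \<delta>_def intro!: sum.cong)
    also have "\<dots> = (if 1 \<in> grade S d then 1 else 0)" using finite_grade[OF S] by simp
    also have "1 \<in> grade S d \<longleftrightarrow> d = 0" using grade_0[of S] grade_disjoint[of 1 S d 0] by auto
    finally show "fps_nth (gfps S t \<delta>) d = fps_nth 1 d" by simp
  qed
  have gu: "gfps S t u = inverse (gfps S t q)" for t
  proof -
    have "gfps S t q * gfps S t u = gfps S t (dconv q u)" by (simp add: gfps_dconv[OF S])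
    also have "\<dots> = gfps S t \<delta>" unfolding gfps_def u_def
      by (intro arg_cong[of _ _ Abs_fps] ext sum.cong) (auto simp: grade_def \<delta>_def dconv_dinv[of q, OF q1])
    finally show ?thesis by (simp add: g\<delta> fps_inverse_unique)
  qed
  show ?thesis unfolding \<delta>_def[symmetric] dclosure_def
  proof (intro allI impI)
    fix e :: real assume e: "e > 0"
    obtain r X where r: "0 < r" "r < 1" and rX: "\<And>Q::complex poly. degree Q \<le> D \<Longrightarrow> (\<forall>z. norm z < 1 \<longrightarrow> poly Q z \<noteq> 0) \<Longrightarrow>
     norm (poly Q 0) = norm (q 1) \<Longrightarrow> (\<Sum>i\<le>D. norm (poly.coeff Q i)) \<le> L \<Longrightarrow>
     (\<Sum>n\<le>X + D. (norm (fps_nth (fps_of_poly Q *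
        Abs_fps (\<lambda>n. if n \<le> X then of_real r ^ n * fps_nth (inverse (fps_of_poly Q)) n else 0) - 1) n))\<^sup>2) \<le> e / 2"
      using zero_free_poly_truncated_inverse[of "norm (q 1)" L "e / 2" D] q1 e unfolding L_def by (auto simp: sum_nonneg)
    \<comment> \<open>The Dirichlet inverse damped by r per prime factor and cut at total degree
      \<open>X\<close>. It does not involve t, yet its slice at each t is the truncated inverse of
      \<open>Q t\<close>.\<close>
    define v where "v = (\<lambda>n. if n \<in> grade S (bigomega n) \<and> bigomega n \<le> X then of_real r ^ bigomega n * u n else 0)"
    define y where "y = dconv q v"
    have gv: "gfps S t v = Abs_fps (\<lambda>n. if n \<le> X then of_real r ^ n * fps_nth (inverse (fps_of_poly (Q t))) n else 0)" for t
    proof (rule fps_ext)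
      fix d
      show "fps_nth (gfps S t v) d = fps_nth (Abs_fps (\<lambda>n. if n \<le> X then of_real r ^ n * fps_nth (inverse (fps_of_poly (Q t))) n else 0)) d"
        unfolding fpsQ gu[symmetric] unfolding gfps_def
        by (auto simp: v_def grade_def sum_distrib_left mult.assoc intro!: sum.cong sum.neutral)
    qed
    define F where "F = (\<Union>d\<le>X + D. grade S d)"
    have F: "finite F" unfolding F_def by (intro finite_UN_I finite_grade S) auto
    have supp: "\<delta> n - y n = 0" if "n \<notin> F" for n
    proof -
      have "1 \<in> F" unfolding F_def using grade_0[of S] by (intro UN_I[of 0]) auto
      then have "\<delta> n = 0" using that by (auto simp: \<delta>_def)
      moreover have "q d * v (n div d) = 0" if d: "d dvd n" for d
      proof (rule ccontr)
        assume "q d * v (n div d) \<noteq> 0"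
        then have qd: "q d \<noteq> 0" and vd: "v (n div d) \<noteq> 0" by auto
        have "d \<in> A" using A(3) qd by blast
        moreover have "n div d \<in> grade S (bigomega (n div d))" "bigomega (n div d) \<le> X" using vd by (auto simp: v_def split: if_splits)
        ultimately have "d * (n div d) \<in> grade S (bigomega d + bigomega (n div d))" "bigomega d + bigomega (n div d) \<le> X + D"
          using Agr D by (auto intro!: grade_mult simp: add.commute intro: add_mono)
        then have "n \<in> F" unfolding F_def using d by (auto intro!: UN_I)
        then show False using \<open>n \<notin> F\<close> by simp
      qed
      ultimately show ?thesis unfolding y_def dconv_def by (simp add: sum.neutral del: mult_eq_0_iff)
    qed
    have "(\<Sum>d\<le>X + D. \<Sum>n\<in>grade S d. (norm (y n - \<delta> n))\<^sup>2) \<le> e / 2"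
    proof (rule sum_sq_le_sup_vertical)
      fix t :: real
      have "fps_of_poly (Q t) * gfps S t v - 1 = gfps S t y - gfps S t \<delta>"
        by (simp add: fpsQ gfps_dconv[OF S] y_def g\<delta>)
      then have "(\<Sum>n\<in>grade S d. (y n - \<delta> n) * ?e t n) = fps_nth (fps_of_poly (Q t) * gfps S t v - 1) d" for d
        by (simp add: gfps_def left_diff_distrib sum_subtractf)
      then show "(\<Sum>d\<le>X + D. (norm (\<Sum>n\<in>grade S d. (y n - \<delta> n) * ?e t n))\<^sup>2) \<le> e / 2"
        using rX[OF degQ[of t]] nz Q0 L unfolding gv polyQ[symmetric] by simp
    qed (auto simp: finite_grade[OF S], auto simp: grade_def)
    also have "(\<Sum>d\<le>X + D. \<Sum>n\<in>grade S d. (norm (y n - \<delta> n))\<^sup>2) = (\<Sum>n\<in>F. (norm (\<delta> n - y n))\<^sup>2)"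
      unfolding F_def using grade_disjoint[of _ S]
      by (subst sum.UNION_disjoint) (auto simp: finite_grade[OF S] norm_minus_commute)
    also have "\<dots> = nsq (\<lambda>n. \<delta> n - y n)"
    proof -
      have "nsq (\<lambda>n. \<delta> n - y n) = infsum (\<lambda>n. (norm (\<delta> n - y n))\<^sup>2) F"
        unfolding nsq_def by (rule infsum_cong_neutral) (auto simp: supp)
      then show ?thesis using F by simp
    qed
    finally have "nsq (\<lambda>n. \<delta> n - y n) < e" using e by simp
    moreover have "l2 (\<lambda>n. \<delta> n - y n)"
    proof -
      have "(\<lambda>n. (norm (\<delta> n - y n))\<^sup>2) summable_on F" using F by simp
      then show ?thesis unfolding l2_def by (rule summable_on_cong_neutral[THEN iffD1, rotated -1]) (auto simp: supp)
    qed
    moreover have "y \<in> dspan q"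
    proof -
      define V where "V = {k. v k \<noteq> 0}"
      have "V \<subseteq> (\<Union>d\<le>X. grade S d)" by (auto simp: V_def v_def split: if_splits)
      moreover have "finite (\<Union>d\<le>X. grade S d)" by (intro finite_UN_I finite_grade S) auto
      ultimately have V: "finite V" "0 \<notin> V" by (auto intro: finite_subset simp: grade_def)
      have "y n = (\<Sum>k\<in>V. v k * dil k q n)" for n
      proof (cases "n = 0")
        case True
        then show ?thesis using A by (simp add: y_def dconv_def dil_def)
      next
        case False
        then have n: "n > 0" by simp
        have bij: "bij_betw (\<lambda>d. n div d) {d. d dvd n} {d. d dvd n}"
          using n by (intro bij_betw_byWitness[where f' = "\<lambda>d. n div d"]) auto
        have "y n = (\<Sum>k | k dvd n. q (n div k) * v (n div (n div k)))"
          unfolding y_def dconv_def by (rule sum.reindex_bij_betw[OF bij, symmetric])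
        also have "\<dots> = (\<Sum>k | k dvd n. v k * dil k q n)" using n by (intro sum.cong) (auto simp: dil_def)
        also have "\<dots> = (\<Sum>k\<in>V \<inter> {k. k dvd n}. v k * dil k q n)"
          using n by (intro sum.mono_neutral_right) (auto simp: V_def)
        also have "\<dots> = (\<Sum>k\<in>V. v k * dil k q n)"
          using V by (intro sum.mono_neutral_left) (auto simp: dil_def)
        finally show ?thesis .
      qed
      then have "y = (\<lambda>n. \<Sum>k\<in>V. v k * dil k q n)" by blast
      then show ?thesis using dspan_sum[OF V] by simp
    qed
    ultimately show "\<exists>x\<in>dspan q. l2 (\<lambda>n. \<delta> n - x n) \<and> nsq (\<lambda>n. \<delta> n - x n) < e" by blast
  qed
qed

section \<open>Removing the rational factor at the primes dividing the period\<close>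

lemma prime_power_dvd_mult_iff:
  assumes "prime (p::nat)" "coprime p k"
  shows "p ^ t dvd n * k \<longleftrightarrow> p ^ t dvd n"
  using assms by (simp add: coprime_dvd_mult_left_iff)

context periodic_seq begin

text \<open>With N = p^v M, multiplication by p^t changes nothing modulo M once p^t = 1 modulo M,
  and modulo p^v both n and p^t n vanish. So \<open>f\<close> is eventually periodic in the exponent
  of \<open>p\<close>, which makes the lift rational in that coordinate.\<close>

lemma ex_period_prime_power:
  assumes p: "prime p" "p dvd N"
  shows "\<exists>t>0. \<forall>n. p ^ N dvd n \<longrightarrow> f (p ^ t * n) = f n"
proof -
  define v where "v = multiplicity p N"
  obtain M where M: "N = p ^ v * M" "\<not> p dvd M"
  proof (rule multiplicity_decompose'[of N p])
    show "N \<noteq> 0" using N by simp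
    show "\<not> is_unit p" using prime_gt_1_nat[OF p(1)] by simp
  qed (auto simp: v_def)
  have M0: "M > 0" using M N by (auto intro: gr0I)
  have "coprime p M" using M p(1) by (simp add: prime_imp_coprime)
  then have "[p ^ totient M = 1] (mod M)" by (rule euler_theorem)
  then have dvdM: "M dvd p ^ totient M - 1" using cong_to_1_nat by simp
  \<comment> \<open>From v < 2^v \<le> p^v \<le> N: the exponent N is a crude threshold that suits
    every p at once.\<close>
  have "v < 2 ^ v" by (rule less_exp)
  also have "2 ^ v \<le> p ^ v" using prime_ge_2_nat[OF p(1)] by (rule power_mono) simp
  also have "p ^ v \<le> N" using M M0 by simp
  finally have vN: "v \<le> N" by simp
  show ?thesis
  proof (intro exI[of _ "totient M"] conjI allI impI)
    show "totient M > 0" using M0 by simp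
    fix n assume "p ^ N dvd n"
    then have "p ^ v dvd n" using vN by (meson dvd_trans le_imp_power_dvd)
    then have "p ^ v * M dvd n * (p ^ totient M - 1)" using dvdM by (rule mult_dvd_mono)
    then have d: "N dvd n * (p ^ totient M - 1)" using M by simp
    have "p ^ totient M \<ge> 1" using prime_gt_0_nat[OF p(1)] by (simp add: Suc_le_eq)
    then have "p ^ totient M * n = n + n * (p ^ totient M - 1)" by (simp add: algebra_simps)
    also have "[n + n * (p ^ totient M - 1) = n] (mod N)" using d by (auto simp: cong_def elim!: dvdE)
    finally show "f (p ^ totient M * n) = f n" by (rule f_cong)
  qed
qed

text \<open>Substituting n = p^t m in the dilated part pulls out
  \<open>cmf g (p ^ t) = g p ^ t\<close>.\<close>

lemma dsum_minus_dil:
  assumes g: "csum g" and B: "\<And>n. norm (F n) \<le> B" and p: "prime p"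
  shows "dsum (\<lambda>n. F n - dil (p ^ t) F n) g 1 = (1 - g p ^ t) * dsum F g 1"
proof -
  have pt: "p ^ t > 0" using prime_gt_0_nat[OF p] by simp
  have B0: "B \<ge> 0" using order_trans[OF norm_ge_zero B] .
  have Bd: "norm (dil (p ^ t) F n) \<le> B" for n using B B0 by (simp add: dil_def)
  have s1: "(\<lambda>n. F (n * 1) * cmf g n) summable_on pos" by (rule dsum_summable[where F=F, OF g B])
  have s2: "(\<lambda>n. dil (p ^ t) F (n * 1) * cmf g n) summable_on pos" by (rule dsum_summable[where F="dil (p ^ t) F", OF g Bd])
  have "dsum (\<lambda>n. F n - dil (p ^ t) F n) g 1 = (\<Sum>\<^sub>\<infinity>n\<in>pos. F (n * 1) * cmf g n + (- 1) * (dil (p ^ t) F (n * 1) * cmf g n))"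
    unfolding dsum_def by (rule infsum_cong) (simp add: algebra_simps)
  also have "\<dots> = dsum F g 1 + (- 1) * (\<Sum>\<^sub>\<infinity>n\<in>pos. dil (p ^ t) F (n * 1) * cmf g n)"
    unfolding infsum_add[OF s1 summable_on_cmult_right[OF s2, of "- 1"]] infsum_cmult_right' dsum_def ..
  also have "(\<Sum>\<^sub>\<infinity>n\<in>pos. dil (p ^ t) F (n * 1) * cmf g n) = infsum (\<lambda>n. dil (p ^ t) F (n * 1) * cmf g n) ((*) (p ^ t) ` pos)"
    by (rule infsum_cong_neutral) (use pt in \<open>auto simp: dil_def dvd_def\<close>)
  also have "\<dots> = (\<Sum>\<^sub>\<infinity>m\<in>pos. g p ^ t * (F (m * 1) * cmf g m))"
    using pt by (subst infsum_reindex)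
      (auto simp: inj_on_def o_def dil_def cmf_mult cmf_prime_power[OF p] mult_ac intro!: infsum_cong)
  also have "\<dots> = g p ^ t * dsum F g 1" unfolding dsum_def by (rule infsum_cmult_right')
  finally show ?thesis by (simp add: algebra_simps)
qed

definition seq :: "nat \<Rightarrow> complex" where "seq n = f n / of_nat n"

text \<open>The invariant for treating the primes dividing \<open>N\<close> one by one,
  \<open>R\<close> being those already done. The fourth clause makes the lift a polynomial in the
  coordinates of \<open>R\<close>; the fifth keeps the exponent of each remaining prime periodic
  from N on, with period \<open>t p\<close>.\<close>

definition cleared :: "(nat \<Rightarrow> nat) \<Rightarrow> nat set \<Rightarrow> (nat \<Rightarrow> complex) \<Rightarrow> real \<Rightarrow> bool" where
  "cleared t R F B \<longleftrightarrow> (\<lambda>n. F n / of_nat n) \<in> dspan seq \<and> (\<forall>n. norm (F n) \<le> B) \<and>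
    (\<forall>k n. coprime k N \<longrightarrow> n > 0 \<longrightarrow> F (n * k) = f k / f 1 * F n) \<and>
    (\<forall>p n. p \<in> R \<longrightarrow> n > 0 \<longrightarrow> p ^ (N + t p) dvd n \<longrightarrow> F n = 0) \<and>
    (\<forall>p n. prime p \<longrightarrow> p dvd N \<longrightarrow> p \<notin> R \<longrightarrow> n > 0 \<longrightarrow> p ^ N dvd n \<longrightarrow> F (p ^ t p * n) = F n) \<and>
    (\<forall>g. adm g \<longrightarrow> dsum F g 1 \<noteq> 0)"

lemma cleared_props:
  assumes "cleared t R F B"
  shows "(\<lambda>n. F n / of_nat n) \<in> dspan seq" "norm (F n) \<le> B"
    "coprime k N \<Longrightarrow> n > 0 \<Longrightarrow> F (n * k) = f k / f 1 * F n"
    "p \<in> R \<Longrightarrow> n > 0 \<Longrightarrow> p ^ (N + t p) dvd n \<Longrightarrow> F n = 0"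
    "prime p \<Longrightarrow> p dvd N \<Longrightarrow> p \<notin> R \<Longrightarrow> n > 0 \<Longrightarrow> p ^ N dvd n \<Longrightarrow> F (p ^ t p * n) = F n"
    "adm g \<Longrightarrow> dsum F g 1 \<noteq> 0"
  using assms unfolding cleared_def by blast+

text \<open>Multiplying by \<open>1 - (z\<^sub>p / p)\<^sup>t\<close> for every prime \<open>p\<close> dividing \<open>N\<close> turns the rational factor of the Bohr
  lift into a polynomial.\<close>

lemma clear_denominators:
  assumes nz: "\<And>g. adm g \<Longrightarrow> dsum f g 1 \<noteq> 0"
    and t: "\<And>p. prime p \<Longrightarrow> p dvd N \<Longrightarrow> t p > 0 \<and> (\<forall>n. p ^ N dvd n \<longrightarrow> f (p ^ t p * n) = f n)"
    and R: "finite R" "R \<subseteq> {p. prime p \<and> p dvd N}"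
  shows "\<exists>F B. cleared t R F B"
  using R
proof (induction R rule: finite_induct)
  case empty
  have "(\<lambda>n. f n / of_nat n) \<in> dspan seq" using dspan_base[of seq] by (simp add: seq_def[abs_def])
  then have "cleared t {} f Bd" unfolding cleared_def using f_bound f_times_coprime[OF nz] t nz by blast
  then show ?case by blast
next
  case (insert p R)
  have p: "prime p" "p dvd N" "p \<notin> R" using insert by auto
  from insert obtain F B where c: "cleared t R F B" by auto
  note F = cleared_props(1)[OF c] and B = cleared_props(2)[OF c] and \<alpha> = cleared_props(3)[OF c]
    and \<beta> = cleared_props(4)[OF c] and \<gamma> = cleared_props(5)[OF c] and \<delta> = cleared_props(6)[OF c]
  define P where "P = p ^ t p"
  have P: "P > 0" using prime_gt_0_nat[OF p(1)] by (simp add: P_def)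
  define G where "G = (\<lambda>n. F n - dil P F n)"
  have other: "prime q \<Longrightarrow> q \<noteq> p \<Longrightarrow> coprime p q" for q using p(1) by (simp add: primes_coprime)
  show ?case
    unfolding cleared_def
  proof (intro exI[of _ G] exI[of _ "2 * B"] conjI allI impI)
    \<comment> \<open>Dilating \<open>F n / n\<close> by \<open>P\<close> gives P F(n / P) / n; the
      coefficient -1 / P therefore makes the combination equal to \<open>G n / n\<close>.\<close>
    have "(\<lambda>n. F n / of_nat n + (- 1 / of_nat P) * dil P (\<lambda>n. F n / of_nat n) n) \<in> dspan seq"
      by (intro dspan_add_scale dspan_dil F P)
    moreover have "F n / of_nat n + (- 1 / of_nat P) * dil P (\<lambda>n. F n / of_nat n) n = G n / of_nat n" for n
    proof (cases "P dvd n")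
      case True
      then obtain m where n: "n = P * m" by auto
      show ?thesis using P by (cases "m = 0") (auto simp: G_def dil_def n field_simps)
    qed (simp add: G_def dil_def)
    ultimately show "(\<lambda>n. G n / of_nat n) \<in> dspan seq" by simp
  next
    fix n
    have "norm (dil P F n) \<le> B" using B order_trans[OF norm_ge_zero B] by (simp add: dil_def)
    then show "norm (G n) \<le> 2 * B"
      unfolding G_def using norm_triangle_ineq4[of "F n" "dil P F n"] B[of n] by simp
  next
    fix k n :: nat assume k: "coprime k N" and n: "n > 0"
    have "coprime p k" using coprime_divisors[of k k p N] k p(2) by (simp add: coprime_commute)
    then have dv: "P dvd n * k \<longleftrightarrow> P dvd n" unfolding P_def by (rule prime_power_dvd_mult_iff[OF p(1)])
    show "G (n * k) = f k / f 1 * G n"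
    proof (cases "P dvd n")
      case True
      then obtain m where m: "n = P * m" by auto
      then have m0: "m > 0" using n by (auto intro: gr0I)
      have "G (n * k) = F (n * k) - F (m * k)" using True dv P by (simp add: G_def dil_def m mult.assoc)
      also have "\<dots> = f k / f 1 * (F n - F m)" using \<alpha>[OF k n] \<alpha>[OF k m0] by (simp only: right_diff_distrib)
      also have "F n - F m = G n" using P by (simp add: G_def dil_def m)
      finally show ?thesis .
    next
      case False
      then show ?thesis using \<alpha>[OF k n] dv by (simp add: G_def dil_def)
    qed
  next
    fix q n assume q: "q \<in> insert p R" and n: "n > 0" and d: "q ^ (N + t q) dvd n"
    show "G n = 0"
    proof (cases "q = p")
      case True
      \<comment> \<open>n / P is still divisible by p^N, where F no longer changes under
        multiplication by P, so the two parts of G cancel.\<close>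
      have "P dvd n" using d unfolding True power_add P_def by (rule dvd_mult_right)
      then obtain m where m: "n = P * m" by auto
      have m0: "m > 0" using m n by (auto intro: gr0I)
      have "p ^ N * P dvd m * P" using d unfolding True power_add m P_def by (simp add: mult.commute)
      then have "p ^ N dvd m" using P by simp
      from \<gamma>[OF p m0 this] show ?thesis using P by (simp add: G_def dil_def m P_def)
    next
      case False
      then have qR: "q \<in> R" "prime q" using q insert by auto
      have "F n = 0" using \<beta>[OF qR(1) n d] .
      moreover have "dil P F n = 0"
      proof (cases "P dvd n")
        case True
        then obtain m where m: "n = P * m" by auto
        have m0: "m > 0" using m n by (auto intro: gr0I)
        have "coprime q P" unfolding P_def using other[OF qR(2) False] by (simp add: coprime_commute)
        then have "q ^ (N + t q) dvd m" using d prime_power_dvd_mult_iff[OF qR(2), of P "N + t q" m] by (simp add: m mult.commute)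
        then show ?thesis using \<beta>[OF qR(1) m0] P by (simp add: dil_def m)
      qed (simp add: dil_def)
      ultimately show ?thesis by (simp add: G_def)
    qed
  next
    fix q n assume q: "prime q" "q dvd N" "q \<notin> insert p R" and n: "n > 0" and d: "q ^ N dvd n"
    have cop: "coprime q p" using other[of q] q by (auto simp: coprime_commute)
    then have "coprime p (q ^ t q)" by (simp add: coprime_commute)
    then have dv: "P dvd q ^ t q * n \<longleftrightarrow> P dvd n"
      unfolding P_def using prime_power_dvd_mult_iff[OF p(1), of "q ^ t q" "t p" n] by (simp add: mult.commute)
    have Fn: "F (q ^ t q * n) = F n" using \<gamma>[of q n] q n d by simp
    show "G (q ^ t q * n) = G n"
    proof (cases "P dvd n")
      case True
      then obtain m where m: "n = P * m" by auto
      have m0: "m > 0" using m n by (auto intro: gr0I)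
      have "coprime q P" unfolding P_def using cop by simp
      then have "q ^ N dvd m" using d prime_power_dvd_mult_iff[OF q(1), of P N m] by (simp add: m mult.commute)
      then have "F (q ^ t q * m) = F m" using \<gamma>[of q m] q m0 by simp
      moreover have "(q ^ t q * n) div P = q ^ t q * m" using P by (simp add: m mult.left_commute)
      ultimately show ?thesis using Fn True dv P by (simp add: G_def dil_def m)
    next
      case False
      then show ?thesis using Fn dv by (simp add: G_def dil_def)
    qed
  next
    fix g assume g: "adm g"
    have "dsum G g 1 = (1 - g p ^ t p) * dsum F g 1"
      unfolding G_def P_def by (rule dsum_minus_dil[OF adm_csum[OF g] B p(1)])
    moreover have "g p ^ t p \<noteq> 1"
    proof
      assume "g p ^ t p = 1"
      then have "norm (g p) ^ t p = 1" by (metis norm_one norm_power)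
      moreover have "norm (g p) ^ t p < 1 ^ t p" using adm_norm_less_1[OF g p(1)] t[OF p(1,2)] by (intro power_strict_mono) auto
      ultimately show False by simp
    qed
    ultimately show "dsum G g 1 \<noteq> 0" using \<delta>[OF g] by simp
  qed
qed

text \<open>After clearing, \<open>F (n * k)\<close> is \<chi>(k) F n for k prime to
  \<open>N\<close>, so each prime not dividing \<open>N\<close> is sieved out exactly by subtracting
  one dilate. In the l2 limit there remains the finite sequence \<open>q\<close> carried by numbers
  composed of primes dividing \<open>N\<close>; its lift is that of \<open>F\<close> at points
  supported on these primes, hence zero-free.\<close>

theorem dclosure_seq_unit:
  assumes nz: "\<And>g. adm g \<Longrightarrow> dsum f g 1 \<noteq> 0"
  shows "dclosure seq (\<lambda>n. if n = 1 then 1 else 0)"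
proof -
  have "\<forall>p. \<exists>t. prime p \<longrightarrow> p dvd N \<longrightarrow> t > 0 \<and> (\<forall>n. p ^ N dvd n \<longrightarrow> f (p ^ t * n) = f n)"
    using ex_period_prime_power by metis
  then obtain t where t: "\<And>p. prime p \<Longrightarrow> p dvd N \<Longrightarrow> t p > 0 \<and> (\<forall>n. p ^ N dvd n \<longrightarrow> f (p ^ t p * n) = f n)" by metis
  define R where "R = {p. prime p \<and> p dvd N}"
  have R: "finite R" unfolding R_def by (rule finite_subset[OF _ finite_divisors_nat[OF N]]) auto
  obtain F B where c: "cleared t R F B"
    using clear_denominators[OF nz t R] unfolding R_def by auto
  note F = cleared_props(1)[OF c] and B = cleared_props(2)[OF c] and \<alpha> = cleared_props(3)[OF c]
    and \<beta> = cleared_props(4)[OF c] and \<delta> = cleared_props(6)[OF c]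
  define x where "x = (\<lambda>n. F n / of_nat n)"
  define xT where "xT = (\<lambda>T n. if \<exists>p\<in>T. p dvd n then 0 else x n)"
  have xT: "xT T \<in> dspan seq" if "finite T" "\<forall>p\<in>T. prime p \<and> coprime p N" for T
    using that
  proof (induction T rule: finite_induct)
    case empty
    then show ?case using F by (simp add: xT_def x_def)
  next
    case (insert p T)
    have p: "prime p" "coprime p N" using insert by auto
    have p0: "p > 0" using prime_gt_0_nat[OF p(1)] .
    \<comment> \<open>For n = p m one has x n = \<chi>(p) / p times x m, so the combination cancels
      the terms with p dividing n and leaves the others.\<close>
    have "(\<lambda>n. xT T n + (- (f p / f 1) / of_nat p) * dil p (xT T) n) \<in> dspan seq"
      using insert p0 by (intro dspan_add_scale dspan_dil) auto
    moreover have "xT T n + (- (f p / f 1) / of_nat p) * dil p (xT T) n = xT (insert p T) n" for n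
    proof (cases "p dvd n")
      case True
      then obtain m where m: "n = p * m" by auto
      have iff: "(\<exists>q\<in>T. q dvd n) \<longleftrightarrow> (\<exists>q\<in>T. q dvd m)"
      proof -
        have "q dvd p * m \<longleftrightarrow> q dvd m" if "q \<in> T" for q
        proof -
          have "prime q" "q \<noteq> p" using insert that by auto
          then have "\<not> q dvd p" using p(1) primes_dvd_imp_eq by blast
          then show ?thesis using \<open>prime q\<close> by (auto simp: prime_dvd_mult_iff)
        qed
        then show ?thesis unfolding m by blast
      qed
      have "x n = (f p / f 1) / of_nat p * x m"
      proof (cases "m = 0")
        case False
        then have "F n = f p / f 1 * F m" using \<alpha>[OF p(2), of m] by (simp add: m mult.commute)
        then show ?thesis by (simp add: x_def m)
      qed (simp add: x_def m)
      moreover have "xT (insert p T) n = 0" using True by (simp add: xT_def)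
      moreover have "dil p (xT T) n = xT T m" using p0 by (simp add: dil_def m)
      moreover have "xT T n = (if \<exists>q\<in>T. q dvd m then 0 else x n)" "xT T m = (if \<exists>q\<in>T. q dvd m then 0 else x m)"
        unfolding xT_def iff by auto
      ultimately show ?thesis by auto
    qed (auto simp: xT_def dil_def)
    ultimately show ?case by simp
  qed
  define q where "q = (\<lambda>n. if n > 0 \<and> (\<forall>p. prime p \<longrightarrow> p dvd n \<longrightarrow> p dvd N) then x n else 0)"
  have xb: "(norm (x n))\<^sup>2 \<le> B\<^sup>2 * real n powr (- (1 + 1))" if "n > 0" for n
  proof -
    have "(norm (x n))\<^sup>2 = (norm (F n))\<^sup>2 / (real n)\<^sup>2" by (simp add: x_def norm_divide power_divide)
    also have "\<dots> \<le> B\<^sup>2 / (real n)\<^sup>2" using B by (intro divide_right_mono power_mono) auto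
    also have "1 / (real n)\<^sup>2 = real n powr (- (1 + 1))" using that by (simp add: powr_minus powr_numeral field_simps)
    then have "B\<^sup>2 / (real n)\<^sup>2 = B\<^sup>2 * real n powr (- (1 + 1))" by (metis mult.right_neutral times_divide_eq_right)
    finally show ?thesis .
  qed
  have xs: "(\<lambda>n. (norm (x n))\<^sup>2) summable_on pos"
  proof (rule summable_on_comparison_test)
    have "summable (\<lambda>n. real n powr (- (1 + 1)))" by (simp add: summable_real_powr_iff)
    then have "(\<lambda>n. real n powr (- (1 + 1))) summable_on UNIV" by (intro summable_nonneg_imp_summable_on) auto
    then have "(\<lambda>n. real n powr (- (1 + 1))) summable_on pos" by (rule summable_on_subset_banach) simp
    then show "(\<lambda>n. B\<^sup>2 * real n powr (- (1 + 1))) summable_on pos" by (rule summable_on_cmult_right)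
  qed (use xb in auto)
  have q: "dclosure seq q"
  proof (rule dclosure_limit)
    fix e :: real assume e: "e > 0"
    obtain Y where Y: "(\<Sum>\<^sub>\<infinity>n\<in>{Y<..}. (norm (x n))\<^sup>2) < e"
      using infsum_tail_small[OF xs _ e] by auto
    define T where "T = {p\<in>{..Y}. prime p \<and> coprime p N}"
    have T: "finite T" "\<forall>p\<in>T. prime p \<and> coprime p N" by (auto simp: T_def)
    have small: "q n - xT T n = 0" if "n \<le> Y" for n
    proof (cases "n = 0")
      case True
      then show ?thesis by (simp add: q_def xT_def x_def)
    next
      case False
      then have n: "n > 0" by simp
      have ndvd: "\<not> p dvd N" if "p \<in> T" for p
        using T(2) that coprime_common_divisor[of p N p] prime_gt_1_nat[of p] by auto
      show ?thesis
      proof (cases "\<exists>p. prime p \<and> p dvd n \<and> \<not> p dvd N")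
        case True
        then obtain p where p: "prime p" "p dvd n" "\<not> p dvd N" by blast
        have "p \<le> Y" using dvd_imp_le[OF p(2) n] that by simp
        then have "p \<in> T" using p prime_imp_coprime[of p N] by (simp add: T_def)
        then have "xT T n = 0" using p(2) by (auto simp: xT_def)
        moreover have "q n = 0" using p by (auto simp: q_def)
        ultimately show ?thesis by simp
      next
        case False
        then have "q n = x n" using n by (auto simp: q_def)
        moreover have "xT T n = x n" using False ndvd T(2) by (auto simp: xT_def)
        ultimately show ?thesis by simp
      qed
    qed
    have le: "(norm (q n - xT T n))\<^sup>2 \<le> (norm (x n))\<^sup>2" for n
      by (auto simp: q_def xT_def)
    have xsY: "(\<lambda>n. (norm (x n))\<^sup>2) summable_on {Y<..}" by (rule summable_on_subset_banach[OF xs]) auto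
    have sY: "(\<lambda>n. (norm (q n - xT T n))\<^sup>2) summable_on {Y<..}"
      by (rule summable_on_comparison_test[OF xsY]) (use le in auto)
    have "l2 (\<lambda>n. q n - xT T n)" unfolding l2_def
      using sY by (rule summable_on_cong_neutral[THEN iffD1, rotated -1]) (use small in auto)
    moreover have "nsq (\<lambda>n. q n - xT T n) = (\<Sum>\<^sub>\<infinity>n\<in>{Y<..}. (norm (q n - xT T n))\<^sup>2)"
      unfolding nsq_def by (rule infsum_cong_neutral) (use small in auto)
    moreover have "\<dots> \<le> (\<Sum>\<^sub>\<infinity>n\<in>{Y<..}. (norm (x n))\<^sup>2)" by (rule infsum_mono[OF sY xsY le])
    moreover have "dclosure seq (xT T)" by (rule dclosure_dspan_self[OF xT[OF T]])
    ultimately show "\<exists>b'. dclosure seq b' \<and> l2 (\<lambda>n. q n - b' n) \<and> nsq (\<lambda>n. q n - b' n) < e"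
      using Y by (intro exI[of _ "xT T"]) auto
  qed
  \<comment> \<open>Finite because the exponents of all primes of \<open>R\<close> are bounded; the
    fourth clause of \<open>cleared\<close> makes \<open>q\<close> vanish off it.\<close>
  define A where "A = {n. n > 0 \<and> (\<forall>p. prime p \<longrightarrow> p dvd n \<longrightarrow> p dvd N) \<and> (\<forall>p\<in>R. \<not> p ^ (N + t p) dvd n)}"
  have "A \<subseteq> {n. n dvd (\<Prod>p\<in>R. p ^ (N + t p))}"
  proof
    fix n assume n: "n \<in> A"
    have K0: "(\<Prod>p\<in>R. p ^ (N + t p)) \<noteq> 0" using R by (auto simp: R_def)
    have "n dvd (\<Prod>p\<in>R. p ^ (N + t p))"
    proof (rule multiplicity_le_imp_dvd)
      show "n \<noteq> 0" using n by (simp add: A_def)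
      fix p :: nat assume p: "prime p"
      show "multiplicity p n \<le> multiplicity p (\<Prod>p\<in>R. p ^ (N + t p))"
      proof (cases "p dvd n")
        case True
        then have pR: "p \<in> R" using n p by (auto simp: A_def R_def)
        have "p ^ (N + t p) dvd (\<Prod>p\<in>R. p ^ (N + t p))" using R pR by (rule dvd_prodI)
        then have "N + t p \<le> multiplicity p (\<Prod>p\<in>R. p ^ (N + t p))"
          using K0 p by (intro multiplicity_geI) auto
        moreover have "multiplicity p n < N + t p"
          using n pR p by (intro multiplicity_lessI) (auto simp: A_def)
        ultimately show ?thesis by simp
      qed (simp add: not_dvd_imp_multiplicity_0)
    qed
    then show "n \<in> {n. n dvd (\<Prod>p\<in>R. p ^ (N + t p))}" by simp
  qed
  moreover have "finite {n. n dvd (\<Prod>p\<in>R. p ^ (N + t p))}"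
    by (rule finite_divisors_nat) (auto simp: R_def prime_gt_0_nat intro!: prod_pos)
  ultimately have finA: "finite A" by (rule finite_subset)
  have qA: "q n = 0" if "n \<notin> A" for n
    using that \<beta>[of _ n] by (auto simp: q_def A_def x_def)
  have "dclosure q (\<lambda>n. if n = 1 then 1 else 0)"
  proof (rule dclosure_zero_free_polynomial[OF finA _ qA])
    show "0 \<notin> A" by (simp add: A_def)
    fix s :: real and z :: complex assume z: "norm z < 1"
    \<comment> \<open>Coordinates \<open>z * p powr (i s)\<close> at the primes dividing
      \<open>N\<close> and 0 elsewhere, divided by p as \<open>adm\<close> requires;
      \<open>dsum F g 1\<close> is then the slice of \<open>q\<close>.\<close>
    define g where "g = (\<lambda>p. if p dvd N then z * (of_nat p powr (\<i> * of_real s) / of_nat p) else 0)"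
    have "{p. prime p \<and> g p \<noteq> 0} \<subseteq> R" by (auto simp: g_def R_def)
    then have "finite {p. prime p \<and> g p \<noteq> 0}" using R by (rule finite_subset)
    moreover have "norm (g p) * real p < 1" if "prime p" for p
    proof (cases "p dvd N")
      case True
      then have "norm (g p) * real p = norm z"
        using prime_gt_0_nat[OF that] by (simp add: g_def norm_mult norm_divide norm_nat_powr)
      then show ?thesis using z by simp
    qed (simp add: g_def)
    ultimately have g: "adm g" by (simp add: adm_def)
    have "dsum F g 1 = (\<Sum>\<^sub>\<infinity>n\<in>A. q n * of_nat n powr (\<i> * of_real s) * z ^ bigomega n)"
      unfolding dsum_def
    proof (rule infsum_cong_neutral)
      fix n assume "n \<in> pos - A"
      then have n: "n > 0" "n \<notin> A" by auto
      show "F (n * 1) * cmf g n = 0"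
      proof (cases "\<exists>p\<in>R. p ^ (N + t p) dvd n")
        case True
        then show ?thesis using \<beta> n by auto
      next
        case False
        then obtain p where "prime p" "p dvd n" "\<not> p dvd N" using n by (auto simp: A_def)
        then have "cmf g n = 0" using n by (intro cmf_eq_0[of p]) (auto simp: g_def)
        then show ?thesis by simp
      qed
    next
      fix n assume "n \<in> pos \<inter> A"
      then have n: "n > 0" "\<And>p. prime p \<Longrightarrow> p dvd n \<Longrightarrow> p dvd N" by (auto simp: A_def)
      have "cmf g n = cmf (\<lambda>p. z * (of_nat p powr (\<i> * of_real s) / of_nat p)) n"
        using n by (intro cmf_cong) (auto simp: g_def)
      also have "\<dots> = z ^ bigomega n * (of_nat n powr (\<i> * of_real s) / of_nat n)"
        using n by (simp add: cmf_scale cmf_div_of_nat cmf_powr)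
      finally show "F (n * 1) * cmf g n = q n * of_nat n powr (\<i> * of_real s) * z ^ bigomega n"
        using n by (auto simp: q_def x_def)
    qed (auto simp: A_def)
    then show "(\<Sum>n\<in>A. q n * of_nat n powr (\<i> * of_real s) * z ^ bigomega n) \<noteq> 0"
      using \<delta>[OF g] finA by simp
  qed
  with q show ?thesis by (rule dclosure_trans)
qed

end

subsection \<open>The sine basis\<close>

definition es :: "nat \<Rightarrow> real \<Rightarrow> complex" where
  "es n x = complex_of_real (sqrt 2 * sin (real n * pi * x))"

definition NN :: "(real \<Rightarrow> complex) \<Rightarrow> real" where
  "NN f = (\<integral>x. (norm (f x))\<^sup>2 \<partial>M01)"

lemma space_M01 [simp]: "space M01 = {0<..<1}"
  by (simp add: M01_def space_restrict_space)

lemma integral_M01: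
  fixes f :: "real \<Rightarrow> 'a::{banach, second_countable_topology}"
  shows "integral\<^sup>L M01 f = (\<integral>x. indicator {0<..<1} x *\<^sub>R f x \<partial>lborel)"
  unfolding M01_def by (subst integral_restrict_space) auto

lemma integrable_M01:
  fixes f :: "real \<Rightarrow> 'a::{banach, second_countable_topology}"
  shows "integrable M01 f \<longleftrightarrow> integrable lborel (\<lambda>x. indicator {0<..<1} x *\<^sub>R f x)"
  unfolding M01_def by (subst integrable_restrict_space) auto

lemma borel_measurable_M01_iff:
  fixes f :: "real \<Rightarrow> 'a::real_normed_vector"
  shows "f \<in> borel_measurable M01 \<longleftrightarrow> (\<lambda>x. indicator {0<..<1} x *\<^sub>R f x) \<in> borel_measurable borel"
  unfolding M01_def by (subst borel_measurable_restrict_space_iff) auto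

lemma borel_measurable_M01: "f \<in> borel_measurable borel \<Longrightarrow> f \<in> borel_measurable M01"
  unfolding M01_def by (rule measurable_restrict_space1) simp

lemma finite_measure_M01: "finite_measure M01"
  unfolding M01_def by (rule finite_measureI) (simp add: space_restrict_space emeasure_restrict_space)

lemma measure_M01 [simp]: "measure M01 {0<..<1} = 1"
  unfolding M01_def by (simp add: measure_restrict_space)

lemma integrable_M01_bounded:
  fixes f :: "real \<Rightarrow> 'a::{banach, second_countable_topology}"
  assumes "f \<in> borel_measurable M01" "\<And>x. 0 < x \<Longrightarrow> x < 1 \<Longrightarrow> norm (f x) \<le> B"
  shows "integrable M01 f"
  by (rule finite_measure.integrable_const_bound[OF finite_measure_M01, of _ B]) (use assms in \<open>auto intro!: AE_I2\<close>)

lemma L2_bounded: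
  assumes "f \<in> borel_measurable M01" "\<And>x. 0 < x \<Longrightarrow> x < 1 \<Longrightarrow> norm (f x) \<le> B"
  shows "L2 f"
  unfolding L2_def
proof
  show "integrable M01 (\<lambda>x. (norm (f x))\<^sup>2)"
    using assms by (intro integrable_M01_bounded[where B = "B\<^sup>2"]) (auto intro!: power_mono)
qed (rule assms)

lemma L2_es: "L2 (es n)"
proof (rule L2_bounded)
  show "es n \<in> borel_measurable M01" unfolding es_def by (intro borel_measurable_M01) measurable
  show "norm (es n x) \<le> sqrt 2 * 1" for x
    unfolding es_def norm_of_real abs_mult by (intro mult_mono) auto
qed

lemma L2_mult_integrable:
  assumes "L2 f" "L2 g"
  shows "integrable M01 (\<lambda>x. f x * g x)"
proof (rule Bochner_Integration.integrable_bound)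
  show "integrable M01 (\<lambda>x. (norm (f x))\<^sup>2 + (norm (g x))\<^sup>2)"
    using assms by (auto simp: L2_def)
  show "(\<lambda>x. f x * g x) \<in> borel_measurable M01" using assms unfolding L2_def by (intro borel_measurable_times) auto
  have "norm (f x * g x) \<le> norm ((norm (f x))\<^sup>2 + (norm (g x))\<^sup>2)" for x
  proof -
    have "2 * (norm (f x) * norm (g x)) \<le> (norm (f x))\<^sup>2 + (norm (g x))\<^sup>2"
      using sum_squares_bound[of "norm (f x)" "norm (g x)"] by simp
    moreover have "norm (f x) * norm (g x) \<ge> 0" by simp
    ultimately have "norm (f x) * norm (g x) \<le> (norm (f x))\<^sup>2 + (norm (g x))\<^sup>2" by linarith
    then show ?thesis by (simp add: norm_mult)
  qed
  then show "AE x in M01. norm (f x * g x) \<le> norm ((norm (f x))\<^sup>2 + (norm (g x))\<^sup>2)" by simp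
qed

lemma L2_scale: "L2 f \<Longrightarrow> L2 (\<lambda>x. c * f x)"
  unfolding L2_def by (auto simp: norm_mult power_mult_distrib)

lemma L2_add:
  assumes "L2 f" "L2 g"
  shows "L2 (\<lambda>x. f x + g x)" "NN (\<lambda>x. f x + g x) \<le> 2 * NN f + 2 * NN g"
proof -
  have le: "(norm (f x + g x))\<^sup>2 \<le> 2 * (norm (f x))\<^sup>2 + 2 * (norm (g x))\<^sup>2" for x
    by (rule sq_norm_add_le)
  have int: "integrable M01 (\<lambda>x. 2 * (norm (f x))\<^sup>2 + 2 * (norm (g x))\<^sup>2)" using assms by (auto simp: L2_def)
  have meas: "(\<lambda>x. f x + g x) \<in> borel_measurable M01" using assms by (auto simp: L2_def)
  have int2: "integrable M01 (\<lambda>x. (norm (f x + g x))\<^sup>2)"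
    by (rule Bochner_Integration.integrable_bound[OF int]) (use meas le in auto)
  show "L2 (\<lambda>x. f x + g x)" unfolding L2_def using meas int2 by blast
  have "NN (\<lambda>x. f x + g x) \<le> (\<integral>x. 2 * (norm (f x))\<^sup>2 + 2 * (norm (g x))\<^sup>2 \<partial>M01)"
    unfolding NN_def by (intro integral_mono int int2 le)
  also have "\<dots> = 2 * NN f + 2 * NN g" using assms unfolding NN_def L2_def by simp
  finally show "NN (\<lambda>x. f x + g x) \<le> 2 * NN f + 2 * NN g" .
qed

lemma L2_diff: "L2 f \<Longrightarrow> L2 g \<Longrightarrow> L2 (\<lambda>x. f x - g x)"
  using L2_add(1)[of f "\<lambda>x. - 1 * g x"] L2_scale[of g "- 1"] by simp

lemma L2_sum: "finite I \<Longrightarrow> (\<And>i. i \<in> I \<Longrightarrow> L2 (f i)) \<Longrightarrow> L2 (\<lambda>x. \<Sum>i\<in>I. f i x)"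
proof (induction I rule: finite_induct)
  case empty
  show ?case by (rule L2_bounded[where B = 0]) auto
next
  case (insert i I)
  then show ?case using L2_add(1)[of "f i" "\<lambda>x. \<Sum>i\<in>I. f i x"] by simp
qed

lemma NN_nonneg: "NN f \<ge> 0"
  unfolding NN_def by (rule Bochner_Integration.integral_nonneg) auto

lemma interval_integral_M01:
  fixes f F :: "real \<Rightarrow> complex"
  assumes ab: "0 \<le> a" "a \<le> b" "b \<le> 1"
    and F: "\<And>x. (F has_vector_derivative f x) (at x)" and f: "continuous_on UNIV f"
  shows "(\<integral>x. indicator {a<..<b} x *\<^sub>R f x \<partial>M01) = F b - F a"
proof -
  have "(\<integral>x. indicator {a<..<b} x *\<^sub>R f x \<partial>M01) = (\<integral>x. indicator {a<..<b} x *\<^sub>R f x \<partial>lborel)"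
    unfolding integral_M01 using ab by (intro Bochner_Integration.integral_cong) (auto simp: indicator_def)
  also have "\<dots> = (LBINT x=a..b. f x)"
    using ab by (simp add: interval_lebesgue_integral_def set_lebesgue_integral_def)
  also have "\<dots> = F b - F a"
    by (intro interval_integral_FTC_finite continuous_on_subset[OF f] has_vector_derivative_at_within[OF F]) auto
  finally show ?thesis .
qed

lemma cos_integral_M01:
  fixes k :: int
  shows "(\<integral>x. complex_of_real (cos (of_int k * pi * x)) \<partial>M01) = (if k = 0 then 1 else 0)"
proof (cases "k = 0")
  case True
  then show ?thesis by (simp add: measure_M01)
next
  case False
  define F where "F = (\<lambda>x. complex_of_real (sin (of_int k * pi * x) / (of_int k * pi)))"
  have "(\<integral>x. complex_of_real (cos (of_int k * pi * x)) \<partial>M01) =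
     (\<integral>x. indicator {0<..<1} x *\<^sub>R complex_of_real (cos (of_int k * pi * x)) \<partial>M01)"
    by (intro Bochner_Integration.integral_cong) (auto simp: indicator_def)
  also have "\<dots> = F 1 - F 0"
  proof (rule interval_integral_M01)
    fix x :: real
    have "((\<lambda>x. sin (of_int k * pi * x) / (of_int k * pi)) has_real_derivative cos (of_int k * pi * x)) (at x)"
      using False by (auto intro!: derivative_eq_intros simp: field_simps)
    then show "(F has_vector_derivative complex_of_real (cos (of_int k * pi * x))) (at x)"
      unfolding F_def by (intro has_vector_derivative_of_real) (simp add: has_real_derivative_iff_has_vector_derivative)
  qed (auto intro!: continuous_intros)
  also have "\<dots> = 0" by (simp add: F_def sin_times_pi_eq_0 mult.commute)
  finally show ?thesis using False by simp
qed

lemma es_orthonormal: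
  assumes "n > 0" "m > 0"
  shows "(\<integral>x. es n x * es m x \<partial>M01) = (if n = m then 1 else 0)"
proof -
  have eq: "es n x * es m x = complex_of_real (cos (of_int (int n - int m) * pi * x)) - complex_of_real (cos (of_int (int n + int m) * pi * x))" for x
  proof -
    have "2 * (sin (real n * pi * x) * sin (real m * pi * x)) = cos (real n * pi * x - real m * pi * x) - cos (real n * pi * x + real m * pi * x)"
      by (simp add: cos_add cos_diff)
    moreover have "(sqrt 2 * sin (real n * pi * x)) * (sqrt 2 * sin (real m * pi * x)) =
        (sqrt 2 * sqrt 2) * (sin (real n * pi * x) * sin (real m * pi * x))" by (simp only: mult_ac)
    ultimately have "(sqrt 2 * sin (real n * pi * x)) * (sqrt 2 * sin (real m * pi * x)) =
        cos (of_int (int n - int m) * pi * x) - cos (of_int (int n + int m) * pi * x)"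
      by (simp add: left_diff_distrib distrib_right)
    then show ?thesis unfolding es_def of_real_mult[symmetric] of_real_diff[symmetric] by simp
  qed
  have int: "integrable M01 (\<lambda>x. complex_of_real (cos (of_int k * pi * x)))" for k
    by (rule integrable_M01_bounded[where B = 1]) (auto intro!: borel_measurable_M01)
  show ?thesis
    unfolding eq Bochner_Integration.integral_diff[OF int int] cos_integral_M01 using assms by auto
qed

inductive_set sinepoly :: "(real \<Rightarrow> complex) set" where
  zero: "(\<lambda>_. 0) \<in> sinepoly"
| step: "s \<in> sinepoly \<Longrightarrow> (\<lambda>x. s x + b * es n x) \<in> sinepoly"

lemma es_0 [simp]: "es 0 = (\<lambda>_. 0)"
  by (auto simp: es_def)

lemma sinepoly_explicit: "s \<in> sinepoly \<Longrightarrow> \<exists>M b. \<forall>x. s x = (\<Sum>n=1..M. b n * es n x)"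
proof (induction rule: sinepoly.induct)
  case zero
  show ?case by (intro exI[of _ "0::nat"]) auto
next
  case (step s d k)
  then obtain M b where b: "\<And>x. s x = (\<Sum>n=1..M. b n * es n x)" by blast
  define b' where "b' = (\<lambda>j. (if j \<le> M then b j else 0) + (if j = k then d else 0))"
  have "s x + d * es k x = (\<Sum>j=1..max M k. b' j * es j x)" for x
  proof -
    have "(\<Sum>j=1..max M k. b' j * es j x) = (\<Sum>j=1..max M k. if j \<le> M then b j * es j x else 0) +
        (\<Sum>j=1..max M k. if j = k then d * es j x else 0)"
      unfolding sum.distrib[symmetric] by (intro sum.cong) (auto simp: b'_def algebra_simps)
    also have "(\<Sum>j=1..max M k. if j = k then d * es j x else 0) = d * es k x"
      by (cases "k = 0") (auto simp: sum.delta)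
    also have "(\<Sum>j=1..max M k. if j \<le> M then b j * es j x else 0) = s x"
      unfolding b by (rule sum.mono_neutral_cong_right) auto
    finally show ?thesis by simp
  qed
  then show ?case by blast
qed

lemma sinepoly_L2: "s \<in> sinepoly \<Longrightarrow> L2 s"
proof (induction rule: sinepoly.induct)
  case zero
  show ?case by (rule L2_bounded[where B = 0]) auto
next
  case (step s b n)
  then show ?case by (intro L2_add L2_scale L2_es)
qed

lemma sinepoly_add_scale: "s \<in> sinepoly \<Longrightarrow> t \<in> sinepoly \<Longrightarrow> (\<lambda>x. t x + c * s x) \<in> sinepoly"
proof (induction rule: sinepoly.induct)
  case (step s b n)
  then have "(\<lambda>x. (t x + c * s x) + (c * b) * es n x) \<in> sinepoly" by (intro sinepoly.step) auto
  then show ?case by (simp add: algebra_simps)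
qed simp

lemma es_times_cos: "n > 0 \<Longrightarrow> es n x * complex_of_real (cos (pi * x)) = (1/2) * es (n + 1) x + (1/2) * es (n - 1) x"
proof -
  assume "n > 0"
  have a: "real (n + 1) * pi * x = real n * pi * x + pi * x" by (simp add: algebra_simps)
  have b: "real (n - 1) * pi * x = real n * pi * x - pi * x" using \<open>n > 0\<close> by (simp add: of_nat_diff algebra_simps)
  have "sqrt 2 * sin (real n * pi * x) * cos (pi * x) =
      (1/2) * (sqrt 2 * sin (real (n + 1) * pi * x)) + (1/2) * (sqrt 2 * sin (real (n - 1) * pi * x))"
    unfolding a b sin_add sin_diff by (simp add: algebra_simps)
  from arg_cong[OF this, of complex_of_real] show ?thesis unfolding es_def
    by (simp only: of_real_add of_real_mult of_real_divide of_real_1 of_real_numeral)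
qed

lemma sinepoly_times_cos: "s \<in> sinepoly \<Longrightarrow> (\<lambda>x. s x * complex_of_real (cos (pi * x))) \<in> sinepoly"
proof (induction rule: sinepoly.induct)
  case zero
  show ?case by (simp add: sinepoly.zero)
next
  case (step s b n)
  show ?case
  proof (cases "n = 0")
    case False
    then have n: "n > 0" by simp
    have "(\<lambda>x. (s x * complex_of_real (cos (pi * x)) + (b * (1/2)) * es (n + 1) x) + (b * (1/2)) * es (n - 1) x) \<in> sinepoly"
      using step by (intro sinepoly.step)
    moreover have "(s x + b * es n x) * complex_of_real (cos (pi * x)) =
       (s x * complex_of_real (cos (pi * x)) + (b * (1/2)) * es (n + 1) x) + (b * (1/2)) * es (n - 1) x" for x
      unfolding distrib_right mult.assoc[of b "es n x"] es_times_cos[OF n] by (simp only: distrib_left mult.assoc add.assoc)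
    ultimately show ?thesis by simp
  qed (use step in simp)
qed

text \<open>Lets the Weierstrass theorem for ordinary polynomials in y = cos (pi x) produce sine
  polynomials.\<close>

lemma sinepoly_sin_cos_poly:
  "(\<lambda>x. es 1 x * (\<Sum>i\<le>d. a i * complex_of_real (cos (pi * x)) ^ i)) \<in> sinepoly"
proof -
  have pw: "(\<lambda>x. es 1 x * complex_of_real (cos (pi * x)) ^ i) \<in> sinepoly" for i
  proof (induction i)
    case 0
    show ?case using sinepoly.step[OF sinepoly.zero, of 1 1] by simp
  next
    case (Suc i)
    then show ?case using sinepoly_times_cos[OF Suc] by (simp add: mult_ac)
  qed
  show ?thesis
  proof (induction d)
    case 0
    show ?case using sinepoly_add_scale[OF pw[of 0] sinepoly.zero, of "a 0"] by (simp add: mult.commute)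
  next
    case (Suc d)
    show ?case using sinepoly_add_scale[OF pw[of "Suc d"] Suc, of "a (Suc d)"] by (simp add: algebra_simps)
  qed
qed

definition sdense :: "(real \<Rightarrow> complex) \<Rightarrow> bool" where
  "sdense f \<longleftrightarrow> L2 f \<and> (\<forall>e>0. \<exists>s\<in>sinepoly. NN (\<lambda>x. f x - s x) < e)"

lemma sdense_limit:
  assumes "L2 f" "\<And>e. e > 0 \<Longrightarrow> \<exists>g. sdense g \<and> NN (\<lambda>x. f x - g x) < e"
  shows "sdense f"
  unfolding sdense_def
proof (intro conjI allI impI assms(1))
  fix e :: real assume e: "e > 0"
  then have e4: "e / 4 > 0" by simp
  then obtain g where g: "sdense g" "NN (\<lambda>x. f x - g x) < e / 4" using assms(2) by blast
  then obtain s where s: "s \<in> sinepoly" "NN (\<lambda>x. g x - s x) < e / 4" using e4 unfolding sdense_def by blast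
  have "L2 g" using g by (simp add: sdense_def)
  then have "NN (\<lambda>x. (f x - g x) + (g x - s x)) \<le> 2 * NN (\<lambda>x. f x - g x) + 2 * NN (\<lambda>x. g x - s x)"
    using sinepoly_L2[OF s(1)] by (intro L2_add(2) L2_diff assms(1))
  then show "\<exists>s\<in>sinepoly. NN (\<lambda>x. f x - s x) < e" using s g by (intro bexI[of _ s]) auto
qed

lemma NN_le_bound:
  assumes "\<And>x. 0 < x \<Longrightarrow> x < 1 \<Longrightarrow> norm (f x) \<le> c" "f \<in> borel_measurable M01"
  shows "NN f \<le> c\<^sup>2"
proof -
  have "L2 f" by (rule L2_bounded[OF assms(2,1)])
  then have "NN f \<le> (\<integral>x. c\<^sup>2 \<partial>M01)"
    unfolding NN_def L2_def using assms
    by (intro integral_mono_AE finite_measure.integrable_const[OF finite_measure_M01]) (auto intro!: power_mono AE_I2)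
  then show ?thesis by simp
qed

text \<open>A continuous function supported away from the end points is \<open>sin (pi x)\<close> times a continuous function of \<open>cos (pi x)\<close>.\<close>

lemma sdense_compact_support:
  fixes h :: "real \<Rightarrow> complex"
  assumes h: "continuous_on UNIV h" and \<delta>: "0 < \<delta>" "\<delta> < 1/2" and supp: "\<And>x. x \<notin> {\<delta>..1 - \<delta>} \<Longrightarrow> h x = 0"
  shows "sdense h"
  unfolding sdense_def
proof (intro conjI allI impI)
  have meas: "h \<in> borel_measurable M01" using h by (intro borel_measurable_M01 borel_measurable_continuous_onI)
  have "compact (h ` {0..1})" using h by (intro compact_continuous_image continuous_on_subset[OF h]) auto
  then obtain B where B: "\<And>x. x \<in> {0..1} \<Longrightarrow> norm (h x) \<le> B"
    by (metis bounded_iff compact_imp_bounded imageI)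
  show "L2 h" by (rule L2_bounded[OF meas, of B]) (use B in auto)
  fix e :: real assume e: "e > 0"
  \<comment> \<open>The maximum keeps the denominator positive at the end points and changes nothing
    on the support of \<open>h\<close>, where sin (pi x) is at least sin (pi \<delta>).\<close>
  define \<phi> where "\<phi> = (\<lambda>y. h (arccos y / pi) / complex_of_real (sqrt 2 * max (sin (arccos y)) (sin (pi * \<delta>))))"
  have sd: "sin (pi * \<delta>) > 0" using \<delta> by (intro sin_gt_zero) auto
  have "max (sin (arccos y)) (sin (pi * \<delta>)) > 0" for y using sd by (simp add: max_def)
  then have cont: "continuous_on {-1..1} \<phi>" unfolding \<phi>_def
    by (intro continuous_intros continuous_on_compose2[OF h] continuous_on_of_real continuous_on_max continuous_on_mult)
       (auto intro!: continuous_intros simp: less_imp_neq[symmetric])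
  \<comment> \<open>Errors \<epsilon> in real and imaginary part and |es 1| \<le> 2 give 4
    \<epsilon> in all, with square e / 2.\<close>
  define \<epsilon> where "\<epsilon> = sqrt (e / 32)"
  have \<epsilon>: "\<epsilon> > 0" using e by (simp add: \<epsilon>_def)
  obtain p1 where p1: "real_polynomial_function p1" "\<And>y. y \<in> {-1..1} \<Longrightarrow> \<bar>Re (\<phi> y) - p1 y\<bar> < \<epsilon>"
    by (rule Stone_Weierstrass_real_polynomial_function[of "{-1..1}" "\<lambda>y. Re (\<phi> y)" \<epsilon>]) (use cont \<epsilon> in \<open>auto intro!: continuous_intros\<close>)
  obtain p2 where p2: "real_polynomial_function p2" "\<And>y. y \<in> {-1..1} \<Longrightarrow> \<bar>Im (\<phi> y) - p2 y\<bar> < \<epsilon>"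
    by (rule Stone_Weierstrass_real_polynomial_function[of "{-1..1}" "\<lambda>y. Im (\<phi> y)" \<epsilon>]) (use cont \<epsilon> in \<open>auto intro!: continuous_intros\<close>)
  obtain a1 n1 where a1: "p1 = (\<lambda>x. \<Sum>i\<le>n1. a1 i * x ^ i)" using p1(1) unfolding real_polynomial_function_iff_sum by blast
  obtain a2 n2 where a2: "p2 = (\<lambda>x. \<Sum>i\<le>n2. a2 i * x ^ i)" using p2(1) unfolding real_polynomial_function_iff_sum by blast
  define s where "s = (\<lambda>x. es 1 x * complex_of_real (p1 (cos (pi * x))) + \<i> * (es 1 x * complex_of_real (p2 (cos (pi * x)))))"
  have s: "s \<in> sinepoly" unfolding s_def
  proof (rule sinepoly_add_scale)
    show "(\<lambda>x. es 1 x * complex_of_real (p2 (cos (pi * x)))) \<in> sinepoly"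
      using sinepoly_sin_cos_poly[of "\<lambda>i. complex_of_real (a2 i)" n2] by (simp add: a2)
    show "(\<lambda>x. es 1 x * complex_of_real (p1 (cos (pi * x)))) \<in> sinepoly"
      using sinepoly_sin_cos_poly[of "\<lambda>i. complex_of_real (a1 i)" n1] by (simp add: a1)
  qed
  have hphi: "h x = es 1 x * \<phi> (cos (pi * x))" if x: "0 < x" "x < 1" for x
  proof (cases "x \<in> {\<delta>..1 - \<delta>}")
    case True
    have ac: "arccos (cos (pi * x)) = pi * x" using x by (intro arccos_cos) (auto simp: mult_le_cancel_left1)
    have "sin (pi * \<delta>) \<le> sin (pi * x)"
    proof (cases "x \<le> 1/2")
      case True2: True
      have "pi * \<delta> \<le> pi * x" "pi * x \<le> pi / 2" using True True2 by auto
      then show ?thesis using \<delta> by (intro sin_monotone_2pi_le) (auto intro: order_trans[of _ 0])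
    next
      case False
      have "pi * \<delta> \<le> pi * (1 - x)" "pi * (1 - x) \<le> pi / 2" using True False by auto
      then have "sin (pi * \<delta>) \<le> sin (pi * (1 - x))" using \<delta> by (intro sin_monotone_2pi_le) (auto intro: order_trans[of _ 0])
      also have "sin (pi * (1 - x)) = sin (pi * x)" by (simp add: right_diff_distrib sin_diff)
      finally show ?thesis .
    qed
    then have "max (sin (arccos (cos (pi * x)))) (sin (pi * \<delta>)) = sin (pi * x)" "sin (pi * x) > 0" using sd by (auto simp: ac)
    then show ?thesis using ac by (simp add: \<phi>_def es_def)
  next
    case False
    have ac: "arccos (cos (pi * x)) = pi * x" using x by (intro arccos_cos) (auto simp: mult_le_cancel_left1)
    show ?thesis using supp[OF False] by (simp add: \<phi>_def ac)
  qed
  have "norm (h x - s x) \<le> 2 * (2 * \<epsilon>)" if x: "0 < x" "x < 1" for x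
  proof -
    define y where "y = cos (pi * x)"
    have y: "y \<in> {-1..1}" by (simp add: y_def)
    have "h x - s x = es 1 x * (\<phi> y - (complex_of_real (p1 y) + \<i> * complex_of_real (p2 y)))"
      using hphi[OF x] by (simp add: s_def y_def algebra_simps)
    also have "norm \<dots> = norm (es 1 x) * norm (\<phi> y - (complex_of_real (p1 y) + \<i> * complex_of_real (p2 y)))" by (rule norm_mult)
    also have "\<dots> \<le> 2 * (2 * \<epsilon>)"
    proof (intro mult_mono)
      have "norm (es 1 x) \<le> sqrt 2 * 1" unfolding es_def norm_of_real abs_mult by (intro mult_mono) auto
      also have "\<dots> \<le> 2" using real_sqrt_le_mono[of 2 4] by simp
      finally show "norm (es 1 x) \<le> 2" .
      have "norm (\<phi> y - (complex_of_real (p1 y) + \<i> * complex_of_real (p2 y))) \<le> \<bar>Re (\<phi> y) - p1 y\<bar> + \<bar>Im (\<phi> y) - p2 y\<bar>"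
        using cmod_le[of "\<phi> y - (complex_of_real (p1 y) + \<i> * complex_of_real (p2 y))"] by simp
      then show "norm (\<phi> y - (complex_of_real (p1 y) + \<i> * complex_of_real (p2 y))) \<le> 2 * \<epsilon>" using p1(2)[OF y] p2(2)[OF y] by linarith
    qed auto
    finally show ?thesis .
  qed
  moreover have "(\<lambda>x. h x - s x) \<in> borel_measurable M01" using meas sinepoly_L2[OF s] by (auto simp: L2_def)
  ultimately have "NN (\<lambda>x. h x - s x) \<le> (4 * \<epsilon>)\<^sup>2" by (intro NN_le_bound) auto
  also have "\<dots> < e" using e by (simp add: \<epsilon>_def power_mult_distrib)
  finally show "\<exists>s\<in>sinepoly. NN (\<lambda>x. h x - s x) < e" using s by blast
qed

text \<open>Measurability supplies continuous functions converging to \<open>f\<close> almost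
  everywhere. Clipping their values to the ball of radius \<open>B\<close> and cutting off near the
  end points keeps the limit and gives a constant dominating function.\<close>

lemma sdense_bounded:
  assumes meas: "f \<in> borel_measurable M01" and B: "B > 0" "\<And>x. 0 < x \<Longrightarrow> x < 1 \<Longrightarrow> norm (f x) \<le> B"
  shows "sdense f"
proof -
  define f0 where "f0 = (\<lambda>x. indicator {0<..<1} x *\<^sub>R f x)"
  have "f0 \<in> borel_measurable borel" using meas by (simp add: borel_measurable_M01_iff f0_def)
  then have "f0 \<in> borel_measurable lborel" by simp
  then have "f0 \<in> borel_measurable lebesgue" by (rule measurable_completion)
  then have "f0 measurable_on UNIV" by (rule lebesgue_measurable_imp_measurable_on) simp
  then obtain Z G where Z: "negligible Z" and G: "\<And>n. continuous_on UNIV (G n)"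
      "\<And>x. x \<notin> Z \<Longrightarrow> (\<lambda>n. G n x) \<longlonglongrightarrow> f0 x"
    unfolding measurable_on_def by auto
  have AEZ: "AE x in M01. x \<notin> Z"
  proof -
    have "AE x in lebesgue. x \<notin> Z" using Z by (simp add: negligible_iff_null_sets AE_not_in)
    then have "AE x in lborel. x \<notin> Z" by (simp add: AE_completion_iff)
    then show ?thesis unfolding M01_def by (subst AE_restrict_space_iff) (auto elim: eventually_mono)
  qed
  \<comment> \<open>Radial retraction onto the ball of radius \<open>B\<close>: continuous, and the
    identity on the values of f in the open interval.\<close>
  define cl where "cl = (\<lambda>z::complex. (B / max B (norm z)) *\<^sub>R z)"
  have clcont: "continuous_on UNIV cl" unfolding cl_def using B(1)
    by (intro continuous_intros) (auto simp: max_def)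
  have clb: "norm (cl z) \<le> B" for z using B(1) by (auto simp: cl_def max_def field_simps)
  have clid: "cl z = z" if "norm z \<le> B" for z using that B(1) by (auto simp: cl_def max_def)
  \<comment> \<open>A trapezoid: 0 outside [1/n, 1 - 1/n] and 1 on [2/n, 1 - 2/n].\<close>
  define w where "w = (\<lambda>(n::nat) (x::real). max 0 (min 1 (min (real n * x - 1) (real n * (1 - x) - 1))))"
  have wb: "0 \<le> w n x" "w n x \<le> 1" for n x by (auto simp: w_def)
  have wlim: "(\<lambda>n. w n x) \<longlonglongrightarrow> 1" if x: "0 < x" "x < 1" for x
  proof (rule tendsto_eventually)
    obtain n1 where n1: "real n1 * x > 2" using reals_Archimedean3[OF x(1)] by blast
    obtain n2 where n2: "real n2 * (1 - x) > 2" using reals_Archimedean3[of "1 - x"] x by auto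
    show "eventually (\<lambda>n. w n x = 1) sequentially"
      using eventually_ge_at_top[of "max n1 n2"]
    proof eventually_elim
      fix n assume "max n1 n2 \<le> n"
      then have "real n1 * x \<le> real n * x" "real n2 * (1 - x) \<le> real n * (1 - x)" using x by (auto intro!: mult_right_mono)
      then show "w n x = 1" using n1 n2 by (auto simp: w_def)
    qed
  qed
  define h where "h = (\<lambda>n x. w n x *\<^sub>R cl (G n x))"
  have hcont: "continuous_on UNIV (h n)" for n unfolding h_def w_def
    by (intro continuous_intros continuous_on_compose2[OF clcont G(1)]) auto
  have hb: "norm (h n x) \<le> B" for n x
    unfolding h_def using mult_mono[OF wb(2)[of n x] clb[of "G n x"]] wb[of n x] by simp
  have hs: "sdense (h n)" if "n \<ge> 3" for n
  proof (rule sdense_compact_support[OF hcont, of "1 / real n"])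
    show "0 < 1 / real n" "1 / real n < 1 / 2" using that by (auto simp: field_simps)
    fix x assume "x \<notin> {1 / real n..1 - 1 / real n}"
    then have "real n * x < 1 \<or> real n * (1 - x) < 1" using that by (auto simp: field_simps)
    then show "h n x = 0" by (auto simp: h_def w_def)
  qed
  have L2f: "L2 f" by (rule L2_bounded[OF meas B(2)])
  have hm: "h n \<in> borel_measurable M01" for n using hcont by (intro borel_measurable_M01 borel_measurable_continuous_onI)
  have "(\<lambda>n. \<integral>x. (norm (f x - h n x))\<^sup>2 \<partial>M01) \<longlonglongrightarrow> (\<integral>x. 0 \<partial>M01)"
  proof (rule integral_dominated_convergence[where w = "\<lambda>_. (2 * B)\<^sup>2"])
    show "(\<lambda>x. (norm (f x - h n x))\<^sup>2) \<in> borel_measurable M01" for n using meas hm by measurable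
    show "integrable M01 (\<lambda>_. (2 * B)\<^sup>2)" by (rule finite_measure.integrable_const[OF finite_measure_M01])
    show "AE x in M01. (\<lambda>n. (norm (f x - h n x))\<^sup>2) \<longlonglongrightarrow> 0"
    proof -
      have "AE x in M01. x \<in> space M01" by (rule AE_space)
      then show ?thesis using AEZ
      proof eventually_elim
        fix x assume x: "x \<in> space M01" "x \<notin> Z"
        then have x': "0 < x" "x < 1" by auto
        have "(\<lambda>n. G n x) \<longlonglongrightarrow> f x" using G(2)[OF x(2)] x' by (simp add: f0_def)
        moreover have "isCont cl (f x)" using clcont by (simp add: continuous_on_eq_continuous_at)
        ultimately have "(\<lambda>n. cl (G n x)) \<longlonglongrightarrow> cl (f x)" by (rule isCont_tendsto_compose[rotated])
        then have "(\<lambda>n. h n x) \<longlonglongrightarrow> 1 *\<^sub>R f x" unfolding h_def using clid[OF B(2)[OF x']] wlim[OF x'] by (intro tendsto_scaleR) auto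
        then have "(\<lambda>n. (norm (f x - h n x))\<^sup>2) \<longlonglongrightarrow> (norm (f x - 1 *\<^sub>R f x))\<^sup>2" by (intro tendsto_intros)
        then show "(\<lambda>n. (norm (f x - h n x))\<^sup>2) \<longlonglongrightarrow> 0" by simp
      qed
    qed
    show "AE x in M01. norm ((norm (f x - h n x))\<^sup>2) \<le> (2 * B)\<^sup>2" for n
    proof (rule AE_I2)
      fix x assume "x \<in> space M01"
      then have "norm (f x) \<le> B" using B(2) by auto
      then have "norm (f x - h n x) \<le> 2 * B" using norm_triangle_ineq4[of "f x" "h n x"] hb[of n x] by simp
      then show "norm ((norm (f x - h n x))\<^sup>2) \<le> (2 * B)\<^sup>2"
        using power_mono[of "norm (f x - h n x)" "2 * B" 2] by simp
    qed
  qed auto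
  then have lim: "(\<lambda>n. NN (\<lambda>x. f x - h n x)) \<longlonglongrightarrow> 0" by (simp add: NN_def)
  show ?thesis
  proof (rule sdense_limit[OF L2f])
    fix e :: real assume "e > 0"
    then have "eventually (\<lambda>n. NN (\<lambda>x. f x - h n x) < e) sequentially" using lim by (intro order_tendstoD)
    then have "eventually (\<lambda>n. NN (\<lambda>x. f x - h n x) < e \<and> n \<ge> 3) sequentially"
      using eventually_ge_at_top[of 3] by eventually_elim auto
    then obtain n where "NN (\<lambda>x. f x - h n x) < e" "n \<ge> 3" by (auto simp: eventually_sequentially)
    then show "\<exists>g. sdense g \<and> NN (\<lambda>x. f x - g x) < e" using hs by blast
  qed
qed

text \<open>Large values are cut off, with |f|^2 as dominating function.\<close>

lemma sdense_L2:
  assumes "L2 f"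
  shows "sdense f"
proof (rule sdense_limit[OF assms])
  have meas: "f \<in> borel_measurable M01" using assms by (simp add: L2_def)
  define fB where "fB = (\<lambda>(n::nat) x. if norm (f x) \<le> real n + 1 then f x else 0)"
  have mB: "fB n \<in> borel_measurable M01" for n unfolding fB_def using meas by measurable
  have sB: "sdense (fB n)" for n
    by (rule sdense_bounded[OF mB, of "real n + 1"]) (auto simp: fB_def)
  have "(\<lambda>n. \<integral>x. (norm (f x - fB n x))\<^sup>2 \<partial>M01) \<longlonglongrightarrow> (\<integral>x. 0 \<partial>M01)"
  proof (rule integral_dominated_convergence[where w = "\<lambda>x. (norm (f x))\<^sup>2"])
    show "(\<lambda>x. (norm (f x - fB n x))\<^sup>2) \<in> borel_measurable M01" for n using meas mB by measurable
    show "integrable M01 (\<lambda>x. (norm (f x))\<^sup>2)" using assms by (simp add: L2_def)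
    show "AE x in M01. (\<lambda>n. (norm (f x - fB n x))\<^sup>2) \<longlonglongrightarrow> 0"
    proof (rule AE_I2)
      fix x
      obtain n0 where n0: "norm (f x) \<le> real n0" using real_arch_simple by blast
      have "eventually (\<lambda>n. (norm (f x - fB n x))\<^sup>2 = 0) sequentially"
        using eventually_ge_at_top[of n0]
      proof eventually_elim
        fix n assume "n0 \<le> n"
        then have "real n0 \<le> real n" by simp
        then show "(norm (f x - fB n x))\<^sup>2 = 0" using n0 by (simp add: fB_def)
      qed
      then show "(\<lambda>n. (norm (f x - fB n x))\<^sup>2) \<longlonglongrightarrow> 0" by (rule tendsto_eventually)
    qed
    show "AE x in M01. norm ((norm (f x - fB n x))\<^sup>2) \<le> (norm (f x))\<^sup>2" for n by (rule AE_I2) (simp add: fB_def)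
  qed auto
  then have lim: "(\<lambda>n. NN (\<lambda>x. f x - fB n x)) \<longlonglongrightarrow> 0" by (simp add: NN_def)
  fix e :: real assume "e > 0"
  then have "eventually (\<lambda>n. NN (\<lambda>x. f x - fB n x) < e) sequentially" using lim by (intro order_tendstoD)
  then show "\<exists>g. sdense g \<and> NN (\<lambda>x. f x - g x) < e" using sB by (auto simp: eventually_sequentially)
qed

subsection \<open>Parseval's identity\<close>

lemma sine_coeff_es: "sine_coeff f n = (\<integral>x. f x * es n x \<partial>M01)"
  by (simp add: sine_coeff_def es_def)

lemma sine_coeff_0 [simp]: "sine_coeff f 0 = 0"
  by (simp add: sine_coeff_es)

lemma sine_coeff_add_scale:
  "L2 f \<Longrightarrow> L2 g \<Longrightarrow> sine_coeff (\<lambda>x. f x + c * g x) n = sine_coeff f n + c * sine_coeff g n"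
  using L2_mult_integrable[OF _ L2_es[of n], of f] L2_mult_integrable[OF _ L2_es[of n], of g]
  by (simp add: sine_coeff_es distrib_right mult.assoc)

lemma sine_coeff_diff: "L2 f \<Longrightarrow> L2 g \<Longrightarrow> sine_coeff (\<lambda>x. f x - g x) n = sine_coeff f n - sine_coeff g n"
  using sine_coeff_add_scale[of f g "- 1" n] by simp

lemma sine_coeff_sum:
  assumes "finite I" "\<And>i. i \<in> I \<Longrightarrow> L2 (g i)"
  shows "sine_coeff (\<lambda>x. \<Sum>i\<in>I. c i * g i x) n = (\<Sum>i\<in>I. c i * sine_coeff (g i) n)"
  using assms
proof (induction I rule: finite_induct)
  case empty
  then show ?case by (simp add: sine_coeff_es)
next
  case (insert i I)
  have "L2 (\<lambda>x. \<Sum>i\<in>I. c i * g i x)" using insert by (intro L2_sum L2_scale) auto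
  then show ?case using insert sine_coeff_add_scale[of "\<lambda>x. \<Sum>i\<in>I. c i * g i x" "g i" "c i" n] by (simp add: add.commute)
qed

lemma sine_coeff_basis: "m > 0 \<Longrightarrow> sine_coeff (es m) n = (if m = n then 1 else 0)"
  by (cases "n = 0") (auto simp: sine_coeff_es es_orthonormal)

lemma NN_diff_scale_es:
  assumes h: "L2 h" and k: "k > 0"
  shows "NN (\<lambda>x. h x - b * es k x) = NN h - 2 * Re (cnj b * sine_coeff h k) + (norm b)\<^sup>2"
proof -
  have ie: "integrable M01 (\<lambda>x. h x * es k x)" "integrable M01 (\<lambda>x. es k x * es k x)"
    by (intro L2_mult_integrable h L2_es)+
  have pt: "(norm (h x - b * es k x))\<^sup>2 = (norm (h x))\<^sup>2 - 2 * Re (cnj b * (h x * es k x)) + (norm b)\<^sup>2 * Re (es k x * es k x)" for x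
  proof -
    define r where "r = sqrt 2 * sin (real k * pi * x)"
    have r: "es k x = complex_of_real r" by (simp add: es_def r_def)
    show ?thesis unfolding r cmod_power2 by (simp add: power2_eq_square algebra_simps)
  qed
  have "NN (\<lambda>x. h x - b * es k x) = (\<integral>x. (norm (h x))\<^sup>2 - 2 * Re (cnj b * (h x * es k x)) + (norm b)\<^sup>2 * Re (es k x * es k x) \<partial>M01)"
    unfolding NN_def pt ..
  also have "\<dots> = NN h - 2 * (\<integral>x. Re (cnj b * (h x * es k x)) \<partial>M01) + (norm b)\<^sup>2 * (\<integral>x. Re (es k x * es k x) \<partial>M01)"
  proof -
    have i1: "integrable M01 (\<lambda>x. (norm (h x))\<^sup>2)" using h by (simp add: L2_def)
    have i2: "integrable M01 (\<lambda>x. 2 * Re (cnj b * (h x * es k x)))"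
      using integrable_Re[OF integrable_mult_right[of "cnj b", OF ie(1)]] by (intro integrable_mult_right) auto
    have i3: "integrable M01 (\<lambda>x. (norm b)\<^sup>2 * Re (es k x * es k x))"
      using integrable_Re[OF ie(2)] by (intro integrable_mult_right) auto
    show ?thesis unfolding NN_def
      Bochner_Integration.integral_add[OF Bochner_Integration.integrable_diff[OF i1 i2] i3]
      Bochner_Integration.integral_diff[OF i1 i2] integral_mult_right_zero ..
  qed
  also have "(\<integral>x. Re (cnj b * (h x * es k x)) \<partial>M01) = Re (cnj b * sine_coeff h k)"
    unfolding sine_coeff_es using ie by (subst integral_Re) auto
  also have "(\<integral>x. Re (es k x * es k x) \<partial>M01) = 1"
    using integral_Re[OF ie(2)] es_orthonormal[OF k k] by simp
  finally show ?thesis by simp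
qed

text \<open>The square completed: only the last sum depends on \<open>b\<close>, and it vanishes for
  the sine coefficients.\<close>

lemma NN_diff_sine_sum:
  assumes g: "L2 g"
  shows "NN (\<lambda>x. g x - (\<Sum>n=1..M. b n * es n x)) =
     NN g - (\<Sum>n=1..M. (norm (sine_coeff g n))\<^sup>2) + (\<Sum>n=1..M. (norm (sine_coeff g n - b n))\<^sup>2)"
proof (induction M)
  case (Suc M)
  let ?s = "\<lambda>x. \<Sum>n=1..M. b n * es n x"
  have s: "L2 ?s" by (intro L2_sum L2_scale L2_es) auto
  have c: "sine_coeff (\<lambda>x. g x - ?s x) (Suc M) = sine_coeff g (Suc M)"
    unfolding sine_coeff_diff[OF g s] using sine_coeff_sum[of "{1..M}" es b "Suc M"] L2_es
    by (simp add: sine_coeff_basis)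
  have "NN (\<lambda>x. g x - (\<Sum>n=1..Suc M. b n * es n x)) = NN (\<lambda>x. (g x - ?s x) - b (Suc M) * es (Suc M) x)"
    by (simp add: algebra_simps)
  also have "\<dots> = NN (\<lambda>x. g x - ?s x) - 2 * Re (cnj (b (Suc M)) * sine_coeff g (Suc M)) + (norm (b (Suc M)))\<^sup>2"
    using NN_diff_scale_es[OF L2_diff[OF g s], of "Suc M" "b (Suc M)"] by (simp only: c)
  also have "- 2 * Re (cnj (b (Suc M)) * sine_coeff g (Suc M)) + (norm (b (Suc M)))\<^sup>2 =
      (norm (sine_coeff g (Suc M) - b (Suc M)))\<^sup>2 - (norm (sine_coeff g (Suc M)))\<^sup>2"
    unfolding cmod_power2 by (simp add: power2_eq_square algebra_simps)
  then have "NN (\<lambda>x. g x - ?s x) - 2 * Re (cnj (b (Suc M)) * sine_coeff g (Suc M)) + (norm (b (Suc M)))\<^sup>2 =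
     NN (\<lambda>x. g x - ?s x) + ((norm (sine_coeff g (Suc M) - b (Suc M)))\<^sup>2 - (norm (sine_coeff g (Suc M)))\<^sup>2)" by simp
  finally show ?case using Suc by simp
qed simp

lemma bessel: "L2 g \<Longrightarrow> (\<Sum>n=1..M. (norm (sine_coeff g n))\<^sup>2) \<le> NN g"
  using NN_diff_sine_sum[of g "sine_coeff g" M] NN_nonneg[of "\<lambda>x. g x - (\<Sum>n=1..M. sine_coeff g n * es n x)"] by simp

lemma sine_coeff_le: "L2 g \<Longrightarrow> (norm (sine_coeff g n))\<^sup>2 \<le> NN g"
proof (cases "n = 0")
  case False
  assume g: "L2 g"
  have "(norm (sine_coeff g n))\<^sup>2 \<le> (\<Sum>n=1..n. (norm (sine_coeff g n))\<^sup>2)"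
    using False by (intro member_le_sum) auto
  then show ?thesis using bessel[OF g, of n] by simp
qed (simp add: NN_nonneg)

theorem parseval:
  assumes g: "L2 g"
  shows "((\<lambda>n. (norm (sine_coeff g n))\<^sup>2) has_sum NN g) UNIV"
proof (rule sums_nonneg_imp_has_sum)
  define S where "S = (\<lambda>M. \<Sum>n=1..M. (norm (sine_coeff g n))\<^sup>2)"
  have mono: "S M \<le> S M'" if "M \<le> M'" for M M' unfolding S_def using that by (intro sum_mono2) auto
  have "S \<longlonglongrightarrow> NN g"
  proof (rule LIMSEQ_I)
    fix e :: real assume e: "e > 0"
    then obtain s where s: "s \<in> sinepoly" "NN (\<lambda>x. g x - s x) < e" using sdense_L2[OF g] unfolding sdense_def by blast
    obtain M b where b: "\<And>x. s x = (\<Sum>n=1..M. b n * es n x)" using sinepoly_explicit[OF s(1)] by blast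
    \<comment> \<open>The partial sine series is the best approximation of length M, so a good sine
      polynomial forces \<open>S M\<close> close to \<open>NN g\<close>.\<close>
    have "NN g - S M \<le> NN (\<lambda>x. g x - s x)"
      unfolding b NN_diff_sine_sum[OF g] S_def by (simp add: sum_nonneg)
    then have "NN g - S M < e" using s by simp
    show "\<exists>no. \<forall>n\<ge>no. norm (S n - NN g) < e"
    proof (intro exI[of _ M] allI impI)
      fix n assume "M \<le> n"
      then have "S M \<le> S n" by (rule mono)
      moreover have "S n \<le> NN g" unfolding S_def by (rule bessel[OF g])
      ultimately show "norm (S n - NN g) < e" using \<open>NN g - S M < e\<close> by simp
    qed
  qed
  moreover have "(\<Sum>n<Suc M. (norm (sine_coeff g n))\<^sup>2) = S M" for M
  proof -
    have "{..<Suc M} = insert 0 {1..M}" by auto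
    then show ?thesis by (simp add: S_def)
  qed
  ultimately have "(\<lambda>M. \<Sum>n<Suc M. (norm (sine_coeff g n))\<^sup>2) \<longlonglongrightarrow> NN g" by simp
  then show "(\<lambda>n. (norm (sine_coeff g n))\<^sup>2) sums NN g" unfolding sums_def by (rule LIMSEQ_imp_Suc)
qed auto

subsection \<open>Dilations of the odd periodic extension\<close>

definition cut :: "(real \<Rightarrow> complex) \<Rightarrow> real \<Rightarrow> complex" where
  "cut \<phi> x = indicator {0<..<1} x *\<^sub>R \<phi> x"

text \<open>\<open>cut\<close> vanishes outside (0,1), so the two terms take over the case
  distinction and measurability follows by composition.\<close>

lemma odd_ext_cut:
  defines "y \<equiv> \<lambda>x. x - 2 * of_int \<lfloor>x / 2\<rfloor>"
  shows "odd_ext \<phi> x = cut \<phi> (y x) - cut \<phi> (2 - y x)"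
proof -
  have "0 \<le> y x" "y x < 2" unfolding y_def by linarith+
  then show ?thesis unfolding odd_ext_def Let_def y_def[symmetric] by (auto simp: cut_def indicator_def y_def)
qed

lemma borel_measurable_odd_ext:
  assumes "\<phi> \<in> borel_measurable M01"
  shows "odd_ext \<phi> \<in> borel_measurable borel"
proof -
  have c: "cut \<phi> \<in> borel_measurable borel" using assms by (simp add: borel_measurable_M01_iff cut_def[abs_def])
  have "(\<lambda>x::real. x - 2 * of_int \<lfloor>x / 2\<rfloor>) \<in> borel_measurable borel" by measurable
  from measurable_compose[OF this c] have 1: "(\<lambda>x. cut \<phi> (x - 2 * of_int \<lfloor>x / 2\<rfloor>)) \<in> borel_measurable borel" .
  have "(\<lambda>x::real. 2 - (x - 2 * of_int \<lfloor>x / 2\<rfloor>)) \<in> borel_measurable borel" by measurable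
  from measurable_compose[OF this c] have 2: "(\<lambda>x. cut \<phi> (2 - (x - 2 * of_int \<lfloor>x / 2\<rfloor>))) \<in> borel_measurable borel" .
  have "odd_ext \<phi> = (\<lambda>x. cut \<phi> (x - 2 * of_int \<lfloor>x / 2\<rfloor>) - cut \<phi> (2 - (x - 2 * of_int \<lfloor>x / 2\<rfloor>)))"
    by (rule ext) (rule odd_ext_cut)
  then show ?thesis using borel_measurable_diff[OF 1 2] by simp
qed

text \<open>As x runs through (0,1), k x runs through k unit intervals; on the j-th the odd
  extension is a translate of \<phi> for even j and a negated reflection for odd j, and the sign
  disappears under the norm. Each piece is an affine substitution.\<close>

lemma sq_norm_odd_ext_dilate:
  assumes k: "k > (0::nat)"
  shows "indicator {0<..<1} x *\<^sub>R (norm (odd_ext \<phi> (real k * x)))\<^sup>2 =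
    (\<Sum>j<k. (norm (cut \<phi> (if even j then - real j + real k * x else (1 + real j) + (- real k) * x)))\<^sup>2)"
proof -
  define \<psi> where "\<psi> = (\<lambda>j::nat. cut \<phi> (if even j then - real j + real k * x else (1 + real j) + (- real k) * x))"
  have z: "\<psi> j = 0" if "\<not> (real j < real k * x \<and> real k * x < real j + 1)" for j
    using that by (auto simp: \<psi>_def cut_def indicator_def)
  show ?thesis
  proof (cases "0 < x \<and> x < 1")
    case False
    have "\<psi> j = 0" if "j < k" for j
    proof (rule z, rule notI)
      assume a: "real j < real k * x \<and> real k * x < real j + 1"
      have "real j + 1 \<le> real k" using that by linarith
      then have "real k * x < real k" using a by linarith
      then have "x < 1" using mult_left_mono[of 1 x "real k"] by force
      moreover have "0 < real k * x" using a by linarith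
      then have "0 < x" using k by (simp add: zero_less_mult_iff)
      ultimately show False using False by simp
    qed
    then have "(\<Sum>j<k. (norm (\<psi> j))\<^sup>2) = 0" by simp
    moreover have "indicator {0<..<1} x = (0::real)" using False by (auto simp: indicator_def)
    ultimately show ?thesis by (simp add: \<psi>_def)
  next
    case True
    define i where "i = nat \<lfloor>real k * x\<rfloor>"
    have pos: "0 < real k * x" using True k by simp
    have fl: "real i \<le> real k * x" "real k * x < real i + 1"
      using pos unfolding i_def by linarith+
    have "real k * x < real k * 1" using True k by (intro mult_strict_left_mono) auto
    then have "real i < real k" using fl by linarith
    then have ik: "i < k" by simp
    have "(\<Sum>j<k. (norm (\<psi> j))\<^sup>2) = (\<Sum>j\<in>{i}. (norm (\<psi> j))\<^sup>2)"
    proof (rule sum.mono_neutral_right)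
      show "\<forall>j\<in>{..<k} - {i}. (norm (\<psi> j))\<^sup>2 = 0"
      proof
        fix j assume "j \<in> {..<k} - {i}"
        then have "j \<noteq> i" by simp
        then have "\<not> (real j < real k * x \<and> real k * x < real j + 1)" using fl by linarith
        then show "(norm (\<psi> j))\<^sup>2 = 0" using z by simp
      qed
    qed (use ik in auto)
    also have "\<dots> = (norm (odd_ext \<phi> (real k * x)))\<^sup>2"
    proof -
      define u where "u = real k * x - real i"
      have u: "0 \<le> u" "u < 1" using fl by (auto simp: u_def)
      show ?thesis
      proof (cases "even i")
        case True
        then obtain m where m: "i = 2 * m" by auto
        have "\<lfloor>real k * x / 2\<rfloor> = int m" using fl by (intro floor_unique) (auto simp: m)
        then have "odd_ext \<phi> (real k * x) = cut \<phi> u - cut \<phi> (2 - u)"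
          by (simp add: odd_ext_cut u_def m)
        also have "cut \<phi> (2 - u) = 0" using u by (simp add: cut_def)
        finally show ?thesis using True by (simp add: \<psi>_def u_def add.commute)
      next
        case False
        then obtain m where m: "i = 2 * m + 1" by (auto elim: oddE)
        have "\<lfloor>real k * x / 2\<rfloor> = int m" using fl by (intro floor_unique) (auto simp: m)
        then have "odd_ext \<phi> (real k * x) = cut \<phi> (1 + u) - cut \<phi> (1 - u)"
          by (simp add: odd_ext_cut u_def m algebra_simps)
        also have "cut \<phi> (1 + u) = 0" using u by (simp add: cut_def)
        finally show ?thesis using False by (simp add: \<psi>_def u_def algebra_simps)
      qed
    qed
    finally show ?thesis using True by (simp add: \<psi>_def indicator_def)
  qed
qed

text \<open>Each of the k affine pieces contributes \<open>NN \<phi> / k\<close>, so dilations are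
  isometric.\<close>

lemma L2_dilate:
  assumes \<phi>: "L2 \<phi>" and k: "k > 0"
  shows "L2 (\<lambda>x. odd_ext \<phi> (real k * x))" "NN (\<lambda>x. odd_ext \<phi> (real k * x)) = NN \<phi>"
proof -
  define q where "q = (\<lambda>x. (norm (cut \<phi> x))\<^sup>2)"
  have qe: "q x = indicator {0<..<1} x *\<^sub>R (norm (\<phi> x))\<^sup>2" for x by (simp add: q_def cut_def indicator_def)
  have qi: "integrable lborel q" using \<phi> unfolding L2_def integrable_M01 qe[symmetric] by simp
  have NNq: "NN \<phi> = integral\<^sup>L lborel q" unfolding NN_def integral_M01 qe[symmetric] by simp
  have k0: "real k \<noteq> 0" "- real k \<noteq> 0" using k by auto
  define r where "r = (\<lambda>(j::nat) x. q (if even j then - real j + real k * x else (1 + real j) + (- real k) * x))"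
  have ri: "integrable lborel (r j)" for j
    unfolding r_def using lborel_integrable_real_affine[OF qi k0(1), of "- real j"]
      lborel_integrable_real_affine[OF qi k0(2), of "1 + real j"]
    by (cases "even j") (simp_all only: if_True if_False)
  have rI: "integral\<^sup>L lborel (r j) = NN \<phi> / real k" for j
    unfolding r_def NNq using lborel_integral_real_affine[OF k0(1), of q "- real j"]
      lborel_integral_real_affine[OF k0(2), of q "1 + real j"] k
    by (cases "even j") auto
  have eq: "indicator {0<..<1} x *\<^sub>R (norm (odd_ext \<phi> (real k * x)))\<^sup>2 = (\<Sum>j<k. r j x)" for x
    unfolding r_def q_def by (rule sq_norm_odd_ext_dilate[OF k])
  have meas: "(\<lambda>x. odd_ext \<phi> (real k * x)) \<in> borel_measurable M01"
  proof (rule borel_measurable_M01)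
    have "(\<lambda>x. real k * x) \<in> borel_measurable borel" by measurable
    moreover have "odd_ext \<phi> \<in> borel_measurable borel" using \<phi> by (intro borel_measurable_odd_ext) (simp add: L2_def)
    ultimately show "(\<lambda>x. odd_ext \<phi> (real k * x)) \<in> borel_measurable borel" by (rule measurable_compose)
  qed
  show "L2 (\<lambda>x. odd_ext \<phi> (real k * x))"
    unfolding L2_def integrable_M01 eq using meas ri by auto
  show "NN (\<lambda>x. odd_ext \<phi> (real k * x)) = NN \<phi>"
    unfolding NN_def integral_M01 eq using ri rI k by (simp add: NN_def integral_M01)
qed

lemma odd_ext_diff: "odd_ext (\<lambda>x. f x - g x) x = odd_ext f x - odd_ext g x"
  by (simp add: odd_ext_def Let_def)

lemma odd_ext_lincomb: "odd_ext (\<lambda>x. \<Sum>n\<in>I. b n * g n x) x = (\<Sum>n\<in>I. b n * odd_ext (g n) x)"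
proof -
  define y where "y = x - 2 * of_int \<lfloor>x / 2\<rfloor>"
  consider "0 < y" "y < 1" | "1 < y" | "\<not> (0 < y \<and> y < 1)" "\<not> 1 < y" by blast
  then show ?thesis unfolding odd_ext_def Let_def y_def[symmetric] by cases (auto simp: sum_negf)
qed

lemma odd_ext_es: "odd_ext (es m) x = es m x"
proof -
  define n where "n = \<lfloor>x / 2\<rfloor>"
  define y where "y = x - 2 * of_int n"
  have y: "0 \<le> y" "y < 2" unfolding y_def n_def by linarith+
  have per: "sin (real m * pi * x) = sin (real m * pi * y)"
  proof -
    have "real m * pi * x = real m * pi * y + 2 * pi * of_int (int m * n)" by (simp add: y_def algebra_simps)
    then have "sin (real m * pi * x) = sin (real m * pi * y) * 1 + cos (real m * pi * y) * 0"
      by (simp only: sin_add sin_int_2pin cos_int_2pin)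
    then show ?thesis by simp
  qed
  have reflect: "sin (real m * pi * (2 - y)) = - sin (real m * pi * y)"
  proof -
    have "real m * pi * (2 - y) = 2 * pi * of_int (int m) - real m * pi * y" by (simp add: algebra_simps)
    then show ?thesis by (simp only: sin_diff sin_int_2pin cos_int_2pin)
  qed
  have z: "sin (real m * pi * y) = 0" if "y = 0 \<or> y = 1" using that by auto
  show ?thesis
    unfolding odd_ext_def Let_def n_def[symmetric] y_def[symmetric] es_def per
    using y reflect z by auto
qed

text \<open>Clear for sine polynomials, since \<open>es i\<close> at k x is
  \<open>es (k * i)\<close> at x; both sides are continuous in L2 because dilation is isometric, so
  density finishes.\<close>

lemma sine_coeff_dilate:
  assumes \<phi>: "L2 \<phi>" and k: "k > 0"
  shows "sine_coeff (\<lambda>x. odd_ext \<phi> (real k * x)) n = dil k (sine_coeff \<phi>) n"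
proof -
  let ?T = "\<lambda>f x. odd_ext f (real k * x)"
  have "(norm (sine_coeff (?T \<phi>) n - dil k (sine_coeff \<phi>) n))\<^sup>2 \<le> 0 + e" if e: "e > 0" for e
  proof -
    have "e / 4 > 0" using e by simp
    then obtain s where s: "s \<in> sinepoly" "NN (\<lambda>x. \<phi> x - s x) < e / 4" using sdense_L2[OF \<phi>] unfolding sdense_def by blast
    obtain M b where b: "\<And>x. s x = (\<Sum>m=1..M. b m * es m x)" using sinepoly_explicit[OF s(1)] by blast
    have sL: "L2 s" by (rule sinepoly_L2[OF s(1)])
    have sc: "sine_coeff s m = (if m \<in> {1..M} then b m else 0)" for m
    proof -
      have "sine_coeff s m = (\<Sum>i=1..M. b i * sine_coeff (es i) m)"
        unfolding b[abs_def] by (rule sine_coeff_sum) (auto intro: L2_es)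
      also have "\<dots> = (\<Sum>i=1..M. if i = m then b i else 0)" by (intro sum.cong) (auto simp: sine_coeff_basis)
      finally show ?thesis by simp
    qed
    have "?T s = (\<lambda>x. \<Sum>i=1..M. b i * es (k * i) x)"
    proof
      fix x
      have "?T s x = (\<Sum>i=1..M. b i * odd_ext (es i) (real k * x))" unfolding b[abs_def] by (rule odd_ext_lincomb)
      also have "\<dots> = (\<Sum>i=1..M. b i * es (k * i) x)" by (intro sum.cong) (auto simp: odd_ext_es es_def mult_ac)
      finally show "?T s x = (\<Sum>i=1..M. b i * es (k * i) x)" .
    qed
    then have "sine_coeff (?T s) n = (\<Sum>i=1..M. b i * sine_coeff (es (k * i)) n)"
      by (simp only:) (rule sine_coeff_sum, auto intro: L2_es)
    also have "\<dots> = (\<Sum>i=1..M. if k * i = n then b i else 0)" using k by (intro sum.cong) (auto simp: sine_coeff_basis)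
    also have "\<dots> = dil k (sine_coeff s) n"
    proof (cases "k dvd n")
      case True
      then obtain m where m: "n = k * m" by auto
      have "(\<Sum>i=1..M. if k * i = n then b i else 0) = (\<Sum>i=1..M. if i = m then b i else 0)"
        using k by (intro sum.cong) (auto simp: m)
      then show ?thesis using k by (simp add: dil_def m sc)
    next
      case False
      then have "(\<Sum>i=1..M. if k * i = n then b i else 0) = 0" by (intro sum.neutral) auto
      then show ?thesis using False by (simp add: dil_def)
    qed
    finally have Ts: "sine_coeff (?T s) n = dil k (sine_coeff s) n" .
    have d: "L2 (\<lambda>x. \<phi> x - s x)" by (rule L2_diff[OF \<phi> sL])
    have 1: "(norm (sine_coeff (?T \<phi>) n - sine_coeff (?T s) n))\<^sup>2 \<le> NN (\<lambda>x. \<phi> x - s x)"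
      using sine_coeff_le[OF L2_dilate(1)[OF d k], of n] L2_dilate(2)[OF d k]
      unfolding odd_ext_diff by (simp add: sine_coeff_diff L2_dilate \<phi> sL k)
    have 2: "(norm (dil k (sine_coeff s) n - dil k (sine_coeff \<phi>) n))\<^sup>2 \<le> NN (\<lambda>x. \<phi> x - s x)"
      using sine_coeff_le[OF d, of "n div k"] NN_nonneg[of "\<lambda>x. \<phi> x - s x"]
      by (auto simp: dil_def sine_coeff_diff[OF \<phi> sL] norm_minus_commute)
    have "(norm (sine_coeff (?T \<phi>) n - dil k (sine_coeff \<phi>) n))\<^sup>2 \<le>
        2 * (norm (sine_coeff (?T \<phi>) n - sine_coeff (?T s) n))\<^sup>2 + 2 * (norm (dil k (sine_coeff s) n - dil k (sine_coeff \<phi>) n))\<^sup>2"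
      using sq_norm_add_le[of "sine_coeff (?T \<phi>) n - sine_coeff (?T s) n" "dil k (sine_coeff s) n - dil k (sine_coeff \<phi>) n"]
      by (simp add: Ts)
    then show ?thesis using 1 2 s(2) by simp
  qed
  then have "(norm (sine_coeff (?T \<phi>) n - dil k (sine_coeff \<phi>) n))\<^sup>2 \<le> 0" by (rule field_le_epsilon)
  then show ?thesis by simp
qed

text \<open>Makes the errors in \<open>dilation_complete\<close> and in \<open>dclosure\<close> the
  same number.\<close>

lemma parseval_dilations:
  assumes f: "L2 f" and \<phi>: "L2 \<phi>"
  shows "((\<lambda>n. (norm (sine_coeff f n - (\<Sum>k=1..N. c k * dil k (sine_coeff \<phi>) n)))\<^sup>2) has_sum
     (\<integral>x. (norm (f x - (\<Sum>k=1..N. c k * odd_ext \<phi> (real k * x))))\<^sup>2 \<partial>M01)) UNIV"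
proof -
  have L: "L2 (\<lambda>x. odd_ext \<phi> (real k * x))" if "k \<in> {1..N}" for k using that by (intro L2_dilate \<phi>) auto
  have S: "L2 (\<lambda>x. \<Sum>k=1..N. c k * odd_ext \<phi> (real k * x))" by (intro L2_sum L2_scale L) auto
  have "sine_coeff (\<lambda>x. f x - (\<Sum>k=1..N. c k * odd_ext \<phi> (real k * x))) n =
     sine_coeff f n - (\<Sum>k=1..N. c k * dil k (sine_coeff \<phi>) n)" for n
    unfolding sine_coeff_diff[OF f S] using L sine_coeff_sum[of "{1..N}" "\<lambda>k x. odd_ext \<phi> (real k * x)" c n]
    by (simp add: sine_coeff_dilate[OF \<phi>])
  then show ?thesis using parseval[OF L2_diff[OF f S]] by (simp add: NN_def)
qed

text \<open>Dilates of the unit sequence are the coefficient sequences of the functions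
  \<open>es m\<close>, so with it the closure contains the coefficients of every sine polynomial,
  and these are dense.\<close>

theorem dilation_complete_if_dclosure:
  assumes \<phi>: "L2 \<phi>" and cl: "dclosure (sine_coeff \<phi>) (\<lambda>n. if n = 1 then 1 else 0)"
  shows "dilation_complete \<phi>"
  unfolding dilation_complete_def
proof (intro conjI allI impI \<phi>)
  fix f :: "real \<Rightarrow> complex" and e :: real assume f: "L2 f" and e: "e > 0"
  let ?\<delta> = "\<lambda>n::nat. if n = 1 then 1 else (0::complex)"
  have e4: "e / 4 > 0" using e by simp
  obtain s where s: "s \<in> sinepoly" "NN (\<lambda>x. f x - s x) < e / 4" using sdense_L2[OF f] e4 unfolding sdense_def by blast
  have sL: "L2 s" by (rule sinepoly_L2[OF s(1)])
  have "sine_coeff s \<in> dspan ?\<delta>"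
    using s(1)
  proof (induction rule: sinepoly.induct)
    case zero
    have "sine_coeff (\<lambda>_. 0) = (\<lambda>_. 0)" by (auto simp: sine_coeff_es)
    then show ?case by (simp add: dspan.zero)
  next
    case (step s b m)
    show ?case
    proof (cases "m = 0")
      case False
      have "dil m ?\<delta> n = sine_coeff (es m) n" for n
        using False by (auto simp: dil_def sine_coeff_basis dvd_def)
      then have "sine_coeff (\<lambda>x. s x + b * es m x) = (\<lambda>n. sine_coeff s n + b * dil m ?\<delta> n)"
        using sine_coeff_add_scale[OF sinepoly_L2[OF step(1)] L2_es] by auto
      then show ?thesis using dspan.step[OF step(2), of m b] False by simp
    qed (use step in simp)
  qed
  then have "dclosure (sine_coeff \<phi>) (sine_coeff s)" using cl by (rule dclosure_dspan)
  then obtain x where x: "x \<in> dspan (sine_coeff \<phi>)" "nsq (\<lambda>n. sine_coeff s n - x n) < e / 4"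
    using e4 unfolding dclosure_def by blast
  obtain N c where c: "\<And>n. x n = (\<Sum>k=1..N. c k * dil k (sine_coeff \<phi>) n)" using dspan_explicit[OF x(1)] by blast
  let ?D = "\<lambda>x. \<Sum>k=1..N. c k * odd_ext \<phi> (real k * x)"
  have D: "L2 ?D" by (intro L2_sum L2_scale L2_dilate \<phi>) auto
  have "NN (\<lambda>x. s x - ?D x) = nsq (\<lambda>n. sine_coeff s n - x n)"
    unfolding nsq_def c NN_def using infsumI[OF parseval_dilations[OF sL \<phi>, of c N]] by simp
  then have "NN (\<lambda>x. (f x - s x) + (s x - ?D x)) < e"
    using L2_add(2)[OF L2_diff[OF f sL] L2_diff[OF sL D]] x(2) s(2) by simp
  then show "\<exists>N c. (\<integral>x. (norm (f x - (\<Sum>k=1..N. c k * odd_ext \<phi> (real k * x))))\<^sup>2 \<partial>M01) < e"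
    unfolding NN_def by (intro exI[of _ N] exI[of _ c]) simp
qed

subsection \<open>Evaluation of the Bohr lift\<close>

lemma infinite_primes: "infinite {p::nat. prime p}"
  by (rule primes_infinite)

lemma prime_nth_prime: "prime (nth_prime j)"
  using enumerate_in_set[OF infinite_primes, of j] by (simp add: nth_prime_def)

lemma inj_nth_prime: "inj nth_prime"
  unfolding nth_prime_def[abs_def] using strict_mono_enumerate[OF infinite_primes] by (rule strict_mono_imp_inj_on)

lemma ex_nth_prime: "prime p \<Longrightarrow> \<exists>j. nth_prime j = p"
  using enumerate_Ex[of "{p. prime p}" p] infinite_primes by (auto simp: nth_prime_def)

definition pidx :: "nat \<Rightarrow> nat" where "pidx = inv_into UNIV nth_prime"

lemma pidx_nth_prime [simp]: "pidx (nth_prime j) = j"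
  unfolding pidx_def using inj_nth_prime by (rule inv_into_f_f) simp

lemma nth_prime_pidx: "prime p \<Longrightarrow> nth_prime (pidx p) = p"
  using ex_nth_prime[of p] by (auto simp: pidx_def intro: f_inv_into_f)

lemma monom_at_cmf:
  assumes n: "n > 0"
  shows "monom_at z n = cmf (\<lambda>p. z (pidx p)) n"
proof -
  have "cmf (\<lambda>p. z (pidx p)) n = (\<Prod>p\<in>prime_factors n. z (pidx p) ^ count (prime_factorization n) p)"
    unfolding cmf_def by (rule image_prod_mset_multiplicity)
  also have "prime_factors n = nth_prime ` {j. nth_prime j dvd n}"
  proof
    show "prime_factors n \<subseteq> nth_prime ` {j. nth_prime j dvd n}"
    proof
      fix p assume "p \<in> prime_factors n"
      then have p: "prime p" "p dvd n" by (auto simp: in_prime_factors_iff)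
      then have "p = nth_prime (pidx p)" by (simp add: nth_prime_pidx)
      then show "p \<in> nth_prime ` {j. nth_prime j dvd n}" using p by (intro image_eqI[of _ _ "pidx p"]) auto
    qed
    show "nth_prime ` {j. nth_prime j dvd n} \<subseteq> prime_factors n"
      using n by (auto simp: in_prime_factors_iff prime_nth_prime)
  qed
  also have "(\<Prod>p\<in>nth_prime ` {j. nth_prime j dvd n}. z (pidx p) ^ count (prime_factorization n) p) =
     (\<Prod>j\<in>{j. nth_prime j dvd n}. z j ^ count (prime_factorization n) (nth_prime j))"
    by (subst prod.reindex) (auto intro: inj_on_subset[OF inj_nth_prime])
  also have "\<dots> = monom_at z n"
    unfolding monom_at_def by (intro prod.cong refl) (simp add: count_prime_factorization_prime prime_nth_prime)
  finally show ?thesis by simp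
qed

lemma infsum_cmf_euler:
  fixes h :: "nat \<Rightarrow> real"
  assumes "finite T" "\<And>p. p \<in> T \<Longrightarrow> prime p \<and> 0 \<le> h p \<and> h p < 1"
  shows "(\<Sum>\<^sub>\<infinity>n\<in>pos. cmf (\<lambda>p. if p \<in> T then h p else 0) n) = (\<Prod>p\<in>T. 1 / (1 - h p))"
  using assms
proof (induction T rule: finite_induct)
  case empty
  have "dsum (\<lambda>_. 1) (\<lambda>_. 0::real) 1 = 1" by (rule dsum_zero)
  then show ?case by (simp add: dsum_def)
next
  case (insert p T)
  let ?g = "\<lambda>T p. if p \<in> T then h p else 0"
  have D: "(\<Sum>\<^sub>\<infinity>n\<in>pos. cmf (?g T) n) = dsum (\<lambda>_. 1) (?g T) k" for T k by (simp add: dsum_def)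
  have cg: "csum (?g T)" by (rule csum_finite) (use insert in \<open>auto intro: finite_subset[of _ T]\<close>)
  have p: "prime p" "0 \<le> h p" "h p < 1" using insert.prems by auto
  have up: "?g (insert p T) = (?g T)(p := h p)" by auto
  have "dsum (\<lambda>_. 1) ((?g T)(p := h p)) 1 = dsum (\<lambda>_. 1) (?g T) 1 + h p * dsum (\<lambda>_. 1) ((?g T)(p := h p)) (p * 1)"
    by (rule dsum_upd[where B = 1, OF p(1) cg]) (use p insert in auto)
  then have "(\<Sum>\<^sub>\<infinity>n\<in>pos. cmf (?g (insert p T)) n) = (\<Sum>\<^sub>\<infinity>n\<in>pos. cmf (?g T) n) + h p * (\<Sum>\<^sub>\<infinity>n\<in>pos. cmf (?g (insert p T)) n)"
    unfolding up[symmetric] D[symmetric] .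
  moreover have "d = d0 * (1 / (1 - y))" if "d = d0 + y * d" "y < 1" for d d0 y :: real
  proof -
    have "d - y * d = d0" using that(1) by (metis add_diff_cancel_right')
    then have "d * (1 - y) = d0" by (simp add: right_diff_distrib mult.commute)
    then show ?thesis using that(2) by auto
  qed
  ultimately have "(\<Sum>\<^sub>\<infinity>n\<in>pos. cmf (?g (insert p T)) n) = (\<Sum>\<^sub>\<infinity>n\<in>pos. cmf (?g T) n) * (1 / (1 - h p))" using p(3) by blast
  also have "(\<Sum>\<^sub>\<infinity>n\<in>pos. cmf (?g T) n) = (\<Prod>p\<in>T. 1 / (1 - h p))" using insert by auto
  finally show ?case using insert by simp
qed

text \<open>Partial sums are dominated by finite Euler products, each factor 1 / (1 - h) being at
  most exp (h / (1 - \<rho>)); the common bound \<rho> < 1 exists because the \<open>z j\<close>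
  tend to 0. Applied to squared moduli, it makes the monomials square-summable on
  \<open>D2inf\<close>.\<close>

lemma csum_infinite:
  fixes z :: "nat \<Rightarrow> real"
  assumes z: "\<And>j. 0 \<le> z j" "\<And>j. z j < 1" and sm: "summable z"
  shows "csum (\<lambda>p. z (pidx p))"
proof -
  obtain J where J: "\<And>j. j \<ge> J \<Longrightarrow> z j < 1/2"
    using order_tendstoD(2)[OF summable_LIMSEQ_zero[OF sm], of "1/2"] by (auto simp: eventually_sequentially)
  define \<rho> where "\<rho> = Max (insert (1/2) (z ` {..<J}))"
  have \<rho>1: "\<rho> < 1" unfolding \<rho>_def using z by (subst Max_less_iff) auto
  have \<rho>: "z j \<le> \<rho>" for j
  proof (cases "j < J")
    case True
    then show ?thesis unfolding \<rho>_def by (intro Max_ge) auto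
  next
    case False
    then have "z j \<le> 1/2" using J[of j] by simp
    also have "1/2 \<le> \<rho>" unfolding \<rho>_def by (intro Max_ge) auto
    finally show ?thesis .
  qed
  define h where "h = (\<lambda>p. z (pidx p))"
  have fac: "1 / (1 - h p) \<le> exp (h p / (1 - \<rho>))" for p
  proof -
    have h: "0 \<le> h p" "h p \<le> \<rho>" "h p < 1" using z \<rho> by (auto simp: h_def)
    have "1 / (1 - h p) = 1 + h p / (1 - h p)" using h by (simp add: field_simps)
    also have "\<dots> \<le> 1 + h p / (1 - \<rho>)" using h \<rho>1 by (intro add_left_mono divide_left_mono mult_pos_pos) auto
    also have "\<dots> \<le> exp (h p / (1 - \<rho>))" by (rule exp_ge_add_one_self)
    finally show ?thesis .
  qed
  have "(\<lambda>n. cmf h n) summable_on pos"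
  proof (rule nonneg_bdd_above_summable_on)
    show "0 \<le> cmf h n" for n by (rule cmf_nonneg) (simp add: h_def z)
    show "bdd_above (sum (cmf h) ` {F. F \<subseteq> pos \<and> finite F})"
    proof (rule bdd_aboveI2)
      fix F assume F: "F \<in> {F. F \<subseteq> pos \<and> finite F}"
      define T where "T = {p\<in>{..Max (insert 0 F)}. prime p}"
      have T: "finite T" "\<And>p. p \<in> T \<Longrightarrow> prime p \<and> 0 \<le> h p \<and> h p < 1" by (auto simp: T_def h_def z)
      let ?g = "\<lambda>p. if p \<in> T then h p else 0"
      have cg: "csum ?g" by (rule csum_finite) (use T in \<open>auto intro: finite_subset[of _ T]\<close>)
      have nn: "cmf ?g n \<ge> 0" for n by (rule cmf_nonneg) (auto simp: T)
      have "sum (cmf h) F = sum (cmf ?g) F"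
      proof (rule sum.cong[OF refl])
        fix n assume n: "n \<in> F"
        then have n0: "n > 0" using F by auto
        show "cmf h n = cmf ?g n"
        proof (rule cmf_cong[OF n0])
          fix p assume p: "prime p" "p dvd n"
          have "p \<le> n" using p(2) n0 by (rule dvd_imp_le)
          also have "n \<le> Max (insert 0 F)" using n F by (intro Max_ge) auto
          finally show "h p = ?g p" using p by (simp add: T_def)
        qed
      qed
      also have "\<dots> \<le> (\<Sum>\<^sub>\<infinity>n\<in>pos. cmf ?g n)"
        using cg nn F by (intro finite_sum_le_infsum) (auto simp: csum_def)
      also have "\<dots> = (\<Prod>p\<in>T. 1 / (1 - h p))" by (rule infsum_cmf_euler[OF T])
      also have "\<dots> \<le> (\<Prod>p\<in>T. exp (h p / (1 - \<rho>)))" using T fac by (intro prod_mono) (force simp: less_imp_le)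
      also have "\<dots> = exp ((\<Sum>p\<in>T. h p) / (1 - \<rho>))" by (simp add: exp_sum[OF T(1)] sum_divide_distrib)
      also have "(\<Sum>p\<in>T. h p) = (\<Sum>j\<in>pidx ` T. z j)"
      proof -
        have "inj_on pidx T" by (rule inj_onI) (metis T(2) nth_prime_pidx)
        then show ?thesis by (simp add: sum.reindex h_def)
      qed
      also have "\<dots> \<le> suminf z" using T z by (intro sum_le_suminf sm) auto
      finally show "sum (cmf h) F \<le> exp (suminf z / (1 - \<rho>))" using \<rho>1 by (simp add: divide_right_mono)
    qed
  qed
  then show ?thesis unfolding csum_def h_def[symmetric] using cmf_nonneg[of h] z by (simp add: h_def)
qed

lemma infsum_pos_eq_suminf:
  fixes h :: "nat \<Rightarrow> complex"
  assumes "(\<lambda>n. norm (h n)) summable_on pos"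
  shows "(\<Sum>n. h (Suc n)) = (\<Sum>\<^sub>\<infinity>n\<in>pos. h n)"
proof -
  have bij: "bij_betw Suc UNIV pos"
    by (rule bij_betw_byWitness[where f' = "\<lambda>n. n - 1"]) auto
  have "(h has_sum (\<Sum>\<^sub>\<infinity>n\<in>pos. h n)) pos" by (rule has_sum_infsum[OF abs_summable_summable[OF assms]])
  then have "((\<lambda>n. h (Suc n)) has_sum (\<Sum>\<^sub>\<infinity>n\<in>pos. h n)) UNIV" by (subst has_sum_reindex_bij_betw[OF bij])
  then show ?thesis by (intro sums_unique[symmetric] has_sum_imp_sums)
qed

lemma has_sum_sum:
  fixes h :: "'i \<Rightarrow> 'j \<Rightarrow> 'a::{topological_comm_monoid_add}"
  assumes "finite I" "\<And>i. i \<in> I \<Longrightarrow> (h i has_sum S i) A"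
  shows "((\<lambda>x. \<Sum>i\<in>I. h i x) has_sum (\<Sum>i\<in>I. S i)) A"
  using assms by (induction I rule: finite_induct) (auto intro: has_sum_add)

text \<open>Evaluation at \<open>z\<close> pairs a sequence with the square-summable
  \<open>w\<close>, hence is bounded on l2. If it vanishes on the coefficients of \<phi>, it
  vanishes on all dilates because w (k n) = w k w n; but it equals 1 on \<open>es 1\<close>, which
  then cannot be approximated.\<close>

theorem Bohr_lift_nonzero_if_complete:
  assumes comp: "dilation_complete \<phi>" and z: "z \<in> D2inf"
  shows "Bohr_lift \<phi> z \<noteq> 0"
proof
  assume zero: "Bohr_lift \<phi> z = 0"
  have \<phi>: "L2 \<phi>" using comp by (simp add: dilation_complete_def)
  define a where "a = sine_coeff \<phi>"
  define w where "w = cmf (\<lambda>p. z (pidx p))"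
  have "csum (\<lambda>p. (norm (z (pidx p)))\<^sup>2)"
    using z by (intro csum_infinite) (auto simp: D2inf_def power_less_one_iff)
  then have "(\<lambda>n. norm (cmf (\<lambda>p. (norm (z (pidx p)))\<^sup>2) n)) summable_on pos" unfolding csum_def .
  moreover have "norm (cmf (\<lambda>p. (norm (z (pidx p)))\<^sup>2) n) = (norm (w n))\<^sup>2" for n
    by (simp add: w_def power2_eq_square cmf_mult_fun norm_cmf abs_mult)
  ultimately have wsq: "(\<lambda>n. (norm (w n))\<^sup>2) summable_on pos" by simp
  define C where "C = (\<Sum>\<^sub>\<infinity>n\<in>pos. (norm (w n))\<^sup>2)"
  have C0: "C \<ge> 0" unfolding C_def by (rule infsum_nonneg) auto
  have cs: "(\<lambda>n. norm (x n * w n)) summable_on pos" if x: "(\<lambda>n. (norm (x n))\<^sup>2) summable_on pos" for x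
  proof (rule summable_on_comparison_test[OF summable_on_add[OF x wsq]])
    fix n
    have "2 * (norm (x n) * norm (w n)) \<le> (norm (x n))\<^sup>2 + (norm (w n))\<^sup>2"
      using sum_squares_bound[of "norm (x n)" "norm (w n)"] by simp
    moreover have "norm (x n) * norm (w n) \<ge> 0" by simp
    ultimately show "norm (x n * w n) \<le> (norm (x n))\<^sup>2 + (norm (w n))\<^sup>2" unfolding norm_mult by linarith
  qed auto
  have asq: "(\<lambda>n. (norm (a n))\<^sup>2) summable_on pos"
    using parseval[OF \<phi>] unfolding a_def by (rule summable_on_subset_banach[OF has_sum_imp_summable]) auto
  have "Bohr_lift \<phi> z = (\<Sum>n. a (Suc n) * w (Suc n))"
    by (simp add: Bohr_lift_def a_def w_def monom_at_cmf)
  also have "\<dots> = (\<Sum>\<^sub>\<infinity>n\<in>pos. a n * w n)" by (rule infsum_pos_eq_suminf[OF cs[OF asq]])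
  finally have aw: "(\<Sum>\<^sub>\<infinity>n\<in>pos. a n * w n) = 0" using zero by simp
  have dw: "(\<Sum>\<^sub>\<infinity>n\<in>pos. dil k a n * w n) = 0" "(\<lambda>n. dil k a n * w n) summable_on pos" if k: "k > 0" for k
  proof -
    have inj: "inj_on ((*) k) pos" using k by (auto simp: inj_on_def)
    have comp: "(\<lambda>n. dil k a n * w n) \<circ> (*) k = (\<lambda>n. dil k a (k * n) * w (k * n))" by auto
    have ev: "dil k a (k * n) * w (k * n) = w k * (a n * w n)" if "n \<in> pos" for n
      using k that by (simp add: dil_def w_def cmf_mult)
    have "(\<Sum>\<^sub>\<infinity>n\<in>pos. dil k a n * w n) = infsum (\<lambda>n. dil k a n * w n) ((*) k ` pos)"
      using k by (intro infsum_cong_neutral) (auto simp: dil_def dvd_def)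
    also have "\<dots> = (\<Sum>\<^sub>\<infinity>n\<in>pos. w k * (a n * w n))"
      unfolding infsum_reindex[OF inj] comp by (rule infsum_cong) (rule ev)
    finally show "(\<Sum>\<^sub>\<infinity>n\<in>pos. dil k a n * w n) = 0" by (simp add: infsum_cmult_right' aw)
    have "(\<lambda>n. w k * (a n * w n)) summable_on pos"
      using abs_summable_summable[OF cs[OF asq]] by (rule summable_on_cmult_right)
    also have "?this \<longleftrightarrow> (\<lambda>n. dil k a n * w n) summable_on ((*) k ` pos)"
      unfolding summable_on_reindex[OF inj] comp by (rule summable_on_cong) (rule ev[symmetric])
    also have "\<dots> \<longleftrightarrow> (\<lambda>n. dil k a n * w n) summable_on pos"
      using k by (intro summable_on_cong_neutral) (auto simp: dil_def dvd_def)
    finally show "(\<lambda>n. dil k a n * w n) summable_on pos" .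
  qed
  define e where "e = 1 / (C + 1)"
  have e: "e > 0" using C0 by (simp add: e_def)
  then obtain N c where Nc: "(\<integral>x. (norm (es 1 x - (\<Sum>k=1..N. c k * odd_ext \<phi> (real k * x))))\<^sup>2 \<partial>M01) < e"
    using comp L2_es[of 1] unfolding dilation_complete_def by blast
  define d where "d = (\<lambda>n. sine_coeff (es 1) n - (\<Sum>k=1..N. c k * dil k a n))"
  have dsum: "((\<lambda>n. (norm (d n))\<^sup>2) has_sum (\<integral>x. (norm (es 1 x - (\<Sum>k=1..N. c k * odd_ext \<phi> (real k * x))))\<^sup>2 \<partial>M01)) UNIV"
    unfolding d_def a_def by (rule parseval_dilations[OF L2_es \<phi>])
  have dsq: "(\<lambda>n. (norm (d n))\<^sup>2) summable_on UNIV" using dsum by (rule has_sum_imp_summable)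
  then have dsqp: "(\<lambda>n. (norm (d n))\<^sup>2) summable_on pos" by (rule summable_on_subset_banach) simp
  have dle: "(\<Sum>\<^sub>\<infinity>n\<in>pos. (norm (d n))\<^sup>2) < e"
  proof -
    have "(\<Sum>\<^sub>\<infinity>n\<in>pos. (norm (d n))\<^sup>2) \<le> (\<Sum>\<^sub>\<infinity>n. (norm (d n))\<^sup>2)"
      by (rule infsum_mono_neutral[OF dsqp dsq]) auto
    then show ?thesis using infsumI[OF dsum] Nc by simp
  qed
  have one: "(\<Sum>\<^sub>\<infinity>n\<in>pos. d n * w n) = 1"
  proof -
    have h1: "((\<lambda>n. sine_coeff (es 1) n * w n) has_sum 1) pos"
    proof -
      have "((\<lambda>n. sine_coeff (es 1) n * w n) has_sum (\<Sum>n\<in>{1}. sine_coeff (es 1) n * w n)) {1}" by (rule has_sum_finite) simp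
      also have "?this \<longleftrightarrow> ((\<lambda>n. sine_coeff (es 1) n * w n) has_sum 1) pos"
      proof -
        have "(\<Sum>n\<in>{1}. sine_coeff (es 1) n * w n) = 1" by (simp add: sine_coeff_basis w_def)
        then show ?thesis by (simp only:) (rule has_sum_cong_neutral, auto simp: sine_coeff_basis)
      qed
      finally show ?thesis .
    qed
    have h2: "((\<lambda>n. \<Sum>k\<in>{1..N}. c k * (dil k a n * w n)) has_sum (\<Sum>k\<in>{1..N}. c k * 0)) pos"
    proof (rule has_sum_sum[OF finite_atLeastAtMost])
      fix k assume "k \<in> {1..N}"
      then have "((\<lambda>n. dil k a n * w n) has_sum 0) pos" using dw[of k] by (auto simp: has_sum_iff)
      then show "((\<lambda>n. c k * (dil k a n * w n)) has_sum c k * 0) pos" by (rule has_sum_cmult_right)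
    qed
    have "((\<lambda>n. sine_coeff (es 1) n * w n + (- 1) * (\<Sum>k\<in>{1..N}. c k * (dil k a n * w n))) has_sum 1 + (- 1) * (\<Sum>k\<in>{1..N}. c k * 0)) pos"
      by (intro has_sum_add h1 has_sum_cmult_right h2)
    moreover have "sine_coeff (es 1) n * w n + (- 1) * (\<Sum>k\<in>{1..N}. c k * (dil k a n * w n)) = d n * w n" for n
      by (simp add: d_def left_diff_distrib sum_distrib_right mult.assoc)
    ultimately show ?thesis by (simp add: infsumI)
  qed
  \<comment> \<open>Weight in 2 x y \<le> l x^2 + y^2 / l. With e = 1 / (C + 1) and l = C + 1 the
    two parts are at most 1/2 and below 1/2, against the value 1.\<close>
  define l where "l = C + 1"
  have l: "l > 0" using C0 by (simp add: l_def)
  have bnd: "norm (d n * w n) \<le> l / 2 * (norm (d n))\<^sup>2 + 1 / (2 * l) * (norm (w n))\<^sup>2" for n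
  proof -
    have "0 \<le> (l * norm (d n) - norm (w n))\<^sup>2" by simp
    then have "2 * l * (norm (d n) * norm (w n)) \<le> l * l * (norm (d n))\<^sup>2 + (norm (w n))\<^sup>2"
      by (simp add: power2_eq_square algebra_simps)
    then have "norm (d n) * norm (w n) \<le> (l * l * (norm (d n))\<^sup>2 + (norm (w n))\<^sup>2) / (2 * l)"
      using l by (simp add: field_simps)
    also have "\<dots> = l / 2 * (norm (d n))\<^sup>2 + 1 / (2 * l) * (norm (w n))\<^sup>2" using l by (simp add: field_simps)
    finally show ?thesis by (simp add: norm_mult)
  qed
  have sm: "(\<lambda>n. l / 2 * (norm (d n))\<^sup>2 + 1 / (2 * l) * (norm (w n))\<^sup>2) summable_on pos"
    by (intro summable_on_add summable_on_cmult_right dsqp wsq)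
  have "1 = norm (\<Sum>\<^sub>\<infinity>n\<in>pos. d n * w n)" using one by simp
  also have "\<dots> \<le> (\<Sum>\<^sub>\<infinity>n\<in>pos. norm (d n * w n))" by (rule norm_infsum_bound[OF cs[OF dsqp]])
  also have "\<dots> \<le> (\<Sum>\<^sub>\<infinity>n\<in>pos. l / 2 * (norm (d n))\<^sup>2 + 1 / (2 * l) * (norm (w n))\<^sup>2)"
    by (rule infsum_mono[OF cs[OF dsqp] sm bnd])
  also have "\<dots> = l / 2 * (\<Sum>\<^sub>\<infinity>n\<in>pos. (norm (d n))\<^sup>2) + 1 / (2 * l) * C"
    unfolding C_def infsum_add[OF summable_on_cmult_right[OF dsqp] summable_on_cmult_right[OF wsq]] infsum_cmult_right' ..
  also have "\<dots> \<le> l / 2 * e + 1 / (2 * l) * C" using dle l by (intro add_right_mono mult_left_mono) auto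
  also have "\<dots> < 1 / 2 + 1 / 2"
  proof (rule add_le_less_mono)
    show "l / 2 * e \<le> 1 / 2" using l by (simp add: e_def l_def)
    show "1 / (2 * l) * C < 1 / 2" using l by (simp add: l_def field_simps)
  qed
  finally show False by simp
qed

subsection \<open>Step functions with rational jumps\<close>

lemma common_denominator:
  assumes "finite P" "P \<subseteq> \<rat>"
  shows "\<exists>N>0. \<forall>r\<in>P. \<exists>k::int. r * real N = of_int k"
  using assms
proof (induction P rule: finite_induct)
  case empty
  show ?case by (intro exI[of _ "1::nat"]) auto
next
  case (insert r P)
  then obtain N where N: "N > 0" "\<forall>r\<in>P. \<exists>k::int. r * real N = of_int k" by auto
  obtain a :: int and b :: nat where b: "b > 0" "r = of_int a / of_nat b"
    using insert.prems by (auto elim!: Rats_cases') (metis of_int_of_nat_eq zero_less_imp_eq_int)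
  have "\<exists>k::int. s * real (N * b) = of_int k" if s: "s \<in> insert r P" for s
  proof (cases "s = r")
    case True
    have "s * real (N * b) = of_int (a * int N)" using b True by simp
    then show ?thesis by blast
  next
    case False
    then obtain k :: int where "s * real N = of_int k" using N s by blast
    then have "s * real (N * b) = of_int (k * int b)" by (simp add: mult.assoc[symmetric])
    then show ?thesis by blast
  qed
  moreover have "N * b > 0" using N b by simp
  ultimately show ?case by blast
qed

text \<open>Over a common denominator N no jump lies inside an interval (i / N, (i + 1) / N), whose
  midpoint serves as sample; values at grid points stay arbitrary.\<close>

lemma step_rat_piecewise:
  assumes "step_rat \<phi>"
  shows "\<exists>N>0. \<exists>c. \<forall>i<N. \<forall>x. real i / real N < x \<longrightarrow> x < (real i + 1) / real N \<longrightarrow> \<phi> x = c i"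
proof -
  obtain P where P: "finite P" "P \<subseteq> \<rat>"
     "\<And>x y. 0 < x \<Longrightarrow> x < y \<Longrightarrow> y < 1 \<Longrightarrow> {x..y} \<inter> P = {} \<Longrightarrow> \<phi> x = \<phi> y"
    using assms unfolding step_rat_def by blast
  obtain N where N: "N > 0" "\<forall>r\<in>P. \<exists>k::int. r * real N = of_int k" using common_denominator[OF P(1,2)] by blast
  define c where "c = (\<lambda>i. \<phi> ((real i + 1/2) / real N))"
  have eq: "\<phi> x = \<phi> y" if i: "i < N" and x: "real i / real N < x" and xy: "x < y" and y: "y < (real i + 1) / real N" for i x y
  proof (rule P(3)[OF _ xy])
    show "0 < x" using x by (rule le_less_trans[rotated]) simp
    have "(real i + 1) / real N \<le> 1" using i N by simp
    then show "y < 1" using y by simp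
    show "{x..y} \<inter> P = {}"
    proof (rule ccontr)
      assume "{x..y} \<inter> P \<noteq> {}"
      then obtain r where r: "r \<in> P" "x \<le> r" "r \<le> y" by auto
      obtain k :: int where k: "r * real N = of_int k" using N r by blast
      have "real i / real N < r" "r < (real i + 1) / real N" using r x y by linarith+
      then have "real i < of_int k" "of_int k < real i + 1" using N k by (auto simp: field_simps)
      then have "real_of_int (int i) < of_int k" "of_int k < real_of_int (int i + 1)" by simp_all
      then have "int i < k" "k < int i + 1" unfolding of_int_less_iff .
      then show False by simp
    qed
  qed
  have "\<phi> x = c i" if "i < N" "real i / real N < x" "x < (real i + 1) / real N" for i x
  proof -
    define m where "m = (real i + 1/2) / real N"
    have m: "real i / real N < m" "m < (real i + 1) / real N" using N by (auto simp: m_def divide_strict_right_mono)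
    consider "x < m" | "x = m" | "m < x" by linarith
    then show ?thesis
    proof cases
      case 1
      then show ?thesis using eq[OF that(1,2) 1 m(2)] by (simp add: c_def m_def)
    next
      case 2
      then show ?thesis by (simp add: c_def m_def)
    next
      case 3
      then show ?thesis using eq[OF that(1) m(1) 3 that(3)] by (simp add: c_def m_def)
    qed
  qed
  then show ?thesis using N by blast
qed

text \<open>Integrating the sines piecewise gives sqrt 2 / (pi n) times a combination of cosines cos
  (n pi j / N), and these depend only on n modulo 2 N.\<close>

lemma step_rat_L2_periodic:
  assumes "step_rat \<phi>"
  shows "L2 \<phi> \<and> (\<exists>f N. periodic_seq f N \<and> (\<forall>n. sine_coeff \<phi> n = f n / of_nat n))"
proof -
  obtain N c where N: "N > 0" and c: "\<And>i x. i < N \<Longrightarrow> real i / real N < x \<Longrightarrow> x < (real i + 1) / real N \<Longrightarrow> \<phi> x = c i"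
    using step_rat_piecewise[OF assms] by blast
  define I where "I = (\<lambda>i. {real i / real N<..<(real i + 1) / real N})"
  \<comment> \<open>The grid points, where \<phi> may take any value; as a null set they allow
    \<psi> to replace \<phi> in the integrals.\<close>
  define X where "X = (\<lambda>i. real i / real N) ` {..N}"
  define \<psi> where "\<psi> = (\<lambda>x. \<Sum>i<N. indicator (I i) x *\<^sub>R c i)"
  have eq: "\<psi> x = \<phi> x" if x: "0 < x" "x < 1" "x \<notin> X" for x
  proof -
    define i where "i = nat \<lfloor>real N * x\<rfloor>"
    have "0 < real N * x" using N x by simp
    then have fl: "real i \<le> real N * x" "real N * x < real i + 1" unfolding i_def by linarith+
    have "real N * x < real N * 1" using N x by (intro mult_strict_left_mono) auto
    then have "real i < real N" using fl by linarith
    then have iN: "i < N" by simp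
    have "real N * x \<noteq> real i"
    proof
      assume "real N * x = real i"
      then have "x = real i / real N" using N by (simp add: field_simps)
      then show False using x(3) iN by (auto simp: X_def)
    qed
    then have xi: "real i / real N < x" "x < (real i + 1) / real N" using fl N by (auto simp: field_simps)
    have "\<psi> x = (\<Sum>j<N. if j = i then c i else 0)" unfolding \<psi>_def
    proof (rule sum.cong[OF refl])
      fix j
      have "x \<in> I j \<longleftrightarrow> j = i"
      proof
        assume "x \<in> I j"
        then have "real j < real N * x" "real N * x < real j + 1" using N by (auto simp: I_def field_simps)
        then have "real j < real i + 1" "real i < real j + 1" using fl by linarith+
        then show "j = i" by linarith
      qed (use xi in \<open>auto simp: I_def\<close>)
      then show "indicator (I j) x *\<^sub>R c j = (if j = i then c i else 0)" by (auto simp: indicator_def)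
    qed
    then show ?thesis using c[OF iN xi] iN by simp
  qed
  have X: "finite X" by (simp add: X_def)
  have mI: "I i \<in> sets borel" for i by (simp add: I_def)
  have \<psi>m: "\<psi> \<in> borel_measurable M01" unfolding \<psi>_def
    by (intro borel_measurable_M01 borel_measurable_sum borel_measurable_scaleR borel_measurable_indicator mI borel_measurable_const)
  have singl: "{x} \<in> sets M01" if "x \<in> X \<inter> {0<..<1}" for x
    using that unfolding M01_def by (auto simp: sets_restrict_space_iff)
  have null: "emeasure M01 {x} = 0" if "x \<in> X \<inter> {0<..<1}" for x
    using that unfolding M01_def by (subst emeasure_restrict_space) auto
  have cX: "countable (X \<inter> {0<..<1})" using X by (intro countable_finite) auto
  have \<phi>m: "\<phi> \<in> borel_measurable M01"
    by (rule measurable_discrete_difference[OF \<psi>m cX]) (use singl eq in auto)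
  \<comment> \<open>\<open>L2_bounded\<close> asks for a bound at every point, so the values at grid
    points enter too.\<close>
  define B where "B = (\<Sum>i<N. norm (c i)) + (\<Sum>x\<in>X. norm (\<phi> x))"
  have "norm (\<phi> x) \<le> B" if x: "0 < x" "x < 1" for x
  proof (cases "x \<in> X")
    case True
    have "norm (\<phi> x) \<le> (\<Sum>x\<in>X. norm (\<phi> x))" using True X by (intro member_le_sum) auto
    moreover have "(\<Sum>i<N. norm (c i)) \<ge> 0" by (rule sum_nonneg) auto
    ultimately show ?thesis by (simp add: B_def)
  next
    case False
    have "norm (\<phi> x) = norm (\<psi> x)" using eq x False by simp
    also have "\<dots> \<le> (\<Sum>i<N. norm (indicator (I i) x *\<^sub>R c i))" unfolding \<psi>_def by (rule norm_sum)
    also have "\<dots> \<le> (\<Sum>i<N. norm (c i))" by (intro sum_mono) (auto simp: indicator_def)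
    finally show ?thesis using sum_nonneg[of X "\<lambda>x. norm (\<phi> x)"] by (simp add: B_def)
  qed
  then have L2: "L2 \<phi>" by (rule L2_bounded[OF \<phi>m])
  define f where "f = (\<lambda>n. \<Sum>i<N. c i * complex_of_real (sqrt 2 / pi * (cos (real n * pi * (real i / real N)) - cos (real n * pi * ((real i + 1) / real N)))))"
  have coeff: "sine_coeff \<phi> n = f n / of_nat n" for n
  \<comment> \<open>At n = 0 both sides are 0, by the convention x / 0 = 0.\<close>
  proof (cases "n = 0")
    case False
    define F where "F = (\<lambda>x. complex_of_real (- sqrt 2 * cos (real n * pi * x) / (real n * pi)))"
    have dF: "(F has_vector_derivative es n x) (at x)" for x
    proof -
      have "((\<lambda>x. - sqrt 2 * cos (real n * pi * x) / (real n * pi)) has_real_derivative sqrt 2 * sin (real n * pi * x)) (at x)"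
        using False by (auto intro!: derivative_eq_intros simp: field_simps)
      then show ?thesis unfolding F_def es_def
        by (intro has_vector_derivative_of_real) (simp add: has_real_derivative_iff_has_vector_derivative)
    qed
    have ec: "continuous_on UNIV (es n)" unfolding es_def by (intro continuous_intros)
    have int: "integrable M01 (\<lambda>x. c i * (indicator (I i) x *\<^sub>R es n x))" for i
    proof (rule integrable_M01_bounded)
      have "es n \<in> borel_measurable borel" using ec by (rule borel_measurable_continuous_onI)
      then show "(\<lambda>x. c i * (indicator (I i) x *\<^sub>R es n x)) \<in> borel_measurable M01"
        by (intro borel_measurable_M01 borel_measurable_times borel_measurable_scaleR borel_measurable_indicator mI borel_measurable_const)
      show "norm (c i * (indicator (I i) x *\<^sub>R es n x)) \<le> norm (c i) * (sqrt 2 * 1)" for x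
        unfolding norm_mult norm_scaleR es_def norm_of_real
        by (intro mult_left_mono) (auto simp: indicator_def abs_mult intro!: mult_left_le)
    qed
    have "sine_coeff \<phi> n = (\<integral>x. \<psi> x * es n x \<partial>M01)"
      unfolding sine_coeff_es
      by (rule integral_discrete_difference[OF cX]) (use singl null eq in auto)
    also have "\<dots> = (\<integral>x. (\<Sum>i<N. c i * (indicator (I i) x *\<^sub>R es n x)) \<partial>M01)"
      by (intro Bochner_Integration.integral_cong) (simp_all add: \<psi>_def sum_distrib_right)
    also have "\<dots> = (\<Sum>i<N. \<integral>x. c i * (indicator (I i) x *\<^sub>R es n x) \<partial>M01)"
      by (rule Bochner_Integration.integral_sum[OF int])
    also have "\<dots> = (\<Sum>i<N. c i * (F ((real i + 1) / real N) - F (real i / real N)))"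
    proof (rule sum.cong[OF refl])
      fix i assume "i \<in> {..<N}"
      then have "(\<integral>x. indicator (I i) x *\<^sub>R es n x \<partial>M01) = F ((real i + 1) / real N) - F (real i / real N)"
        unfolding I_def using N by (intro interval_integral_M01 dF ec) (auto simp: divide_right_mono)
      then show "(\<integral>x. c i * (indicator (I i) x *\<^sub>R es n x) \<partial>M01) = c i * (F ((real i + 1) / real N) - F (real i / real N))"
        by (simp only: integral_mult_right_zero)
    qed
    also have "\<dots> = f n / of_nat n"
      unfolding f_def sum_divide_distrib
    proof (rule sum.cong[OF refl])
      fix i
      have "- sqrt 2 * u / (real n * pi) - - sqrt 2 * v / (real n * pi) = (sqrt 2 / pi * (v - u)) / real n" for u v
        using False by (simp add: field_simps)
      then have "F ((real i + 1) / real N) - F (real i / real N) =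
          complex_of_real ((sqrt 2 / pi * (cos (real n * pi * (real i / real N)) - cos (real n * pi * ((real i + 1) / real N)))) / real n)"
        unfolding F_def of_real_diff[symmetric] by (simp only:)
      then show "c i * (F ((real i + 1) / real N) - F (real i / real N)) = c i * complex_of_real (sqrt 2 / pi *
          (cos (real n * pi * (real i / real N)) - cos (real n * pi * ((real i + 1) / real N)))) / of_nat n"
        by (simp only: of_real_divide of_real_of_nat_eq times_divide_eq_right)
    qed
    finally show ?thesis .
  qed simp
  \<comment> \<open>The shift is 2 N and not N: adding N to n multiplies the j-th cosine by
    (-1)^j.\<close>
  have cosper: "cos (real (n + 2 * N) * pi * (real j / real N)) = cos (real n * pi * (real j / real N))" for n j
  proof -
    have "real (n + 2 * N) * pi * (real j / real N) = real n * pi * (real j / real N) + 2 * pi * of_int (int j)"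
      using N by (simp add: field_simps)
    then have "cos (real (n + 2 * N) * pi * (real j / real N)) = cos (real n * pi * (real j / real N)) * 1 - sin (real n * pi * (real j / real N)) * 0"
      by (simp only: cos_add cos_int_2pin sin_int_2pin)
    then show ?thesis by simp
  qed
  have "f (n + 2 * N) = f n" for n
    unfolding f_def using cosper[of n] cosper[of n "Suc i" for i]
    by (intro sum.cong refl) (metis (no_types, lifting) add.commute of_nat_Suc)
  then have "periodic_seq f (2 * N)" using N by unfold_locales auto
  then show ?thesis using L2 coeff by blast
qed

section \<open>Translation between the original notions and the periodic sequence\<close>

lemma D0inf_iff_adm:
  assumes "periodic_seq f N" and coeff: "\<And>n. sine_coeff \<phi> n = f n / of_nat n"
  shows "(\<forall>z\<in>D0inf. Bohr_lift \<phi> z \<noteq> 0) \<longleftrightarrow> (\<forall>g. adm g \<longrightarrow> dsum f g 1 \<noteq> 0)"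
proof -
  interpret periodic_seq f N by fact
  have link: "Bohr_lift \<phi> z = dsum f (\<lambda>p. z (pidx p) / of_nat p) 1" if g: "adm (\<lambda>p. z (pidx p) / of_nat p)" for z
  proof -
    let ?g = "\<lambda>p. z (pidx p) / of_nat p"
    have "Bohr_lift \<phi> z = (\<Sum>n. f (Suc n) * cmf ?g (Suc n))"
      unfolding Bohr_lift_def coeff by (intro suminf_cong) (simp add: monom_at_cmf cmf_div_of_nat)
    also have "\<dots> = (\<Sum>\<^sub>\<infinity>n\<in>pos. f n * cmf ?g n)"
      using dsum_abs_summable[where F=f and k=1, OF adm_csum[OF g] f_bound] by (intro infsum_pos_eq_suminf) simp
    finally show ?thesis by (simp add: dsum_def)
  qed
  show ?thesis
  proof
    assume a: "\<forall>z\<in>D0inf. Bohr_lift \<phi> z \<noteq> 0"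
    show "\<forall>g. adm g \<longrightarrow> dsum f g 1 \<noteq> 0"
    proof (intro allI impI)
      fix g assume g: "adm g"
      define z where "z = (\<lambda>j. g (nth_prime j) * of_nat (nth_prime j))"
      \<comment> \<open>Agreement is claimed only at primes, where \<open>pidx\<close> inverts
        \<open>nth_prime\<close>; neither \<open>adm\<close> nor \<open>cmf\<close> looks
        elsewhere.\<close>
      have gz: "z (pidx p) / of_nat p = g p" if "prime p" for p
        using that by (simp add: z_def nth_prime_pidx prime_gt_0_nat)
      have "{j. z j \<noteq> 0} \<subseteq> pidx ` {p. prime p \<and> g p \<noteq> 0}"
      proof
        fix j assume "j \<in> {j. z j \<noteq> 0}"
        then have "nth_prime j \<in> {p. prime p \<and> g p \<noteq> 0}" by (auto simp: z_def prime_nth_prime)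
        then show "j \<in> pidx ` {p. prime p \<and> g p \<noteq> 0}" by (intro image_eqI[of _ _ "nth_prime j"]) auto
      qed
      moreover have "finite (pidx ` {p. prime p \<and> g p \<noteq> 0})" using g by (simp add: adm_def)
      ultimately have fin: "finite {j. z j \<noteq> 0}" by (rule finite_subset)
      have "norm (z j) < 1" for j using g prime_nth_prime[of j] by (auto simp: z_def adm_def norm_mult)
      moreover have "summable (\<lambda>j. (norm (z j))\<^sup>2)" by (rule summable_finite[OF fin]) auto
      ultimately have "z \<in> D0inf" using fin by (auto simp: D0inf_def D2inf_def)
      then have nz: "Bohr_lift \<phi> z \<noteq> 0" using a by blast
      have "{p. prime p \<and> z (pidx p) / of_nat p \<noteq> 0} = {p. prime p \<and> g p \<noteq> 0}"
        by (auto simp: gz simp del: divide_eq_0_iff)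
      then have "adm (\<lambda>p. z (pidx p) / of_nat p)" using g gz by (simp add: adm_def)
      then have "dsum f (\<lambda>p. z (pidx p) / of_nat p) 1 \<noteq> 0" using nz link by simp
      moreover have "dsum f (\<lambda>p. z (pidx p) / of_nat p) 1 = dsum f g 1"
        unfolding dsum_def using gz by (intro infsum_cong arg_cong2[of _ _ _ _ "(*)"] refl cmf_cong) auto
      ultimately show "dsum f g 1 \<noteq> 0" by simp
    qed
  next
    assume a: "\<forall>g. adm g \<longrightarrow> dsum f g 1 \<noteq> 0"
    show "\<forall>z\<in>D0inf. Bohr_lift \<phi> z \<noteq> 0"
    proof
      fix z assume z: "z \<in> D0inf"
      have "{p. prime p \<and> z (pidx p) / of_nat p \<noteq> 0} \<subseteq> nth_prime ` {j. z j \<noteq> 0}"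
      proof
        fix p assume "p \<in> {p. prime p \<and> z (pidx p) / of_nat p \<noteq> 0}"
        then have "prime p" "z (pidx p) \<noteq> 0" by auto
        then show "p \<in> nth_prime ` {j. z j \<noteq> 0}" by (intro image_eqI[of _ _ "pidx p"]) (auto simp: nth_prime_pidx)
      qed
      moreover have "finite (nth_prime ` {j. z j \<noteq> 0})" using z by (simp add: D0inf_def)
      ultimately have "finite {p. prime p \<and> z (pidx p) / of_nat p \<noteq> 0}" by (rule finite_subset)
      moreover have "norm (z (pidx p) / of_nat p) * real p < 1" if "prime p" for p
        using z prime_gt_0_nat[OF that] by (simp add: norm_divide D0inf_def D2inf_def)
      ultimately have "adm (\<lambda>p. z (pidx p) / of_nat p)" by (simp add: adm_def)
      then show "Bohr_lift \<phi> z \<noteq> 0" using a link by simp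
    qed
  qed
qed

lemma BW_eq_Lser:
  assumes "periodic_seq f N" and coeff: "\<And>n. sine_coeff \<phi> n = f n / of_nat n" and s: "Re s > 0"
  shows "BW \<phi> s = periodic_seq.Lser f s"
proof -
  interpret periodic_seq f N by fact
  have eq: "sine_coeff \<phi> n * of_nat n powr (- s) = f n * of_nat n powr (- (1 + s))" if "n > 0" for n
  proof -
    have "of_nat n powr (- (1 + s)) = of_nat n powr (- 1) * (of_nat n powr (- s) :: complex)"
      by (simp add: powr_add[symmetric])
    also have "of_nat n powr (- 1) = (1 / of_nat n :: complex)" using that by (simp add: powr_minus field_simps)
    finally show ?thesis by (simp add: coeff)
  qed
  have "BW \<phi> s = (\<Sum>n. f (Suc n) * of_nat (Suc n) powr (- (1 + s)))"
    unfolding BW_def by (intro suminf_cong eq) simp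
  also have "\<dots> = Lser s"
    unfolding Lser_def using Lser_abs_summable[OF s] by (intro infsum_pos_eq_suminf)
  finally show ?thesis .
qed

theorem theorem1p3:
  fixes \<phi> :: "real \<Rightarrow> complex"
  assumes "step_rat \<phi>"
  shows "(dilation_complete \<phi> \<longleftrightarrow>
            sine_coeff \<phi> 1 \<noteq> 0 \<and> (\<forall>s. 0 < Re s \<longrightarrow> BW \<phi> s \<noteq> 0))
       \<and> (sine_coeff \<phi> 1 \<noteq> 0 \<and> (\<forall>s. 0 < Re s \<longrightarrow> BW \<phi> s \<noteq> 0) \<longleftrightarrow>
            (\<forall>z\<in>D0inf. Bohr_lift \<phi> z \<noteq> 0))
       \<and> ((\<forall>z\<in>D0inf. Bohr_lift \<phi> z \<noteq> 0) \<longleftrightarrow> (\<forall>z\<in>D2inf. Bohr_lift \<phi> z \<noteq> 0))"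
proof -
  obtain f N where L2: "L2 \<phi>" and pq: "periodic_seq f N" and coeff: "\<And>n. sine_coeff \<phi> n = f n / of_nat n"
    using step_rat_L2_periodic[OF assms] by blast
  interpret periodic_seq f N by fact
  have seq: "sine_coeff \<phi> = seq" by (rule ext) (simp add: coeff seq_def)
  have iii: "(\<forall>z\<in>D0inf. Bohr_lift \<phi> z \<noteq> 0) \<longleftrightarrow> (\<forall>g. adm g \<longrightarrow> dsum f g 1 \<noteq> 0)"
    by (rule D0inf_iff_adm[OF pq coeff])
  have ii_iii: "\<forall>g. adm g \<longrightarrow> dsum f g 1 \<noteq> 0" if "sine_coeff \<phi> 1 \<noteq> 0" "\<forall>s. 0 < Re s \<longrightarrow> BW \<phi> s \<noteq> 0"
    using dsum_nonzero_of_Lser_nonzero that by (simp add: BW_eq_Lser[OF pq coeff] coeff)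
  have iii_ii: "sine_coeff \<phi> 1 \<noteq> 0 \<and> (\<forall>s. 0 < Re s \<longrightarrow> BW \<phi> s \<noteq> 0)" if nz: "\<forall>g. adm g \<longrightarrow> dsum f g 1 \<noteq> 0"
  proof -
    have "dsum f (\<lambda>_. 0) 1 \<noteq> 0" using nz adm_zero by blast
    then have "f 1 \<noteq> 0" by (simp add: dsum_zero)
    moreover have "Lser s \<noteq> 0" if "Re s > 0" for s using Lser_nonzero nz that by blast
    ultimately show ?thesis by (simp add: BW_eq_Lser[OF pq coeff] coeff)
  qed
  have iii_i: "dilation_complete \<phi>" if nz: "\<forall>g. adm g \<longrightarrow> dsum f g 1 \<noteq> 0"
  proof (rule dilation_complete_if_dclosure[OF L2])
    show "dclosure (sine_coeff \<phi>) (\<lambda>n. if n = 1 then 1 else 0)"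
      unfolding seq using nz by (intro dclosure_seq_unit) blast
  qed
  have i_iv: "\<forall>z\<in>D2inf. Bohr_lift \<phi> z \<noteq> 0" if "dilation_complete \<phi>"
    using Bohr_lift_nonzero_if_complete[OF that] by blast
  have iv_iii: "\<forall>z\<in>D0inf. Bohr_lift \<phi> z \<noteq> 0" if "\<forall>z\<in>D2inf. Bohr_lift \<phi> z \<noteq> 0"
    using that by (auto simp: D0inf_def)
  \<comment> \<open>The cycle runs (iii), (i), (iv), (iii), with (ii) tied to (iii) in both
    directions.\<close>
  show ?thesis using iii ii_iii iii_ii iii_i i_iv iv_iii by blast
qed

end
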